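(* Let $G$ be a non-elementary hyperbolic group. If $G$ has a growth gap with respect to one finite symmetric generating set, then it has a growth gap with respect to every finite symmetric generating set.
   Context: Hyperbolic means Gromov hyperbolic (in particular finitely generated); a hyperbolic group is non-elementary if it is not virtually cyclic (finite groups being counted as virtually cyclic). For a finite symmetric generating set $S$ of $G$, write $|g|_S$ for the word length of $g\in G$ with respect to $S$, and $B_S(n)=\{g\in G: |g|_S\le n\}$. For a subset $A\subseteq G$, its exponential growth exponent with respect to $S$ is $$\omega_S(A)=\limsup_{n\to\infty}\frac1n\log|A\cap B_S(n)|.$$ In particular, for a subgroup $H<G$, $\omega_S(H)$ is computed with the restriction to $H$ of the word metric of the ambient group $G$. The top growth gap of $(G,S)$ is $$\operatorname{Gap}_S(G)=\omega_S(G)-\sup_{H<G,\ [G:H]=\infty}\omega_S(H),$$ the supremum being over all infinite-index subgroups $H$ of $G$ (not necessarily finitely generated). One says that $G$ has a growth gap with respect to $S$ if $\operatorname{Gap}_S(G)>0$. *)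

theory Defs
  imports "HOL-Algebra.Elementary_Groups" "HOL-Library.Extended_Real"
    "HOL-Library.Liminf_Limsup"
begin

definition finite_symmetric_generating_set :: "('a, 'b) monoid_scheme \<Rightarrow> 'a set \<Rightarrow> bool" where
  "finite_symmetric_generating_set G S \<longleftrightarrow>
     finite S \<and> S \<subseteq> carrier G \<and> (\<forall>s\<in>S. inv\<^bsub>G\<^esub> s \<in> S) \<and> generate G S = carrier G"

(* Words are positive words in S; since S is meant to be symmetric, no inverses are needed.
   The LEAST is meaningful as soon as S generates G. *)
definition word_length :: "('a, 'b) monoid_scheme \<Rightarrow> 'a set \<Rightarrow> 'a \<Rightarrow> nat" where
  "word_length G S g =
     (LEAST n. \<exists>ws. set ws \<subseteq> S \<and> length ws = n \<and> foldr (\<otimes>\<^bsub>G\<^esub>) ws \<one>\<^bsub>G\<^esub> = g)"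

definition word_ball :: "('a, 'b) monoid_scheme \<Rightarrow> 'a set \<Rightarrow> nat \<Rightarrow> 'a set" where
  "word_ball G S n = {g \<in> carrier G. word_length G S g \<le> n}"

definition word_dist :: "('a, 'b) monoid_scheme \<Rightarrow> 'a set \<Rightarrow> 'a \<Rightarrow> 'a \<Rightarrow> real" where
  "word_dist G S x y = real (word_length G S (inv\<^bsub>G\<^esub> x \<otimes>\<^bsub>G\<^esub> y))"

definition gromov_product :: "('a, 'b) monoid_scheme \<Rightarrow> 'a set \<Rightarrow> 'a \<Rightarrow> 'a \<Rightarrow> 'a \<Rightarrow> real" where
  "gromov_product G S w x y =
     (word_dist G S w x + word_dist G S w y - word_dist G S x y) / 2"

(* Gromov's definition of a hyperbolic metric space (the inequality for Gromov products at
   every base point), applied to the group with the word metric of some finite generating set.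
   Symmetry of that set is no restriction, because inverses can be added to it. *)
definition hyperbolic_group :: "('a, 'b) monoid_scheme \<Rightarrow> bool" where
  "hyperbolic_group G \<longleftrightarrow> group G \<and>
     (\<exists>S. finite_symmetric_generating_set G S \<and>
       (\<exists>\<delta>::real. \<forall>w\<in>carrier G. \<forall>x\<in>carrier G. \<forall>y\<in>carrier G. \<forall>z\<in>carrier G.
          gromov_product G S w x z
            \<ge> min (gromov_product G S w x y) (gromov_product G S w y z) - \<delta>))"

(* A finite group is virtually cyclic through its trivial subgroup. *)
definition virtually_cyclic :: "('a, 'b) monoid_scheme \<Rightarrow> bool" where
  "virtually_cyclic G \<longleftrightarrow>
     (\<exists>H. subgroup H G \<and> finite (rcosets\<^bsub>G\<^esub> H) \<and> cyclic_group (G\<lparr>carrier := H\<rparr>))"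

(* The case distinction implements log 0 = -\<infinity>; the real function has ln 0 = 0 instead.
   The value at n = 0 is irrelevant for the limsup. *)
definition growth_exponent :: "('a, 'b) monoid_scheme \<Rightarrow> 'a set \<Rightarrow> 'a set \<Rightarrow> ereal" where
  "growth_exponent G S A =
     limsup (\<lambda>n. if A \<inter> word_ball G S n = {} then - \<infinity>
                 else ereal (ln (real (card (A \<inter> word_ball G S n))) / real n))"

(* The index of H is the cardinality of its set of right cosets. For a finite generating set S
   growth exponents of subgroups lie in [0, \<infinity>), so the ereal subtraction is an ordinary one
   whenever G is infinite (for finite G the supremum is over the empty family). *)
definition top_growth_gap :: "('a, 'b) monoid_scheme \<Rightarrow> 'a set \<Rightarrow> ereal" where
  "top_growth_gap G S =
     growth_exponent G S (carrier G)
       - (SUP H \<in> {H. subgroup H G \<and> infinite (rcosets\<^bsub>G\<^esub> H)}. growth_exponent G S H)"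

definition has_growth_gap :: "('a, 'b) monoid_scheme \<Rightarrow> 'a set \<Rightarrow> bool" where
  "has_growth_gap G S \<longleftrightarrow> top_growth_gap G S > 0"

end

(* For a subgroup H let pi be the permutation representation on finitely supported functions on G/H.
   The uniform spectral gap of these representations over all H of infinite index is a notion independent
   of generating sets, and it is equivalent to a growth gap.

   If S has a growth gap, return probabilities to cosets of H decay: a product of k elements of the ball of
   radius N equals a given g in at most (poly(N) e^(w N/2))^k e^(-w |g|/2) ways, by a Schur test based on
   hyperbolicity. Summing over H and taking k-th roots shows that the uniform measure on the S-ball of
   radius N has norm at most poly(N) e^(-gamma N) on all the functions on G/H.

   Conversely let T have no growth gap, and choose H with growth exponent close to w. Since sphere sizes are
   submultiplicative as operators, there are a unit vector f >= 0 and a large n with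
   |sum_{|h| = j} pi(h) f| >= const e^(w j) for all j <= n. Put u = sum_{|h| <= n} e^(-w |h|) pi(h) f. The part of u
   in the shadow of y is comparable to e^(-w |y|) pi(y) u, so u is a bounded vector valued density.
   An approximate Lebesgue density argument (finding a scale and a cube on which all parts are almost
   parallel) gives <u, pi(x) u> >= c |u|^2 for all x in a ball of arbitrary radius, where c does not depend on
   the radius. This contradicts the decay of the norm on S-balls. *)
theory Submission
  imports Defs "HOL-Analysis.Inner_Product" "HOL-Real_Asymp.Real_Asymp"
begin

section \<open>Word metrics\<close>

text \<open>The order of choices makes the argument close. The constant \<open>c\<close> of almost
  invariance is fixed first; then a radius \<open>N\<close> at which the normalized norm of the
  \<open>S\<close>-ball is below \<open>c\<close>; then the threshold \<open>M\<close> belonging to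
  a \<open>T\<close>-ball that contains this \<open>S\<close>-ball; only then \<open>n\<close> and
  \<open>H\<close>. So \<open>c\<close> must be uniform over radii and representations, and the
  price of a large radius is paid by the size of \<open>norm u\<close> alone. Two word metrics are
  in use at once, and hyperbolicity is needed for both: the Schur test works in \<open>S\<close>,
  the shadows live in \<open>T\<close>. The vector \<open>u\<close> is a Poincare series at the
  critical exponent, cut off at radius \<open>n\<close>. Its norm becomes large because every sphere
  up to radius \<open>n\<close> contributes a definite amount and positivity forbids cancellation;
  truncation errors are then negligible, in the spirit of Patterson's construction. Positivity also
  turns inclusions of index sets into inequalities of norms, hence the cone. The bound
  \<open>C1 * exp (\<omega> * k)\<close> for spheres, which balances the weights, comes from the
  same shadow estimates applied to the trivial representation.\<close>

locale word_metric = group G for G (structure) +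
  fixes S
  assumes gens: "finite_symmetric_generating_set G S"
begin

abbreviation len where "len \<equiv> word_length G S"

definition wprod where "wprod ws = foldr (\<otimes>) ws \<one>"

lemma finite_gens: "finite S"
  and gens_carrier: "S \<subseteq> carrier G"
  and gens_inv: "s \<in> S \<Longrightarrow> inv s \<in> S"
  and gens_generate: "generate G S = carrier G"
  using gens by (auto simp: finite_symmetric_generating_set_def)

lemma wprod_Nil [simp]: "wprod [] = \<one>"
  and wprod_Cons [simp]: "wprod (x # xs) = x \<otimes> wprod xs"
  by (simp_all add: wprod_def)

lemma wprod_closed: "set ws \<subseteq> S \<Longrightarrow> wprod ws \<in> carrier G"
  using gens_carrier by (induction ws) auto

lemma wprod_append: "set us \<subseteq> S \<Longrightarrow> set vs \<subseteq> S \<Longrightarrow> wprod (us @ vs) = wprod us \<otimes> wprod vs"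
proof (induction us)
  case (Cons a us)
  then show ?case
    using gens_carrier wprod_closed by (auto simp: m_assoc)
qed (auto simp: wprod_closed)

lemma wprod_inv: "set ws \<subseteq> S \<Longrightarrow> \<exists>vs. set vs \<subseteq> S \<and> length vs = length ws \<and> wprod vs = inv (wprod ws)"
proof (induction ws)
  case (Cons a ws)
  then obtain vs where vs: "set vs \<subseteq> S" "length vs = length ws" "wprod vs = inv (wprod ws)"
    by auto
  have "inv a \<in> S" "a \<in> carrier G" using Cons.prems gens_inv gens_carrier by auto
  then have "wprod (vs @ [inv a]) = inv (wprod (a # ws))"
    using Cons.prems vs wprod_append[of vs "[inv a]"] wprod_closed[of ws] by (simp add: inv_mult_group)
  then show ?case
    using vs \<open>inv a \<in> S\<close> by (intro exI[of _ "vs @ [inv a]"]) auto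
qed simp

lemma ex_word: "g \<in> carrier G \<Longrightarrow> \<exists>ws. set ws \<subseteq> S \<and> wprod ws = g"
proof -
  assume "g \<in> carrier G"
  then have "g \<in> generate G S" using gens_generate by simp
  then show ?thesis
  proof induction
    case one show ?case by (intro exI[of _ "[]"]) simp
  next
    case (incl h) then show ?case using gens_carrier by (intro exI[of _ "[h]"]) auto
  next
    case (inv h) then show ?case using gens_carrier gens_inv[of h] by (intro exI[of _ "[inv h]"]) auto
  next
    case (eng h1 h2)
    then show ?case using wprod_append by (metis le_sup_iff set_append)
  qed
qed

lemma len_eq: "len g = (LEAST n. \<exists>ws. set ws \<subseteq> S \<and> length ws = n \<and> wprod ws = g)"
  by (simp add: word_length_def wprod_def)

lemma len_le: "set ws \<subseteq> S \<Longrightarrow> len (wprod ws) \<le> length ws"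
  unfolding len_eq by (rule Least_le) auto

lemma ex_min_word:
  assumes "g \<in> carrier G"
  obtains ws where "set ws \<subseteq> S" "length ws = len g" "wprod ws = g"
proof -
  obtain ws where "set ws \<subseteq> S" "wprod ws = g" using ex_word[OF assms] by auto
  then have "\<exists>n. \<exists>ws. set ws \<subseteq> S \<and> length ws = n \<and> wprod ws = g" by auto
  from LeastI_ex[OF this] show ?thesis using that unfolding len_eq by auto
qed

lemma len_one [simp]: "len \<one> = 0"
  using len_le[of "[]"] by simp

lemma len_eq_0: "g \<in> carrier G \<Longrightarrow> len g = 0 \<longleftrightarrow> g = \<one>"
  by (metis ex_min_word len_one length_0_conv wprod_Nil)

lemma len_mult: "g \<in> carrier G \<Longrightarrow> h \<in> carrier G \<Longrightarrow> len (g \<otimes> h) \<le> len g + len h"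
proof -
  assume g: "g \<in> carrier G" and h: "h \<in> carrier G"
  obtain us where us: "set us \<subseteq> S" "length us = len g" "wprod us = g" using ex_min_word[OF g] .
  obtain vs where vs: "set vs \<subseteq> S" "length vs = len h" "wprod vs = h" using ex_min_word[OF h] .
  show ?thesis using len_le[of "us @ vs"] us vs wprod_append[of us vs] by auto
qed

lemma len_inv_le: "g \<in> carrier G \<Longrightarrow> len (inv g) \<le> len g"
  by (metis ex_min_word wprod_inv len_le)

lemma len_inv [simp]: "g \<in> carrier G \<Longrightarrow> len (inv g) = len g"
  by (metis antisym inv_closed inv_inv len_inv_le)

lemma len_inv_mult_commute: "g \<in> carrier G \<Longrightarrow> h \<in> carrier G \<Longrightarrow> len (inv g \<otimes> h) = len (inv h \<otimes> g)"
  by (metis inv_closed inv_inv inv_mult_group len_inv m_closed)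

text \<open>Stands in for geodesic segments: a shortest word is cut after \<open>i\<close> letters,
  and the triangle inequality forces both pieces to be shortest.\<close>

lemma geodesic_point:
  assumes "g \<in> carrier G" "i \<le> len g"
  obtains y where "y \<in> carrier G" "len y = i" "len (inv y \<otimes> g) = len g - i"
proof -
  obtain ws where ws: "set ws \<subseteq> S" "length ws = len g" "wprod ws = g" using ex_min_word[OF assms(1)] .
  have sub: "set (take i ws) \<subseteq> S" "set (drop i ws) \<subseteq> S"
    using ws(1) by (meson dual_order.trans set_take_subset set_drop_subset)+
  define y z where "y = wprod (take i ws)" "z = wprod (drop i ws)"
  have yz: "y \<in> carrier G" "z \<in> carrier G" "g = y \<otimes> z"
    using sub wprod_append[OF sub] ws(3) by (auto simp: y_z_def wprod_closed)
  then have z: "inv y \<otimes> g = z" by (simp add: inv_solve_left')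
  have "len y \<le> i" "len z \<le> len g - i"
    using len_le[OF sub(1)] len_le[OF sub(2)] ws(2) assms(2) by (auto simp: y_z_def)
  moreover have "len g \<le> len y + len z" using yz len_mult by simp
  ultimately show ?thesis using that[OF yz(1)] z assms(2) by auto
qed

abbreviation "B \<equiv> word_ball G S"

definition Sph where "Sph n = {g \<in> carrier G. len g = n}"

lemma in_B: "g \<in> B n \<longleftrightarrow> g \<in> carrier G \<and> len g \<le> n"
  by (simp add: word_ball_def)

lemma in_Sph: "g \<in> Sph n \<longleftrightarrow> g \<in> carrier G \<and> len g = n"
  by (simp add: Sph_def)

lemma finite_B [simp, intro]: "finite (B n)"
proof -
  have "B n \<subseteq> wprod ` {ws. set ws \<subseteq> S \<and> length ws \<le> n}"
  proof
    fix g assume "g \<in> B n"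
    then have g: "g \<in> carrier G" "len g \<le> n" by (auto simp: in_B)
    obtain ws where "set ws \<subseteq> S" "length ws = len g" "wprod ws = g" using ex_min_word[OF g(1)] .
    then show "g \<in> wprod ` {ws. set ws \<subseteq> S \<and> length ws \<le> n}" using g by auto
  qed
  then show ?thesis
    using finite_lists_length_le[OF finite_gens] finite_subset by blast
qed

lemma B_carrier: "B n \<subseteq> carrier G" by (auto simp: in_B)
lemma one_in_B [simp]: "\<one> \<in> B n" by (simp add: in_B)
lemma B_mono: "m \<le> n \<Longrightarrow> B m \<subseteq> B n" by (auto simp: in_B)
lemma Sph_subset_B: "Sph n \<subseteq> B n" by (auto simp: in_B in_Sph)
lemma finite_Sph [simp, intro]: "finite (Sph n)" using finite_subset[OF Sph_subset_B] by auto
lemma card_B_pos: "card (B n) > 0" using one_in_B card_gt_0_iff by blast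

lemma B_UN_Sph: "B n = (\<Union>j\<le>n. Sph j)" by (auto simp: in_B in_Sph)

lemma sum_B_Sph: "sum f (B n) = (\<Sum>j\<le>n. sum f (Sph j))"
  unfolding B_UN_Sph by (rule sum.UNION_disjoint) (auto simp: in_Sph)

lemma card_B_add: "card (B (m + n)) \<le> card (B m) * card (B n)"
proof -
  have "B (m + n) \<subseteq> (\<lambda>(x, y). x \<otimes> y) ` (B m \<times> B n)"
  proof
    fix g assume "g \<in> B (m + n)"
    then have g: "g \<in> carrier G" "len g \<le> m + n" by (auto simp: in_B)
    obtain y where y: "y \<in> carrier G" "len y = min m (len g)" "len (inv y \<otimes> g) = len g - min m (len g)"
      using geodesic_point[OF g(1), of "min m (len g)"] by auto
    have "(y, inv y \<otimes> g) \<in> B m \<times> B n" using y g by (auto simp: in_B)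
    moreover have "g = y \<otimes> (inv y \<otimes> g)" using y g by (simp add: m_assoc[symmetric])
    ultimately show "g \<in> (\<lambda>(x, y). x \<otimes> y) ` (B m \<times> B n)" by force
  qed
  then have "card (B (m + n)) \<le> card ((\<lambda>(x, y). x \<otimes> y) ` (B m \<times> B n))"
    by (intro card_mono) auto
  also have "\<dots> \<le> card (B m \<times> B n)" by (intro card_image_le) auto
  finally show ?thesis by (simp add: card_cartesian_product)
qed

lemma card_B_mult: "card (B (q * n)) \<le> card (B n) ^ q"
proof (induction q)
  case 0
  have "B 0 = {\<one>}" using len_eq_0 by (auto simp: in_B)
  then show ?case by simp
next
  case (Suc q)
  have "card (B (Suc q * n)) \<le> card (B n) * card (B (q * n))"
    using card_B_add[of n "q * n"] by simp
  also have "\<dots> \<le> card (B n) * card (B n) ^ q" using Suc by simp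
  finally show ?case by simp
qed

lemma card_left_translate_B:
  assumes "g \<in> carrier G" shows "card ((\<otimes>) g ` B n) = card (B n)"
  by (rule card_image) (use assms in \<open>auto simp: inj_on_def in_B\<close>)

text \<open>Gromov product based at \<open>\<one>\<close>. It measures how long geodesics from
  \<open>\<one>\<close> to \<open>x\<close> and to \<open>y\<close> stay together; by left
  invariance this base point represents all others.\<close>

definition gp where "gp x y = (real (len x) + real (len y) - real (len (inv x \<otimes> y))) / 2"

lemma gp_commute: "x \<in> carrier G \<Longrightarrow> y \<in> carrier G \<Longrightarrow> gp x y = gp y x"
  by (simp add: gp_def len_inv_mult_commute)

lemma gp_self: "x \<in> carrier G \<Longrightarrow> gp x x = len x"
  by (simp add: gp_def)

lemma len_inv_mult_gp: "real (len (inv x \<otimes> y)) = real (len x) + real (len y) - 2 * gp x y"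
proof -
  have "2 * gp x y = real (len x) + real (len y) - real (len (inv x \<otimes> y))"
    unfolding gp_def by simp
  then show ?thesis by linarith
qed

lemma len_diff:
  assumes "x \<in> carrier G" "y \<in> carrier G"
  shows "len y \<le> len x + len (inv x \<otimes> y)" "len x \<le> len y + len (inv x \<otimes> y)"
proof -
  have "y = x \<otimes> (inv x \<otimes> y)" using assms by (simp add: m_assoc[symmetric])
  then show "len y \<le> len x + len (inv x \<otimes> y)" using len_mult[of x "inv x \<otimes> y"] assms by auto
  have "x = y \<otimes> (inv y \<otimes> x)" using assms by (simp add: m_assoc[symmetric])
  then have "len x \<le> len y + len (inv y \<otimes> x)" using len_mult[of y "inv y \<otimes> x"] assms by auto
  then show "len x \<le> len y + len (inv x \<otimes> y)" using len_inv_mult_commute assms by auto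
qed

lemma gp_le_left: "x \<in> carrier G \<Longrightarrow> y \<in> carrier G \<Longrightarrow> gp x y \<le> len x"
  using len_diff[of x y] by (simp add: gp_def)

lemma gp_le_right: "x \<in> carrier G \<Longrightarrow> y \<in> carrier G \<Longrightarrow> gp x y \<le> len y"
  using len_diff[of x y] by (simp add: gp_def)

lemma gp_nonneg: "x \<in> carrier G \<Longrightarrow> y \<in> carrier G \<Longrightarrow> gp x y \<ge> 0"
  using len_mult[of "inv x" y] by (simp add: gp_def)

lemma gp_mult:
  assumes "x \<in> carrier G" "z \<in> carrier G"
  shows "gp x (x \<otimes> z) = (len x + real (len (x \<otimes> z)) - len z) / 2"
proof -
  have "inv x \<otimes> (x \<otimes> z) = z" using assms by (simp add: m_assoc[symmetric])
  then show ?thesis by (simp add: gp_def)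
qed

lemma gp_geodesic:
  assumes "g \<in> carrier G" "len (inv y \<otimes> g) = len g - i" "len y = i" "i \<le> len g"
  shows "gp y g = i"
  using assms by (simp add: gp_def of_nat_diff)

end

section \<open>Hyperbolicity does not depend on the generating set\<close>

lemma linear_less_power:
  fixes r a b :: real
  assumes "r > 1"
  shows "\<exists>n0. \<forall>n\<ge>n0. a * real n + b < r ^ n"
proof -
  have "(\<lambda>n. a * (real n * (1/r) ^ n) + b * (1/r) ^ n) \<longlonglongrightarrow> a * 0 + b * 0"
    using assms by (intro tendsto_intros powser_times_n_limit_0 LIMSEQ_realpow_zero) auto
  then have "eventually (\<lambda>n. a * (real n * (1/r) ^ n) + b * (1/r) ^ n < 1) sequentially"
    by (rule order_tendstoD) auto
  then obtain n0 where n0: "\<And>n. n \<ge> n0 \<Longrightarrow> a * (real n * (1/r) ^ n) + b * (1/r) ^ n < 1"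
    by (auto simp: eventually_sequentially)
  have "a * real n + b < r ^ n" if "n \<ge> n0" for n
  proof -
    have "r ^ n > 0" using assms by simp
    have "a * (real n * (1/r) ^ n) + b * (1/r) ^ n = (a * real n + b) / r ^ n"
      by (simp add: power_one_over add_divide_distrib)
    then show ?thesis using n0[OF that] \<open>r ^ n > 0\<close> by (simp add: pos_divide_less_eq)
  qed
  then show ?thesis by auto
qed

context word_metric begin

definition d where "d x y = real (len (inv x \<otimes> y))"

lemma d_nonneg [simp]: "d x y \<ge> 0" by (simp add: d_def)
lemma d_self [simp]: "x \<in> carrier G \<Longrightarrow> d x x = 0" by (simp add: d_def)
lemma d_commute: "x \<in> carrier G \<Longrightarrow> y \<in> carrier G \<Longrightarrow> d x y = d y x"
  by (simp add: d_def len_inv_mult_commute)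

lemma d_triangle:
  assumes "x \<in> carrier G" "y \<in> carrier G" "z \<in> carrier G" shows "d x z \<le> d x y + d y z"
proof -
  have "inv x \<otimes> z = (inv x \<otimes> y) \<otimes> (inv y \<otimes> z)"
    using assms by (metis inv_closed inv_solve_left m_assoc m_closed)
  then have "len (inv x \<otimes> z) \<le> len (inv x \<otimes> y) + len (inv y \<otimes> z)"
    using len_mult[of "inv x \<otimes> y" "inv y \<otimes> z"] assms by simp
  then show ?thesis by (simp add: d_def)
qed

lemma d_translate:
  assumes "w \<in> carrier G" "x \<in> carrier G" "y \<in> carrier G"
  shows "inv (inv w \<otimes> x) \<otimes> (inv w \<otimes> y) = inv x \<otimes> y"
  using assms by (simp add: inv_mult_group m_assoc inv_solve_left)
     (metis inv_closed l_cancel_one' m_assoc m_closed r_inv r_one inv_solve_left)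

lemma d_point:
  assumes "x \<in> carrier G" "y \<in> carrier G" "i \<le> len (inv x \<otimes> y)"
  obtains z where "z \<in> carrier G" "d x z = i" "d z y = d x y - i"
proof -
  obtain q where q: "q \<in> carrier G" "len q = i" "len (inv q \<otimes> (inv x \<otimes> y)) = len (inv x \<otimes> y) - i"
    using geodesic_point[of "inv x \<otimes> y" i] assms by auto
  have "inv x \<otimes> (x \<otimes> q) = q" using assms q by (simp add: m_assoc[symmetric])
  moreover have "inv (x \<otimes> q) \<otimes> y = inv q \<otimes> (inv x \<otimes> y)"
    using assms q by (simp add: inv_mult_group m_assoc)
  ultimately show ?thesis using that[of "x \<otimes> q"] q assms by (simp add: d_def of_nat_diff)
qed

lemma bilipschitz:
  assumes "finite_symmetric_generating_set G T"
  shows "\<exists>lam\<ge>1. \<forall>g\<in>carrier G. len g \<le> lam * word_length G T g"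
proof -
  interpret T: word_metric G T by standard (rule assms)
  define lam where "lam = Suc (\<Sum>t\<in>T. len t)"
  have *: "len (T.wprod ws) \<le> lam * length ws" if "set ws \<subseteq> T" for ws
    using that
  proof (induction ws)
    case (Cons t ws)
    then have t: "t \<in> T" "t \<in> carrier G" "T.wprod ws \<in> carrier G"
      using T.gens_carrier T.wprod_closed by auto
    have "len t \<le> (\<Sum>t\<in>T. len t)" using T.finite_gens t by (intro member_le_sum) auto
    then have "len t \<le> lam" by (simp add: lam_def)
    then show ?case using len_mult[of t "T.wprod ws"] t Cons by auto
  qed simp
  have "len g \<le> lam * T.len g" if "g \<in> carrier G" for g
    using T.ex_min_word[OF that] * by metis
  then show ?thesis by (intro exI[of _ lam]) (auto simp: lam_def)
qed

end

section \<open>The four-point condition and quasi-geodesics\<close>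

locale hyperbolic_metric = word_metric +
  fixes \<delta> :: real
  assumes \<delta>_nonneg: "\<delta> \<ge> 0"
    and hyp: "\<lbrakk>x \<in> carrier G; y \<in> carrier G; z \<in> carrier G\<rbrakk> \<Longrightarrow> min (gp x y) (gp y z) - \<delta> \<le> gp x z"
begin

definition gpm where "gpm m x y = (d m x + d m y - d x y) / 2"

lemma gpm_gp: "m \<in> carrier G \<Longrightarrow> x \<in> carrier G \<Longrightarrow> y \<in> carrier G \<Longrightarrow>
    gpm m x y = gp (inv m \<otimes> x) (inv m \<otimes> y)"
  by (simp add: gpm_def gp_def d_def d_translate)

text \<open>Left translation by \<open>inv m\<close> moves the base point to \<open>\<one>\<close>,
  where the locale assumes the inequality.\<close>

lemma gpm_hyp:
  assumes "m \<in> carrier G" "x \<in> carrier G" "y \<in> carrier G" "z \<in> carrier G"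
  shows "min (gpm m x y) (gpm m y z) - \<delta> \<le> gpm m x z"
  using assms by (simp only: gpm_gp) (intro hyp m_closed inv_closed)

lemma gpm_commute: "x \<in> carrier G \<Longrightarrow> y \<in> carrier G \<Longrightarrow> gpm m x y = gpm m y x"
  by (simp add: gpm_def d_commute)

text \<open>Twice \<open>gpm_hyp\<close> at the base point \<open>w\<close>, with the Gromov
  products expanded. In this form the three pairings of four points can be permuted freely.\<close>

lemma four_points:
  assumes "w \<in> carrier G" "x \<in> carrier G" "y \<in> carrier G" "z \<in> carrier G"
  shows "d x z + d w y \<le> max (d x y + d w z) (d y z + d w x) + 2 * \<delta>"
  using gpm_hyp[OF assms] unfolding gpm_def min_def max_def by argo

text \<open>Bisection: the chain is split at its midpoint \<open>k\<close> times, and each splitting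
  costs one \<delta>. The loss is thus logarithmic in the length of the chain, which is the source
  of exponential divergence.\<close>

lemma chain_power:
  assumes "m \<in> carrier G" "\<And>i. i \<le> 2 ^ k \<Longrightarrow> s i \<in> carrier G"
    and "\<And>i. i < 2 ^ k \<Longrightarrow> c \<le> gpm m (s i) (s (Suc i))"
  shows "c - real k * \<delta> \<le> gpm m (s 0) (s (2 ^ k))"
  using assms(2,3)
proof (induction k arbitrary: s)
  case 0
  then show ?case by auto
next
  case (Suc k)
  have 1: "c - real k * \<delta> \<le> gpm m (s 0) (s (2 ^ k))"
    using Suc.prems by (intro Suc.IH) auto
  have 2: "c - real k * \<delta> \<le> gpm m (s (2 ^ k + 0)) (s (2 ^ k + 2 ^ k))"
  proof (rule Suc.IH[of "\<lambda>i. s (2 ^ k + i)"])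
    show "s (2 ^ k + i) \<in> carrier G" if "i \<le> 2 ^ k" for i using Suc.prems(1)[of "2 ^ k + i"] that by auto
    show "c \<le> gpm m (s (2 ^ k + i)) (s (2 ^ k + Suc i))" if "i < 2 ^ k" for i
      using Suc.prems(2)[of "2 ^ k + i"] that by auto
  qed
  have e: "(2::nat) ^ Suc k = 2 ^ k + 2 ^ k" by simp
  have "min (gpm m (s 0) (s (2 ^ k))) (gpm m (s (2 ^ k)) (s (2 ^ Suc k))) - \<delta> \<le> gpm m (s 0) (s (2 ^ Suc k))"
    using Suc.prems(1) assms(1) by (intro gpm_hyp) auto
  then show ?case using 1 2 unfolding e by (simp add: algebra_simps)
qed

lemma chain_log:
  assumes "m \<in> carrier G" "\<And>i. i \<le> N \<Longrightarrow> s i \<in> carrier G"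
    and "\<And>i. i < N \<Longrightarrow> c \<le> gpm m (s i) (s (Suc i))" and N: "1 \<le> N" "N \<le> 2 ^ k"
  shows "c - real k * \<delta> \<le> gpm m (s 0) (s N)"
proof -
  \<comment> \<open>The chain is prolonged to \<open>2 ^ k\<close> steps by repeating its last
    point. The repeated steps require \<open>c \<le> d m (s N)\<close>, because
    \<open>gpm m x x = d m x\<close>.\<close>
  define s' where "s' i = s (min i N)" for i
  have end_far: "c \<le> d m (s N)"
  proof -
    have "c \<le> gpm m (s (N - 1)) (s N)" using assms(3)[of "N - 1"] N by simp
    also have "\<dots> \<le> d m (s N)"
      using d_triangle[of m "s N" "s (N - 1)"] assms(1) assms(2)[of N] assms(2)[of "N - 1"] d_commute
      by (simp add: gpm_def)
    finally show ?thesis .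
  qed
  have "c \<le> gpm m (s' i) (s' (Suc i))" if "i < 2 ^ k" for i
  proof (cases "i < N")
    case True then show ?thesis using assms(3)[of i] by (simp add: s'_def min_def)
  next
    case False
    then have "s' i = s N" "s' (Suc i) = s N" by (auto simp: s'_def)
    then show ?thesis using end_far assms(2)[of N] by (simp add: gpm_def)
  qed
  then have "c - real k * \<delta> \<le> gpm m (s' 0) (s' (2 ^ k))"
    using assms(1,2) by (intro chain_power) (auto simp: s'_def)
  then show ?thesis using N by (simp add: s'_def min_def split: if_splits)
qed

text \<open>Only half of the Morse lemma is needed: points between the end points of a quasi-geodesic are
  close to the quasi-geodesic. A point at maximal distance \<open>D\<close> is cut off by a detour of length
  linear in \<open>D\<close> that avoids the ball of radius \<open>D\<close> around it.\<close>

lemma morse_half: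
  fixes lam :: nat and C0 :: real
  assumes lam: "1 \<le> lam" and C0: "0 \<le> C0"
  shows "\<exists>D0. \<forall>c l m. (\<forall>i\<le>l. c i \<in> carrier G) \<longrightarrow> m \<in> carrier G \<longrightarrow>
     (\<forall>i j. i \<le> j \<longrightarrow> j \<le> l \<longrightarrow> real (j - i) \<le> lam * d (c i) (c j)) \<longrightarrow>
     (\<forall>i<l. d (c i) (c (Suc i)) \<le> lam) \<longrightarrow>
     d (c 0) m + d m (c l) \<le> d (c 0) (c l) + C0 \<longrightarrow> (\<exists>i\<le>l. d m (c i) \<le> D0)"
proof -
  \<comment> \<open>\<open>q\<close> sets the bisection depth \<open>k = D div q\<close>: then
    \<open>k * \<delta> \<le> D / 2\<close>, while \<open>2 ^ k\<close> is exponential in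
    \<open>D\<close> and overtakes the linear length of the detour.\<close>
  define q :: nat where "q = nat \<lceil>2 * \<delta>\<rceil> + 2"
  have q: "2 * \<delta> \<le> q" "q > 0" unfolding q_def by linarith+
  obtain e0 where e0: "\<And>e. e \<ge> e0 \<Longrightarrow> (6 * real lam * real q) * real e + (6 * real lam * real q + 2) < 2 ^ e"
    using linear_less_power[of 2 "6 * real lam * real q" "6 * real lam * real q + 2"] by auto
  define D0 :: real where "D0 = max (real (e0 * q)) (2 * real lam + C0 + 1)"
  have big: "\<exists>k. real D - lam - real k * \<delta> > C0 / 2 \<and> 6 * real lam * D + 2 \<le> 2 ^ k" if "real D > D0" for D :: nat
  proof (intro exI[of _ "D div q"] conjI)
    have "e0 * q < D" using that by (simp add: D0_def flip: of_nat_mult)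
    then have "e0 \<le> D div q" using q by (simp add: less_eq_div_iff_mult_less_eq)
    from e0[OF this] have "6 * real lam * (real q * (real (D div q) + 1)) + 2 < 2 ^ (D div q)"
      by (simp add: algebra_simps)
    moreover have "real D \<le> real q * (real (D div q) + 1)"
    proof -
      have "D \<le> q * (D div q + 1)" using q dividend_less_times_div[of q D] by simp
      then show ?thesis by (metis of_nat_1 of_nat_add of_nat_le_iff of_nat_mult)
    qed
    then have "6 * real lam * real D \<le> 6 * real lam * (real q * (real (D div q) + 1))"
      by (intro mult_left_mono) auto
    ultimately show "6 * real lam * D + 2 \<le> 2 ^ (D div q)" by linarith
    have "real (D div q) * (2 * \<delta>) \<le> real (D div q) * q" using q by (intro mult_left_mono) auto
    also have "\<dots> \<le> real D" by (metis of_nat_le_iff of_nat_mult div_times_less_eq_dividend)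
    finally show "real D - lam - real (D div q) * \<delta> > C0 / 2" using that by (simp add: D0_def)
  qed
  have "\<exists>i\<le>l. d m (c i) \<le> D0"
    if c: "\<And>i. i \<le> l \<Longrightarrow> c i \<in> carrier G" and m: "m \<in> carrier G"
      and c1: "\<And>i j. i \<le> j \<Longrightarrow> j \<le> l \<Longrightarrow> real (j - i) \<le> lam * d (c i) (c j)"
      and c2: "\<And>i. i < l \<Longrightarrow> d (c i) (c (Suc i)) \<le> lam"
      and bet: "d (c 0) m + d m (c l) \<le> d (c 0) (c l) + C0" for c l m
  proof -
    \<comment> \<open>Extremal principle: among all points almost between the end points,
      \<open>p\<close> is chosen farthest from the curve. Distances are natural numbers, so
      boundedness suffices for a maximum.\<close>
    define M where "M = {m \<in> carrier G. d (c 0) m + d m (c l) \<le> d (c 0) (c l) + C0}"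
    define dist where "dist m = Min ((\<lambda>i. len (inv m \<otimes> c i)) ` {..l})" for m
    have dist_le: "dist p \<le> len (inv p \<otimes> c i)" if "i \<le> l" for p i
      unfolding dist_def using that by (intro Min_le) auto
    have dist_att: "\<exists>i\<le>l. dist p = len (inv p \<otimes> c i)" for p
    proof -
      have "dist p \<in> (\<lambda>i. len (inv p \<otimes> c i)) ` {..l}" unfolding dist_def by (intro Min_in) auto
      then show ?thesis by auto
    qed
    have "\<exists>p. p \<in> M \<and> (\<forall>p'. p' \<in> M \<longrightarrow> dist p' \<le> dist p)"
    proof (rule ex_has_greatest_nat[of "\<lambda>p. p \<in> M" m])
      show "m \<in> M" using m bet by (simp add: M_def)
      show "\<forall>p. p \<in> M \<longrightarrow> dist p < Suc (nat \<lceil>d (c 0) (c l) + C0\<rceil>)"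
      proof (intro allI impI)
        fix p assume p: "p \<in> M"
        have "real (dist p) \<le> d p (c 0)" using dist_le[of 0 p] by (simp add: d_def)
        also have "\<dots> = d (c 0) p" using p c[of 0] by (auto simp: M_def intro: d_commute)
        also have "\<dots> \<le> d (c 0) (c l) + C0" using p d_nonneg[of p "c l"] unfolding M_def mem_Collect_eq by linarith
        finally show "dist p < Suc (nat \<lceil>d (c 0) (c l) + C0\<rceil>)" by linarith
      qed
    qed
    then obtain p where p: "p \<in> M" and pmax: "\<And>p'. p' \<in> M \<Longrightarrow> dist p' \<le> dist p" by auto
    define D where "D = dist p"
    have pc: "p \<in> carrier G" using p by (simp add: M_def)
    have Dle: "real D \<le> d p (c i)" if "i \<le> l" for i using dist_le[OF that, of p] by (simp add: D_def d_def)
    have c0: "c 0 \<in> carrier G" and cl: "c l \<in> carrier G" using c by auto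
    have pbet: "d (c 0) p + d p (c l) \<le> d (c 0) (c l) + C0" using p by (simp add: M_def)
    \<comment> \<open>Walk from \<open>p\<close> towards an end point by \<open>2 * D\<close>. The
      new point is still almost between the end points, so maximality keeps it within
      \<open>D\<close> of the curve. An end point nearer than \<open>2 * D\<close> serves
      itself.\<close>
    have near: "\<exists>p' i. p' \<in> carrier G \<and> i \<le> l \<and> d p' (c i) \<le> D \<and> d p p' \<le> 2 * D \<and> D \<le> gpm p p' (c i)
        \<and> d p p' + d p' e = d p e"
      if e: "e = c 0 \<or> e = c l" for e
    proof -
      have ec: "e \<in> carrier G" using e c0 cl by auto
      obtain ie where ie: "ie \<le> l" "e = c ie" using e by auto
      show ?thesis
      proof (cases "2 * D \<le> len (inv p \<otimes> e)")
        case False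
        then have "d p e \<le> 2 * D" by (simp add: d_def)
        moreover have "gpm p e (c ie) = d p e" using ie ec pc by (simp add: gpm_def)
        ultimately show ?thesis using ie ec pc Dle[of ie] by (intro exI[of _ e] exI[of _ ie]) auto
      next
        case True
        obtain p' where p': "p' \<in> carrier G" "d p p' = real (2 * D)" "d p' e = d p e - real (2 * D)"
          using d_point[OF pc ec True] by auto
        have "p' \<in> M"
        proof -
          note t = d_triangle[OF p'(1) pc cl] d_triangle[OF c0 pc p'(1)]
            d_commute[OF pc c0] d_commute[OF pc p'(1)] d_commute[OF p'(1) c0]
          have "d (c 0) p' + d p' (c l) \<le> d (c 0) p + d p (c l)"
            using e
          proof
            assume "e = c 0" then show ?thesis using t p'(2) p'(3)[unfolded \<open>e = c 0\<close>] by linarith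
          next
            assume "e = c l" then show ?thesis using t p'(2) p'(3)[unfolded \<open>e = c l\<close>] by linarith
          qed
          then show ?thesis using pbet p' by (simp add: M_def)
        qed
        then have "dist p' \<le> D" using pmax D_def by simp
        moreover obtain i where i: "i \<le> l" "dist p' = len (inv p' \<otimes> c i)" using dist_att by auto
        ultimately have "d p' (c i) \<le> D" by (simp add: d_def)
        moreover have "d p p' \<le> d p (c i) + d p' (c i)"
          using d_triangle[OF pc c[OF i(1)] p'(1)] d_commute[OF p'(1) c[OF i(1)]] by simp
        ultimately show ?thesis using p' i by (intro exI[of _ p'] exI[of _ i]) (auto simp: gpm_def)
      qed
    qed
    obtain y i where y: "y \<in> carrier G" "i \<le> l" "d y (c i) \<le> D" "d p y \<le> 2 * D" "D \<le> gpm p y (c i)"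
        "d p y + d y (c 0) = d p (c 0)" using near[of "c 0"] by auto
    obtain z j where z: "z \<in> carrier G" "j \<le> l" "d z (c j) \<le> D" "d p z \<le> 2 * D" "D \<le> gpm p z (c j)"
        "d p z + d z (c l) = d p (c l)" using near[of "c l"] by auto
    \<comment> \<open>\<open>p\<close> lies almost between the end points, with \<open>y\<close> and
      \<open>z\<close> on its two sides.\<close>
    have yz: "gpm p y z \<le> C0 / 2"
    proof -
      have "d (c 0) (c l) \<le> d (c 0) y + d y z + d z (c l)"
        using d_triangle[OF c0 y(1) cl] d_triangle[OF y(1) z(1) cl] by simp
      then show ?thesis using pbet y(6) z(6) d_commute[OF pc c0] d_commute[OF y(1) c0] by (simp add: gpm_def)
    qed
    \<comment> \<open>The detour runs from \<open>y\<close> to \<open>c i\<close>, along the curve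
      to \<open>c j\<close>, and on to \<open>z\<close>. Seen from \<open>p\<close> all its steps
      have Gromov product at least \<open>D - lam\<close>, whereas \<open>y\<close> and
      \<open>z\<close> have a small one; \<open>chain_log\<close> rules this out for
      \<open>D > D0\<close>.\<close>
    have detour: "\<not> real D > D0" if ij: "i \<le> j" "j \<le> l" and y: "y \<in> carrier G" "d y (c i) \<le> D" "d p y \<le> 2 * D" "D \<le> gpm p y (c i)"
        and z: "z \<in> carrier G" "d z (c j) \<le> D" "d p z \<le> 2 * D" "D \<le> gpm p z (c j)" and yz: "gpm p y z \<le> C0 / 2"
      for i j y z
    proof
      assume "real D > D0"
      from big[OF this] obtain k where k: "real D - lam - real k * \<delta> > C0 / 2" "6 * real lam * D + 2 \<le> 2 ^ k" by auto
      define s where "s t = (if t = 0 then y else if t \<le> j - i + 1 then c (i + t - 1) else z)" for t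
      define N where "N = j - i + 2"
      have ci: "c i \<in> carrier G" "c j \<in> carrier G" using c ij by auto
      have "d (c i) (c j) \<le> d (c i) y + (d y p + d p z) + d z (c j)"
        using d_triangle[OF ci(1) y(1) ci(2)] d_triangle[OF y(1) z(1) ci(2)] d_triangle[OF y(1) pc z(1)] by simp
      also have "\<dots> \<le> 6 * D" using y z d_commute[OF ci(1) y(1)] d_commute[OF y(1) pc] by simp
      finally have "real (j - i) \<le> lam * (6 * D)"
        using order_trans[OF c1[OF ij] mult_left_mono] by simp
      then have "real N \<le> 6 * real lam * D + 2" by (simp add: N_def)
      then have "real N \<le> 2 ^ k" using k by linarith
      then have "N \<le> 2 ^ k" using of_nat_le_iff[of N "2 ^ k", where ?'a = real] by simp
      then have N: "1 \<le> N" "N \<le> 2 ^ k" by (simp_all add: N_def)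
      have "(real D - lam) - real k * \<delta> \<le> gpm p (s 0) (s N)"
      proof (rule chain_log[OF pc _ _ N])
        show "s t \<in> carrier G" if "t \<le> N" for t using y z c ij by (auto simp: s_def)
        show "real D - lam \<le> gpm p (s t) (s (Suc t))" if "t < N" for t
        proof -
          consider "t = 0" | "t > 0" "t < j - i + 1" | "t = j - i + 1" using \<open>t < N\<close> unfolding N_def by linarith
          then show ?thesis
          proof cases
            case 1 then show ?thesis using y by (simp add: s_def)
          next
            case 2
            define u where "u = i + t - 1"
            have u: "u < l" "i + t = Suc u" using 2 ij by (auto simp: u_def)
            have "s t = c u" using 2 by (simp add: s_def u_def)
            moreover have "s (Suc t) = c (Suc u)" using 2 u(2) unfolding s_def by simp
            moreover have "d p (c u) \<le> d p (c (Suc u)) + d (c u) (c (Suc u))"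
              using d_triangle[OF pc c[of "Suc u"] c[of u]] d_commute[OF c[of u] c[of "Suc u"]] u by simp
            ultimately show ?thesis using c2[of u] Dle[of u] Dle[of "Suc u"] u by (simp add: gpm_def)
          next
            case 3
            then have "s t = c j" "s (Suc t) = z" using ij by (auto simp: s_def)
            then show ?thesis using z gpm_commute[OF z(1) ci(2)] by simp
          qed
        qed
      qed
      moreover have "s 0 = y" "s N = z" by (auto simp: s_def N_def)
      ultimately show False using yz k by simp
    qed
    have "\<not> real D > D0"
    proof (cases "i \<le> j")
      case True show ?thesis by (rule detour[OF True z(2) y(1,3-5) z(1,3-5) yz])
    next
      case False
      then have "j \<le> i" by simp
      have "gpm p z y \<le> C0 / 2" using yz gpm_commute[OF y(1) z(1)] by simp
      then show ?thesis by (rule detour[OF \<open>j \<le> i\<close> y(2) z(1,3-5) y(1,3-5)])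
    qed
    moreover have "dist m \<le> D" using pmax m bet by (simp add: D_def M_def)
    moreover obtain i where "i \<le> l" "dist m = len (inv m \<otimes> c i)" using dist_att by auto
    ultimately show ?thesis by (intro exI[of _ i]) (simp add: d_def)
  qed
  then show ?thesis by (intro exI[of _ D0]) blast
qed

text \<open>In a tree, the pairing with the smallest sum separates \<open>{a, b}\<close> from
  \<open>{p, q}\<close>, and the branch point of \<open>a\<close>, \<open>b\<close>,
  \<open>p\<close> lies on all four paths between the two sides. It is found on the geodesic from
  \<open>a\<close> to \<open>p\<close> at distance \<open>gpm a b p\<close>, rounded down.\<close>

lemma tree_center:
  assumes "a \<in> carrier G" "b \<in> carrier G" "p \<in> carrier G" "q \<in> carrier G"
    and small: "d a b + d p q \<le> d a p + d b q" "d a b + d p q \<le> d a q + d b p"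
  shows "\<exists>m\<in>carrier G. \<forall>x\<in>{a, b}. \<forall>y\<in>{p, q}. d x m + d m y \<le> d x y + (8 * \<delta> + 6)"
proof -
  note c = assms(1-4)
  define i where "i = nat \<lfloor>gpm a b p\<rfloor>"
  have g0: "0 \<le> gpm a b p" using d_triangle[OF c(2) c(1) c(3)] d_commute[OF c(1) c(2)] by (simp add: gpm_def)
  have g1: "gpm a b p \<le> d a p" using d_triangle[OF c(1) c(3) c(2)] d_commute[OF c(3) c(2)] by (simp add: gpm_def)
  have i: "real i \<le> gpm a b p" "gpm a b p < real i + 1" using g0 by (simp_all add: i_def)
  have "i \<le> len (inv a \<otimes> p)" using i g1 by (simp add: d_def flip: of_nat_le_iff)
  then obtain m where m: "m \<in> carrier G" "d a m = i" "d m p = d a p - i" using d_point c by metis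
  note s = d_commute[OF c(1) c(2)] d_commute[OF c(1) c(3)] d_commute[OF c(1) c(4)] d_commute[OF c(2) c(3)]
    d_commute[OF c(2) c(4)] d_commute[OF c(3) c(4)] d_commute[OF m(1) c(1)] d_commute[OF m(1) c(2)]
    d_commute[OF m(1) c(3)] d_commute[OF m(1) c(4)]
  have 1: "d a b + d p q \<le> d a p + d b q" "d a b + d p q \<le> d a q + d b p" using small by auto
  have 2: "d a p + d b q \<le> d a q + d b p + 2 * \<delta>" "d a q + d b p \<le> d a p + d b q + 2 * \<delta>"
    using four_points[OF c(1) c(2) c(3) c(4)] four_points[OF c(1) c(2) c(4) c(3)]
      four_points[OF c(1) c(3) c(2) c(4)] four_points[OF c(1) c(4) c(2) c(3)] 1 s \<delta>_nonneg by linarith+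
  have 3: "d m b + d a p \<le> max (d m p + d a b) (d p b + d a m) + 2 * \<delta>"
    by (rule four_points[OF c(1) m(1) c(3) c(2)])
  have 4: "d m q + d a p \<le> max (d m p + d a q) (d p q + d a m) + 2 * \<delta>"
    by (rule four_points[OF c(1) m(1) c(3) c(4)])
  have 5: "real i \<le> (d a b + d a p - d b p) / 2" "(d a b + d a p - d b p) / 2 < real i + 1"
    using i by (auto simp: gpm_def)
  have mb: "d m b \<le> d a b - i + 2 * \<delta> + 2" using 3 5 m(2,3) s(4) by (auto simp: max_def split: if_splits)
  have mq: "d m q \<le> d a q - i + 4 * \<delta> + 2" using 4 5 m(2,3) 1 2 s \<delta>_nonneg by (auto simp: max_def split: if_splits)
  have "d a m + d m p \<le> d a p + (8 * \<delta> + 6)" using m \<delta>_nonneg by simp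
  moreover have "d a m + d m q \<le> d a q + (8 * \<delta> + 6)" using m mq \<delta>_nonneg by simp
  moreover have "d b m + d m p \<le> d b p + (8 * \<delta> + 6)" using m mb 5 s \<delta>_nonneg by simp
  moreover have "d b m + d m q \<le> d b q + (8 * \<delta> + 6)"
    using m mb mq 5 s 2 \<delta>_nonneg by simp
  ultimately show ?thesis using m(1) by blast
qed

text \<open>A \<open>T\<close>-geodesic is a quasi-geodesic for \<open>S\<close>, so by
  \<open>morse_half\<close> a point that is almost between two others for \<open>S\<close> is almost
  between them for \<open>T\<close>. Applied to the center of a quadruple, this gives the four-point
  inequality for \<open>T\<close>.\<close>

lemma hyperbolic_change_generators:
  assumes T: "finite_symmetric_generating_set G T"
  shows "\<exists>\<delta>'. hyperbolic_metric G T \<delta>'"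
proof -
  interpret T: word_metric G T by standard (rule T)
  obtain lam1 where lam1: "lam1 \<ge> 1" "\<And>g. g \<in> carrier G \<Longrightarrow> len g \<le> lam1 * T.len g"
    using bilipschitz[OF T] by auto
  obtain lam2 where lam2: "lam2 \<ge> 1" "\<And>g. g \<in> carrier G \<Longrightarrow> T.len g \<le> lam2 * len g"
    using T.bilipschitz[OF gens] by auto
  define lam where "lam = lam1 * lam2"
  have "lam1 \<le> lam" "lam2 \<le> lam" "1 \<le> lam" using lam1(1) lam2(1) by (auto simp: lam_def)
  then have lam: "len g \<le> lam * T.len g" "T.len g \<le> lam * len g" if "g \<in> carrier G" for g
    using lam1(2)[OF that] lam2(2)[OF that] by (meson le_trans mult_le_mono1)+
  have dT: "d x y \<le> lam * T.d x y" "T.d x y \<le> lam * d x y" if "x \<in> carrier G" "y \<in> carrier G" for x y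
    using lam[of "inv x \<otimes> y"] that by (simp_all add: d_def T.d_def flip: of_nat_mult)
  define C0 where "C0 = 8 * \<delta> + 6"
  have "0 \<le> C0" using \<delta>_nonneg by (simp add: C0_def)
  obtain D0 where D0: "\<And>c l m. \<lbrakk>\<And>i. i \<le> l \<Longrightarrow> c i \<in> carrier G; m \<in> carrier G;
     \<And>i j. i \<le> j \<Longrightarrow> j \<le> l \<Longrightarrow> real (j - i) \<le> lam * d (c i) (c j);
     \<And>i. i < l \<Longrightarrow> d (c i) (c (Suc i)) \<le> lam;
     d (c 0) m + d m (c l) \<le> d (c 0) (c l) + C0\<rbrakk> \<Longrightarrow> \<exists>i\<le>l. d m (c i) \<le> D0"
    using morse_half[OF \<open>1 \<le> lam\<close> \<open>0 \<le> C0\<close>] by blast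
  define C1 where "C1 = 2 * lam * D0"
  have between: "T.d x m + T.d m y \<le> T.d x y + C1"
    if c: "x \<in> carrier G" "y \<in> carrier G" "m \<in> carrier G" and b: "d x m + d m y \<le> d x y + C0" for x y m
  proof -
    obtain ws where ws: "set ws \<subseteq> T" "length ws = T.len (inv x \<otimes> y)" "T.wprod ws = inv x \<otimes> y"
      using T.ex_min_word[of "inv x \<otimes> y"] c by auto
    define l where "l = length ws"
    define s where "s i = x \<otimes> T.wprod (take i ws)" for i
    have sub: "set (take i ws) \<subseteq> T" for i using ws(1) by (meson dual_order.trans set_take_subset)
    have s: "s i \<in> carrier G" for i using T.wprod_closed[OF sub] c by (simp add: s_def)
    have s0: "s 0 = x" using c by (simp add: s_def)
    have sl: "s l = y" using c ws by (simp add: s_def l_def m_assoc[symmetric])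
    have step: "T.d (s i) (s j) \<le> real (j - i)" if "i \<le> j" "j \<le> l" for i j
    proof -
      have e: "take j ws = take i ws @ take (j - i) (drop i ws)"
        using that by (metis le_add_diff_inverse take_add)
      have sub': "set (take (j - i) (drop i ws)) \<subseteq> T"
        using ws(1) by (meson dual_order.trans set_take_subset set_drop_subset)
      have "inv (s i) \<otimes> s j = T.wprod (take (j - i) (drop i ws))"
        using T.wprod_closed[OF sub] T.wprod_closed[OF sub'] T.wprod_append[OF sub sub'] c s
        unfolding s_def e by (simp add: inv_mult_group m_assoc inv_solve_left')
      then show ?thesis using T.len_le[OF sub'] by (simp add: T.d_def)
    qed
    have geo: "T.d (s i) (s j) = real (j - i)" if "i \<le> j" "j \<le> l" for i j
    proof -
      have "real l = T.d x y" using ws by (simp add: T.d_def l_def)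
      also have "\<dots> \<le> T.d (s 0) (s i) + T.d (s i) (s j) + T.d (s j) (s l)"
        using T.d_triangle[OF c(1) s[of i] c(2)] T.d_triangle[OF s[of i] s[of j] c(2)] by (simp add: s0 sl)
      finally show ?thesis using step[of 0 i] step[of i j] step[of j l] that by simp
    qed
    obtain i where i: "i \<le> l" "d m (s i) \<le> D0"
    proof -
      have "\<exists>i\<le>l. d m (s i) \<le> D0"
      proof (rule D0)
        show "real (j - i) \<le> lam * d (s i) (s j)" if "i \<le> j" "j \<le> l" for i j
          using geo[OF that] dT(2)[OF s[of i] s[of j]] by simp
        show "d (s i) (s (Suc i)) \<le> lam" if "i < l" for i
          using geo[of i "Suc i"] dT(1)[OF s[of i] s[of "Suc i"]] that by simp
        show "d (s 0) m + d m (s l) \<le> d (s 0) (s l) + C0" using b by (simp add: s0 sl)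
      qed (use s c in auto)
      then show ?thesis using that by auto
    qed
    have "T.d m (s i) \<le> lam * D0" using dT(2)[OF c(3) s[of i]] i(2)
      by (meson dual_order.trans mult_left_mono of_nat_0_le_iff)
    moreover have "T.d x (s i) + T.d (s i) y = T.d x y"
      using geo[of 0 i] geo[of i l] geo[of 0 l] i by (simp add: s0 sl)
    ultimately show ?thesis
      using T.d_triangle[OF c(1) s[of i] c(3)] T.d_triangle[OF c(3) s[of i] c(2)] T.d_commute[OF c(3) s[of i]]
      by (simp add: C1_def)
  qed
  have four: "T.d x z + T.d w y \<le> max (T.d x y + T.d w z) (T.d y z + T.d w x) + 4 * C1"
    if c: "w \<in> carrier G" "x \<in> carrier G" "y \<in> carrier G" "z \<in> carrier G" for w x y z
  proof -
    have key: "T.d a p + T.d b q \<le> T.d a q + T.d b p + 4 * C1 \<and> T.d a q + T.d b p \<le> T.d a p + T.d b q + 4 * C1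
       \<and> T.d a b + T.d p q \<le> T.d a p + T.d b q + 4 * C1"
      if c: "a \<in> carrier G" "b \<in> carrier G" "p \<in> carrier G" "q \<in> carrier G"
        and small: "d a b + d p q \<le> d a p + d b q" "d a b + d p q \<le> d a q + d b p" for a b p q
    proof -
      obtain m where m: "m \<in> carrier G" "\<And>x y. x \<in> {a, b} \<Longrightarrow> y \<in> {p, q} \<Longrightarrow> d x m + d m y \<le> d x y + C0"
        using tree_center[OF c small] unfolding C0_def by blast
      have b: "T.d a m + T.d m p \<le> T.d a p + C1" "T.d a m + T.d m q \<le> T.d a q + C1"
        "T.d b m + T.d m p \<le> T.d b p + C1" "T.d b m + T.d m q \<le> T.d b q + C1"
        using m(2) c by (auto intro!: between m(1))
      have t: "T.d a p \<le> T.d a m + T.d m p" "T.d a q \<le> T.d a m + T.d m q" "T.d b p \<le> T.d b m + T.d m p"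
        "T.d b q \<le> T.d b m + T.d m q" "T.d a b \<le> T.d a m + T.d b m" "T.d p q \<le> T.d m p + T.d m q"
        using T.d_triangle[OF c(1) m(1) c(3)] T.d_triangle[OF c(1) m(1) c(4)] T.d_triangle[OF c(2) m(1) c(3)]
          T.d_triangle[OF c(2) m(1) c(4)] T.d_triangle[OF c(1) m(1) c(2)] T.d_triangle[OF c(3) m(1) c(4)]
          T.d_commute[OF m(1) c(2)] T.d_commute[OF m(1) c(3)] by simp_all
      then have "0 \<le> C1" using b by linarith
      then show ?thesis using b t by linarith
    qed
    note sym = T.d_commute[OF c(1) c(2)] T.d_commute[OF c(1) c(3)] T.d_commute[OF c(1) c(4)]
      T.d_commute[OF c(2) c(3)] T.d_commute[OF c(2) c(4)] T.d_commute[OF c(3) c(4)]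
      d_commute[OF c(1) c(2)] d_commute[OF c(1) c(3)] d_commute[OF c(1) c(4)]
      d_commute[OF c(2) c(3)] d_commute[OF c(2) c(4)] d_commute[OF c(3) c(4)]
    \<comment> \<open>The pairing with the smallest sum for \<open>d\<close> is the one to which
      \<open>key\<close> applies; each of the three cases yields the inequality for
      \<open>T.d\<close>.\<close>
    consider "d w x + d y z \<le> d w y + d x z" "d w x + d y z \<le> d w z + d x y"
      | "d w z + d x y \<le> d w y + d x z" "d w z + d x y \<le> d w x + d y z"
      | "d w y + d x z \<le> d w x + d y z" "d w y + d x z \<le> d w z + d x y" by linarith
    then show ?thesis
    proof cases
      case 1 then show ?thesis using key[of w x y z] c sym by (auto simp: max_def)
    next
      case 2 then show ?thesis using key[of w z x y] key[of w z y x] c sym by (auto simp: max_def)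
    next
      case 3 then show ?thesis using key[of w y x z] c sym by (auto simp: max_def)
    qed
  qed
  have "T.gp x z \<ge> min (T.gp x y) (T.gp y z) - max 0 (2 * C1)"
    if "x \<in> carrier G" "y \<in> carrier G" "z \<in> carrier G" for x y z
  proof -
    have "real (T.len (inv x \<otimes> z)) + T.len y \<le> max (real (T.len (inv x \<otimes> y)) + T.len z) (real (T.len (inv y \<otimes> z)) + T.len x) + 4 * C1"
      using four[of \<one> x y z] that by (simp add: T.d_def)
    then have "real (T.len (inv x \<otimes> z)) + T.len y \<le> real (T.len (inv x \<otimes> y)) + T.len z + 4 * C1
        \<or> real (T.len (inv x \<otimes> z)) + T.len y \<le> real (T.len (inv y \<otimes> z)) + T.len x + 4 * C1"
      by (simp add: max_def split: if_splits)
    then have "T.gp x y - 2 * C1 \<le> T.gp x z \<or> T.gp y z - 2 * C1 \<le> T.gp x z"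
      by (elim disj_forward) (simp_all add: T.gp_def field_simps)
    then show ?thesis by linarith
  qed
  then have "hyperbolic_metric G T (max 0 (2 * C1))"
    by unfold_locales auto
  then show ?thesis by blast
qed

end

lemma (in group) hyperbolic_group_hyperbolic_metric:
  assumes "hyperbolic_group G" "finite_symmetric_generating_set G T"
  shows "\<exists>\<delta>. hyperbolic_metric G T \<delta>"
proof -
  obtain S \<delta> where S: "finite_symmetric_generating_set G S"
    and h: "\<And>w x y z. \<lbrakk>w\<in>carrier G; x\<in>carrier G; y\<in>carrier G; z\<in>carrier G\<rbrakk> \<Longrightarrow>
          gromov_product G S w x z \<ge> min (gromov_product G S w x y) (gromov_product G S w y z) - \<delta>"
    using assms(1) unfolding hyperbolic_group_def by blast
  interpret S: word_metric G S by standard (rule S)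
  have e: "gromov_product G S \<one> x y = S.gp x y" if "x \<in> carrier G" "y \<in> carrier G" for x y
    using that by (simp add: gromov_product_def word_dist_def S.gp_def)
  have "hyperbolic_metric G S (max 0 \<delta>)"
  proof unfold_locales
    show "min (S.gp x y) (S.gp y z) - max 0 \<delta> \<le> S.gp x z"
      if "x \<in> carrier G" "y \<in> carrier G" "z \<in> carrier G" for x y z
      using h[OF one_closed that] that by (simp add: e)
  qed auto
  then interpret S: hyperbolic_metric G S "max 0 \<delta>" .
  show ?thesis by (rule S.hyperbolic_change_generators[OF assms(2)])
qed

section \<open>Growth exponents\<close>

context word_metric begin

text \<open>The factor \<open>real n + 1\<close> leaves room for sums over spheres; it is harmless
  because \<open>ln (real n + 1) / real n\<close> tends to 0.\<close>

lemma growth_exponent_le: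
  assumes K: "K > 0" and le: "\<And>n. real (card (A \<inter> B n)) \<le> K * (real n + 1) * exp (r * real n)"
  shows "growth_exponent G S A \<le> ereal r"
proof -
  have "growth_exponent G S A \<le> limsup (\<lambda>n. ereal ((ln K + ln (real n + 1)) / real n + r))"
    unfolding growth_exponent_def
  proof (rule Limsup_mono, rule eventually_sequentiallyI[of 1])
    fix n :: nat assume n: "1 \<le> n"
    show "(if A \<inter> B n = {} then - \<infinity> else ereal (ln (real (card (A \<inter> B n))) / real n))
        \<le> ereal ((ln K + ln (real n + 1)) / real n + r)"
    proof (cases "A \<inter> B n = {}")
      case False
      then have "card (A \<inter> B n) > 0" by (simp add: card_gt_0_iff)
      then have "ln (real (card (A \<inter> B n))) \<le> ln (K * (real n + 1) * exp (r * real n))"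
        using le[of n] by (intro ln_mono) auto
      also have "\<dots> = ln K + ln (real n + 1) + r * real n"
        using K by (simp add: ln_mult)
      finally have "ln (real (card (A \<inter> B n))) / real n \<le> (ln K + ln (real n + 1) + r * real n) / real n"
        by (intro divide_right_mono) auto
      also have "\<dots> = (ln K + ln (real n + 1)) / real n + r" using n by (simp add: add_divide_distrib)
      finally show ?thesis using False by simp
    qed simp
  qed
  also have "\<dots> = ereal r"
  proof (rule lim_imp_Limsup)
    have "(\<lambda>n. (ln K + ln (real n + 1)) / real n + r) \<longlonglongrightarrow> r" by real_asymp
    then show "(\<lambda>n. ereal ((ln K + ln (real n + 1)) / real n + r)) \<longlonglongrightarrow> ereal r"
      by (intro tendsto_ereal)
  qed simp
  finally show ?thesis .
qed

lemma card_le_of_growth_exponent: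
  assumes "growth_exponent G S A < ereal r"
  shows "\<exists>K>0. \<forall>n. real (card (A \<inter> B n)) \<le> K * exp (r * real n)"
proof -
  have "\<forall>\<^sub>F n in sequentially. (if A \<inter> B n = {} then - \<infinity> else ereal (ln (real (card (A \<inter> B n))) / real n)) < ereal r"
    using assms unfolding growth_exponent_def by (rule Limsup_lessD)
  then obtain n0 where n0: "\<And>n. n \<ge> n0 \<Longrightarrow>
      (if A \<inter> B n = {} then - \<infinity> else ereal (ln (real (card (A \<inter> B n))) / real n)) < ereal r"
    by (auto simp: eventually_sequentially)
  \<comment> \<open>\<open>Suc n0\<close> instead of \<open>n0\<close> keeps \<open>n = 0\<close>,
    where division by \<open>n\<close> has its default value, out of the asymptotic case.\<close>
  define K where "K = 1 + real (card (B (Suc n0))) * exp (\<bar>r\<bar> * Suc n0)"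
  have "K \<ge> 1" by (simp add: K_def)
  have "real (card (A \<inter> B n)) \<le> K * exp (r * real n)" for n
  proof (cases "n \<ge> Suc n0")
    case True
    have "real (card (A \<inter> B n)) \<le> exp (r * real n)"
    proof (cases "A \<inter> B n = {}")
      case False
      then have c: "card (A \<inter> B n) > 0" by (simp add: card_gt_0_iff)
      have "ln (real (card (A \<inter> B n))) / real n < r" using n0[of n] True False by simp
      then have "ln (real (card (A \<inter> B n))) < r * real n" using True by (simp add: field_simps)
      then have "exp (ln (real (card (A \<inter> B n)))) \<le> exp (r * real n)" by simp
      then show ?thesis using c by simp
    qed simp
    also have "\<dots> \<le> K * exp (r * real n)" using \<open>K \<ge> 1\<close> by simp
    finally show ?thesis .
  next
    case False
    have "card (A \<inter> B n) \<le> card (B (Suc n0))"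
      using False B_mono[of n "Suc n0"] by (intro card_mono) auto
    also have "real (card (B (Suc n0))) * 1 \<le> real (card (B (Suc n0))) * exp (\<bar>r\<bar> * Suc n0 + r * real n)"
    proof (rule mult_left_mono)
      have "- (r * real n) \<le> \<bar>r\<bar> * real n" by (simp add: abs_if)
      also have "\<dots> \<le> \<bar>r\<bar> * Suc n0" using False by (intro mult_left_mono) auto
      finally show "1 \<le> exp (\<bar>r\<bar> * Suc n0 + r * real n)" by simp
    qed simp
    also have "\<dots> \<le> K * exp (r * real n)" by (simp add: K_def exp_add distrib_right)
    finally show ?thesis by simp
  qed
  then show ?thesis using \<open>K \<ge> 1\<close> by (intro exI[of _ K]) auto
qed

lemma growth_exponent_nonneg:
  assumes "\<one> \<in> A" shows "0 \<le> growth_exponent G S A"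
proof -
  have "limsup (\<lambda>n::nat. 0::ereal) \<le> growth_exponent G S A"
    unfolding growth_exponent_def
  proof (rule Limsup_mono, rule eventually_sequentiallyI[of 0])
    fix n
    have "A \<inter> B n \<noteq> {}" using assms one_in_B by auto
    then have "1 \<le> card (A \<inter> B n)" by (simp add: card_gt_0_iff Suc_le_eq)
    then have "1 \<le> real (card (A \<inter> B n))" by simp
    then have "0 \<le> ln (real (card (A \<inter> B n))) / real n" by simp
    then show "0 \<le> (if A \<inter> B n = {} then - \<infinity> else ereal (ln (real (card (A \<inter> B n))) / real n))"
      using \<open>A \<inter> B n \<noteq> {}\<close> by simp
  qed
  then show ?thesis by (simp add: Limsup_const)
qed

definition \<omega> :: real where "\<omega> = real_of_ereal (growth_exponent G S (carrier G))"

lemma carrier_Int_B: "carrier G \<inter> B n = B n" by (auto simp: in_B)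

text \<open>Fekete's argument: \<open>card_B_mult\<close> bounds every ball by a power of the ball
  of radius \<open>n\<close>, so a single radius already bounds the limsup.\<close>

lemma growth_exponent_le_ball:
  assumes "n \<ge> 1"
  shows "growth_exponent G S (carrier G) \<le> ereal (ln (real (card (B n))) / real n)"
proof (rule growth_exponent_le)
  show pos: "0 < real (card (B n))" using card_B_pos by simp
  fix N
  have "N \<le> Suc (N div n) * n" using assms by (simp add: dividend_less_times_div less_imp_le mult.commute)
  then have "card (B N) \<le> card (B (Suc (N div n) * n))" by (intro card_mono B_mono) auto
  also have "\<dots> \<le> card (B n) ^ Suc (N div n)" by (rule card_B_mult)
  finally have "real (card (B N)) \<le> real (card (B n)) ^ Suc (N div n)" by (metis of_nat_le_iff of_nat_power)
  also have "\<dots> = real (card (B n)) * exp (real (N div n) * ln (real (card (B n))))"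
    using pos by (simp add: exp_of_nat_mult)
  also have "\<dots> \<le> real (card (B n)) * exp (ln (real (card (B n))) / real n * real N)"
  proof -
    have "real (N div n) \<le> real N / real n" by (rule of_nat_div_le_of_nat)
    moreover have "0 \<le> ln (real (card (B n)))" using card_B_pos[of n] by simp
    ultimately have "real (N div n) * ln (real (card (B n))) \<le> real N / real n * ln (real (card (B n)))"
      by (intro mult_right_mono)
    then have "real (N div n) * ln (real (card (B n))) \<le> ln (real (card (B n))) / real n * real N"
      by (simp add: mult.commute)
    then show ?thesis using pos by (intro mult_left_mono) auto
  qed
  also have "\<dots> \<le> real (card (B n)) * (real N + 1) * exp (ln (real (card (B n))) / real n * real N)"
    using pos by simp
  finally show "real (card (carrier G \<inter> B N)) \<le> \<dots>" by (simp add: carrier_Int_B)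
qed

lemma growth_exponent_eq: "growth_exponent G S (carrier G) = ereal \<omega>"
proof -
  have "\<bar>growth_exponent G S (carrier G)\<bar> \<noteq> \<infinity>"
    using growth_exponent_le_ball[of 1] growth_exponent_nonneg[of "carrier G"] by auto
  then show ?thesis by (simp add: \<omega>_def ereal_real)
qed

text \<open>There is no error factor because, by submultiplicativity, the exponent is at most its
  approximation at each single radius.\<close>

lemma exp_le_card_B: "exp (\<omega> * real n) \<le> card (B n)"
proof (cases "n = 0")
  case True then show ?thesis using card_B_pos[of 0] by (simp add: Suc_le_eq)
next
  case False
  then have "\<omega> \<le> ln (real (card (B n))) / real n"
    using growth_exponent_le_ball[of n] by (simp add: growth_exponent_eq)
  then have "\<omega> * real n \<le> ln (real (card (B n)))" using False by (simp add: field_simps)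
  then have "exp (\<omega> * real n) \<le> exp (ln (real (card (B n))))" by simp
  then show ?thesis using card_B_pos[of n] by simp
qed

lemma card_B_le_exp: "\<epsilon> > 0 \<Longrightarrow> \<exists>K>0. \<forall>n. real (card (B n)) \<le> K * exp ((\<omega> + \<epsilon>) * real n)"
  using card_le_of_growth_exponent[of "carrier G" "\<omega> + \<epsilon>"]
  by (simp add: growth_exponent_eq carrier_Int_B)

lemma has_growth_gap_iff:
  "has_growth_gap G S \<longleftrightarrow> (\<exists>\<gamma>>0. \<forall>H. subgroup H G \<longrightarrow> infinite (rcosets H) \<longrightarrow> growth_exponent G S H \<le> ereal (\<omega> - \<gamma>))"
proof -
  define s where "s = (SUP H \<in> {H. subgroup H G \<and> infinite (rcosets H)}. growth_exponent G S H)"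
  have gap: "has_growth_gap G S \<longleftrightarrow> ereal \<omega> - s > 0"
    by (simp add: has_growth_gap_def top_growth_gap_def growth_exponent_eq s_def)
  have le: "growth_exponent G S H \<le> s" if "subgroup H G" "infinite (rcosets H)" for H
    unfolding s_def using that by (intro SUP_upper) auto
  show ?thesis
  proof
    assume "has_growth_gap G S"
    then have pos: "ereal \<omega> - s > 0" by (simp add: gap)
    show "\<exists>\<gamma>>0. \<forall>H. subgroup H G \<longrightarrow> infinite (rcosets H) \<longrightarrow> growth_exponent G S H \<le> ereal (\<omega> - \<gamma>)"
    proof (cases s)
      case (real t)
      then show ?thesis using pos le by (intro exI[of _ "\<omega> - t"]) auto
    next
      case PInf then show ?thesis using pos by simp
    next
      \<comment> \<open>The supremum of the empty family; any positive value serves as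
        \<gamma>.\<close>
      case MInf then show ?thesis using le by (intro exI[of _ 1]) auto
    qed
  next
    assume "\<exists>\<gamma>>0. \<forall>H. subgroup H G \<longrightarrow> infinite (rcosets H) \<longrightarrow> growth_exponent G S H \<le> ereal (\<omega> - \<gamma>)"
    then obtain \<gamma> where \<gamma>: "\<gamma> > 0" "\<And>H. subgroup H G \<Longrightarrow> infinite (rcosets H) \<Longrightarrow> growth_exponent G S H \<le> ereal (\<omega> - \<gamma>)"
      by auto
    then have "s \<le> ereal (\<omega> - \<gamma>)" unfolding s_def by (intro SUP_least) auto
    then show "has_growth_gap G S" using \<gamma>(1) unfolding gap by (cases s) auto
  qed
qed

end

section \<open>Positive representations and shadows\<close>

text \<open>The model is the cone of nonnegative functions in a permutation representation.\<close>

locale positive_rep = group G for G (structure) +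
  fixes \<pi> :: "'a \<Rightarrow> 'v::real_inner \<Rightarrow> 'v" and C :: "'v set"
  assumes linear_\<pi>: "g \<in> carrier G \<Longrightarrow> linear (\<pi> g)"
    and C_zero: "0 \<in> C"
    and C_add: "v \<in> C \<Longrightarrow> w \<in> C \<Longrightarrow> v + w \<in> C"
    and C_scale: "c \<ge> 0 \<Longrightarrow> v \<in> C \<Longrightarrow> c *\<^sub>R v \<in> C"
    and C_\<pi>: "g \<in> carrier G \<Longrightarrow> v \<in> C \<Longrightarrow> \<pi> g v \<in> C"
    and C_inner: "v \<in> C \<Longrightarrow> w \<in> C \<Longrightarrow> inner v w \<ge> 0"
    and \<pi>_one: "v \<in> C \<Longrightarrow> \<pi> \<one> v = v"
    and \<pi>_mult: "g \<in> carrier G \<Longrightarrow> h \<in> carrier G \<Longrightarrow> v \<in> C \<Longrightarrow> \<pi> (g \<otimes> h) v = \<pi> g (\<pi> h v)"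
    and \<pi>_inner: "g \<in> carrier G \<Longrightarrow> v \<in> C \<Longrightarrow> w \<in> C \<Longrightarrow> inner (\<pi> g v) (\<pi> g w) = inner v w"
begin

lemma \<pi>_norm: "g \<in> carrier G \<Longrightarrow> v \<in> C \<Longrightarrow> norm (\<pi> g v) = norm v"
  by (simp add: norm_eq_sqrt_inner \<pi>_inner)

lemma \<pi>_sum: "g \<in> carrier G \<Longrightarrow> \<pi> g (sum f I) = (\<Sum>i\<in>I. \<pi> g (f i))"
  by (rule linear_sum[OF linear_\<pi>])

lemma \<pi>_scale: "g \<in> carrier G \<Longrightarrow> \<pi> g (c *\<^sub>R v) = c *\<^sub>R \<pi> g v"
  by (rule linear_scale[OF linear_\<pi>])

lemma C_sum: "(\<And>i. i \<in> I \<Longrightarrow> f i \<in> C) \<Longrightarrow> sum f I \<in> C"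
  by (induction I rule: infinite_finite_induct) (auto simp: C_zero C_add)

lemma inner_le: "w - v \<in> C \<Longrightarrow> z \<in> C \<Longrightarrow> inner v z \<le> inner w z"
  using C_inner[of "w - v" z] by (simp add: inner_diff_left)

text \<open>The cone defines an order by \<open>w - v \<in> C\<close>, and nonnegativity of inner
  products within the cone makes the norm monotone for it.\<close>

lemma norm_le_C:
  assumes "v \<in> C" "w - v \<in> C" shows "norm v \<le> norm w"
proof -
  have w: "w \<in> C" using C_add[OF assms] by simp
  have "inner v v \<le> inner w v" by (rule inner_le) fact+
  also have "\<dots> = inner v w" by (rule inner_commute)
  also have "\<dots> \<le> inner w w" by (rule inner_le) fact+
  finally show ?thesis by (simp add: norm_eq_sqrt_inner)
qed

text \<open>The tool behind all dominations: an injection \<open>t\<close> of indices puts each term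
  of the smaller sum below a term of the larger one, and the unmatched terms lie in the
  cone.\<close>

lemma C_sum_diff:
  assumes "finite J" "inj_on t I" "t ` I \<subseteq> J" "\<And>j. j \<in> J \<Longrightarrow> b j \<in> C" "\<And>i. i \<in> I \<Longrightarrow> b (t i) - a i \<in> C"
  shows "sum b J - sum a I \<in> C"
proof -
  have "sum b J = sum b (J - t ` I) + sum b (t ` I)" using assms by (metis add.commute sum.subset_diff add.commute)
  also have "sum b (t ` I) = (\<Sum>i\<in>I. b (t i))" using assms by (simp add: sum.reindex)
  finally have "sum b J - sum a I = sum b (J - t ` I) + (\<Sum>i\<in>I. b (t i) - a i)"
    by (simp add: sum_subtractf)
  also have "\<dots> \<in> C" using assms by (intro C_add C_sum) auto
  finally show ?thesis .
qed

text \<open>Cross terms are nonnegative, so nothing cancels; orthogonal vectors are the extreme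
  case.\<close>

lemma norm_sum_ge:
  assumes "finite I" "\<And>i. i \<in> I \<Longrightarrow> f i \<in> C"
  shows "(\<Sum>i\<in>I. (norm (f i))\<^sup>2) \<le> (norm (sum f I))\<^sup>2"
proof -
  have "(\<Sum>i\<in>I. (norm (f i))\<^sup>2) = (\<Sum>i\<in>I. inner (f i) (f i))" by (simp add: power2_norm_eq_inner)
  also have "\<dots> \<le> (\<Sum>i\<in>I. inner (f i) (sum f I))"
  proof (rule sum_mono)
    fix i assume i: "i \<in> I"
    have "inner (f i) (f i) \<le> (\<Sum>j\<in>I. inner (f i) (f j))"
      using i assms by (intro member_le_sum C_inner) auto
    then show "inner (f i) (f i) \<le> inner (f i) (sum f I)" by (simp add: inner_sum_right)
  qed
  also have "\<dots> = (norm (sum f I))\<^sup>2" by (simp add: power2_norm_eq_inner inner_sum_left)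
  finally show ?thesis .
qed

end

section \<open>The shadow lemma for a vector valued Poincare series\<close>

definition (in word_metric) p where "p g = exp (- (\<omega> * real (len g)))"

lemma (in word_metric) p_pos [simp]: "0 < p g" "0 \<le> p g" by (simp_all add: p_def)

text \<open>\<open>D\<close> is the thickness of shadows. The condition \<open>D_small\<close>
  bounds the mass of a thin shadow at depth \<open>D\<close> by a quarter of the total, as
  \<open>shadow_lower\<close> requires.\<close>

locale growing_hyperbolic = hyperbolic_metric +
  fixes D :: nat
  assumes \<omega>_pos: "\<omega> > 0" and D_\<delta>: "2 * \<delta> \<le> D" and D_small: "exp (\<omega> * (2 * \<delta> - D)) \<le> 1 / 4"
begin

text \<open>The shadow of \<open>y\<close> seen from \<open>\<one>\<close>: elements
  \<open>h\<close> for which a geodesic from \<open>\<one>\<close> to \<open>h\<close> passes within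
  roughly \<open>D\<close> of \<open>y\<close>.\<close>

definition Sh where "Sh y = {h \<in> carrier G. real (len y) - D \<le> gp y h}"

lemma len_shadow:
  fixes r :: real
  assumes "len y - r \<le> gp y h" shows "real (len (inv y \<otimes> h)) \<le> real (len h) - len y + 2 * r"
  using assms len_inv_mult_gp[of y h] by linarith

end

locale rep_metric = growing_hyperbolic G S \<delta> D + positive_rep G \<pi> C
  for G :: "('a, 'b) monoid_scheme" (structure) and S \<delta> D and \<pi> :: "'a \<Rightarrow> 'v::real_inner \<Rightarrow> 'v" and C +
  fixes f :: 'v
  assumes f_C: "f \<in> C"
begin

text \<open>The part carried by \<open>A\<close> of the Poincare series of \<open>f\<close> at the
  critical exponent; \<open>u n\<close> is the series cut off at radius \<open>n\<close>.\<close>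

definition a where "a A = (\<Sum>h\<in>A. p h *\<^sub>R \<pi> h f)"

definition u where "u n = a (B n)"

lemma pf_C: "c \<ge> 0 \<Longrightarrow> h \<in> carrier G \<Longrightarrow> c *\<^sub>R \<pi> h f \<in> C"
  by (intro C_scale C_\<pi> f_C)

lemma a_C: "A \<subseteq> carrier G \<Longrightarrow> a A \<in> C"
  unfolding a_def by (intro C_sum pf_C) auto

lemma u_C: "u n \<in> C"
  unfolding u_def by (intro a_C B_carrier)

lemma a_mono: "finite A' \<Longrightarrow> A \<subseteq> A' \<Longrightarrow> A' \<subseteq> carrier G \<Longrightarrow> a A' - a A \<in> C"
  unfolding a_def by (rule C_sum_diff[where t = "\<lambda>h. h"]) (auto intro!: pf_C C_zero)

lemma a_union: "finite A \<Longrightarrow> finite A' \<Longrightarrow> A \<inter> A' = {} \<Longrightarrow> a (A \<union> A') = a A + a A'"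
  unfolding a_def by (rule sum.union_disjoint)

lemma \<pi>_a: "g \<in> carrier G \<Longrightarrow> A \<subseteq> carrier G \<Longrightarrow> \<pi> g (a A) = (\<Sum>z\<in>A. p z *\<^sub>R \<pi> (g \<otimes> z) f)"
  unfolding a_def by (auto simp: \<pi>_sum \<pi>_scale \<pi>_mult f_C intro!: sum.cong)

text \<open>By \<open>len_shadow\<close>, translation by \<open>inv y\<close> shortens elements of
  \<open>A\<close> by \<open>len y\<close> up to \<open>2 * r\<close>, which determines the ratio of
  weights. The bound \<open>2 * r \<le> len y\<close> keeps the translates inside the same ball, so
  no truncation error arises.\<close>

lemma shadow_upper:
  fixes r :: real
  assumes A: "A \<subseteq> B n" and y: "y \<in> carrier G" and r: "2 * r \<le> len y"
    and sh: "\<And>h. h \<in> A \<Longrightarrow> len y - r \<le> gp y h"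
  shows "exp (\<omega> * (2 * r - len y)) *\<^sub>R \<pi> y (u n) - a A \<in> C"
proof -
  have Ac: "A \<subseteq> carrier G" using A B_carrier by auto
  have e: "exp (\<omega> * (2 * r - len y)) *\<^sub>R \<pi> y (u n)
      = (\<Sum>z\<in>B n. (exp (\<omega> * (2 * r - len y)) * p z) *\<^sub>R \<pi> (y \<otimes> z) f)"
    unfolding u_def \<pi>_a[OF y B_carrier] by (simp add: scaleR_sum_right)
  show ?thesis
    unfolding e a_def
  proof (rule C_sum_diff[where t = "\<lambda>h. inv y \<otimes> h"])
    show "inj_on (\<lambda>h. inv y \<otimes> h) A" using Ac y by (auto simp: inj_on_def subset_iff)
    have len: "real (len (inv y \<otimes> h)) \<le> real (len h) - len y + 2 * r" if "h \<in> A" for h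
      using sh[OF that] by (rule len_shadow)
    show "(\<lambda>h. inv y \<otimes> h) ` A \<subseteq> B n"
    proof
      fix z assume "z \<in> (\<lambda>h. inv y \<otimes> h) ` A"
      then obtain h where h: "h \<in> A" "z = inv y \<otimes> h" by auto
      have "real (len z) \<le> real (len h)" unfolding h(2) using len[OF h(1)] r by linarith
      then show "z \<in> B n" using h A y Ac by (auto simp: in_B)
    qed
    show "(exp (\<omega> * (2 * r - len y)) * p z) *\<^sub>R \<pi> (y \<otimes> z) f \<in> C" if "z \<in> B n" for z
      using that y by (intro pf_C) (auto simp: in_B)
    show "(exp (\<omega> * (2 * r - len y)) * p (inv y \<otimes> h)) *\<^sub>R \<pi> (y \<otimes> (inv y \<otimes> h)) f - p h *\<^sub>R \<pi> h f \<in> C"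
      if h: "h \<in> A" for h
    proof -
      have hc: "h \<in> carrier G" using h Ac by auto
      have "y \<otimes> (inv y \<otimes> h) = h" using y hc by (simp add: m_assoc[symmetric])
      moreover have "p h \<le> exp (\<omega> * (2 * r - len y)) * p (inv y \<otimes> h)"
      proof -
        have "\<omega> * real (len (inv y \<otimes> h)) \<le> \<omega> * (real (len h) - len y + 2 * r)"
          using len[OF h] \<omega>_pos by (intro mult_left_mono) auto
        then show ?thesis unfolding p_def by (simp add: algebra_simps flip: exp_add)
      qed
      ultimately show ?thesis using pf_C[OF _ hc] by (simp flip: scaleR_diff_left)
    qed
  qed auto
qed

lemma shadow_upper_norm:
  fixes r :: real
  assumes A: "A \<subseteq> B n" and y: "y \<in> carrier G" and r: "2 * r \<le> len y"
    and sh: "\<And>h. h \<in> A \<Longrightarrow> len y - r \<le> gp y h"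
  shows "norm (a A) \<le> exp (\<omega> * (2 * r - len y)) * norm (u n)"
proof -
  have "norm (a A) \<le> norm (exp (\<omega> * (2 * r - len y)) *\<^sub>R \<pi> y (u n))"
    using shadow_upper[OF assms] A B_carrier by (intro norm_le_C a_C) auto
  then show ?thesis by (simp add: \<pi>_norm[OF y u_C])
qed

text \<open>Translation by \<open>g\<close> sends \<open>z\<close> into the shadow of
  \<open>g\<close> unless more than about \<open>D\<close> letters of \<open>g\<close> cancel. The
  cancelling \<open>z\<close> lie in a shadow of an initial segment of \<open>inv g\<close> of
  length \<open>D\<close>, which has at most a quarter of the mass; truncation, by
  \<open>diff\<close>, costs another quarter.\<close>

lemma shadow_lower:
  assumes g: "g \<in> carrier G" and n: "len g \<le> n" and diff: "norm (u n - u (n - len g)) \<le> norm (u n) / 4"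
  shows "exp (- (\<omega> * len g)) / 2 * norm (u n) \<le> norm (a (Sh g \<inter> B n))"
proof -
  define N where "N = n - len g"
  define Z where "Z = {z \<in> B N. gp (inv g) z \<le> D}"
  define Z' where "Z' = {z \<in> B N. gp (inv g) z > D}"
  have ZB: "Z \<subseteq> B N" "Z' \<subseteq> B N" and fin: "finite Z" "finite Z'"
    using finite_subset[OF _ finite_B[of N]] by (auto simp: Z_def Z'_def)
  then have Zc: "Z \<subseteq> carrier G" "Z' \<subseteq> carrier G" using B_carrier by auto
  have "B N = Z \<union> Z'" "Z \<inter> Z' = {}" by (auto simp: Z_def Z'_def)
  then have uN: "u N = a Z + a Z'" unfolding u_def using a_union fin by simp
  have "norm (a Z') \<le> norm (u n) / 4"
  proof (cases "D \<le> len g")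
    case True
    then obtain q where q: "q \<in> carrier G" "len q = D" "len (inv q \<otimes> inv g) = len (inv g) - D"
      using geodesic_point[of "inv g" D] g by auto
    then have gpq: "gp q (inv g) = D" using gp_geodesic[of "inv g" q D] g True by simp
    have "norm (a Z') \<le> exp (\<omega> * (2 * \<delta> - len q)) * norm (u n)"
    proof (rule shadow_upper_norm[OF _ q(1)])
      show "Z' \<subseteq> B n" using ZB B_mono[of N n] by (auto simp: N_def)
      show "2 * \<delta> \<le> len q" using q D_\<delta> by simp
      show "len q - \<delta> \<le> gp q h" if "h \<in> Z'" for h
      proof -
        have "min (gp q (inv g)) (gp (inv g) h) - \<delta> \<le> gp q h"
          using that q g Zc by (intro hyp) auto
        then show ?thesis using that gpq q by (simp add: Z'_def)
      qed
    qed
    also have "\<dots> \<le> 1 / 4 * norm (u n)" using D_small q by (intro mult_right_mono) auto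
    finally show ?thesis by simp
  next
    case False
    have "Z' = {}"
    proof (rule ccontr)
      assume "Z' \<noteq> {}"
      then obtain z where z: "z \<in> Z'" by auto
      then have "gp (inv g) z \<le> len (inv g)" using Zc g by (intro gp_le_left) auto
      then show False using z False g by (simp add: Z'_def)
    qed
    then show ?thesis by (simp add: a_def)
  qed
  moreover have "norm (u n) \<le> norm (u n - u N) + norm (a Z) + norm (a Z')"
    using norm_triangle_ineq[of "u n - u N" "a Z + a Z'"] norm_triangle_ineq[of "a Z" "a Z'"] uN by simp
  ultimately have aZ: "norm (u n) / 2 \<le> norm (a Z)" using diff by (simp add: N_def)
  have "a (Sh g \<inter> B n) - exp (- (\<omega> * len g)) *\<^sub>R \<pi> g (a Z) \<in> C"
  proof -
    have e: "exp (- (\<omega> * len g)) *\<^sub>R \<pi> g (a Z) = (\<Sum>z\<in>Z. (exp (- (\<omega> * len g)) * p z) *\<^sub>R \<pi> (g \<otimes> z) f)"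
      unfolding \<pi>_a[OF g Zc(1)] by (simp add: scaleR_sum_right)
    show ?thesis
      unfolding e unfolding a_def
    proof (rule C_sum_diff[where t = "\<lambda>z. g \<otimes> z"])
      show "inj_on (\<lambda>z. g \<otimes> z) Z" using Zc g by (auto simp: inj_on_def subset_iff)
      show "(\<lambda>z. g \<otimes> z) ` Z \<subseteq> Sh g \<inter> B n"
      proof
        fix h assume "h \<in> (\<lambda>z. g \<otimes> z) ` Z"
        then obtain z where z: "z \<in> Z" "h = g \<otimes> z" by auto
        have zc: "z \<in> carrier G" using z Zc by auto
        have "len h \<le> len g + len z" using len_mult g zc z by simp
        moreover have "len z \<le> N" using z by (simp add: Z_def in_B)
        ultimately have "h \<in> B n" using g zc z n by (simp add: in_B N_def)
        have "gp (inv g) z \<le> D" using z by (simp add: Z_def)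
        then have "real (len g) + len z - len (g \<otimes> z) \<le> 2 * D" using g by (simp add: gp_def)
        then have "real (len g) - D \<le> gp g h" using gp_mult[OF g zc] z by simp
        then show "h \<in> Sh g \<inter> B n" using \<open>h \<in> B n\<close> by (simp add: Sh_def in_B)
      qed
      show "p h *\<^sub>R \<pi> h f \<in> C" if "h \<in> Sh g \<inter> B n" for h using that by (intro pf_C) (auto simp: in_B)
      show "p (g \<otimes> z) *\<^sub>R \<pi> (g \<otimes> z) f - (exp (- (\<omega> * len g)) * p z) *\<^sub>R \<pi> (g \<otimes> z) f \<in> C" if "z \<in> Z" for z
      proof -
        have zc: "z \<in> carrier G" using that Zc by auto
        have "\<omega> * real (len (g \<otimes> z)) \<le> \<omega> * (real (len g) + len z)"
          using len_mult[OF g zc] \<omega>_pos by (intro mult_left_mono) auto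
        then have "exp (- (\<omega> * len g)) * p z \<le> p (g \<otimes> z)"
          unfolding p_def by (simp add: algebra_simps flip: exp_add)
        then show ?thesis using g zc by (simp flip: scaleR_diff_left add: pf_C)
      qed
    qed auto
  qed
  then have "norm (exp (- (\<omega> * len g)) *\<^sub>R \<pi> g (a Z)) \<le> norm (a (Sh g \<inter> B n))"
    using g Zc by (intro norm_le_C C_scale C_\<pi> a_C) auto
  moreover have "norm (exp (- (\<omega> * len g)) *\<^sub>R \<pi> g (a Z)) = exp (- (\<omega> * len g)) * norm (a Z)"
    using \<pi>_norm[OF g a_C[OF Zc(1)]] by simp
  moreover have "exp (- (\<omega> * len g)) * (norm (u n) / 2) \<le> exp (- (\<omega> * len g)) * norm (a Z)"
    using aZ by (intro mult_left_mono) auto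
  moreover have "exp (- (\<omega> * len g)) / 2 * norm (u n) = exp (- (\<omega> * len g)) * (norm (u n) / 2)" by simp
  ultimately show ?thesis by linarith
qed

end

section \<open>Purely exponential growth of spheres\<close>

context growing_hyperbolic begin

text \<open>If the shadows of \<open>g0\<close> and \<open>g\<close> share \<open>h\<close>,
  hyperbolicity makes \<open>gp g0 g\<close> almost \<open>k\<close>, so \<open>g\<close> lies in a
  ball of fixed radius about \<open>g0\<close>.\<close>

lemma Sph_Sh_multiplicity:
  assumes "h \<in> carrier G"
  shows "card {g \<in> Sph k. h \<in> Sh g} \<le> card (B (nat \<lceil>2 * D + 2 * \<delta>\<rceil>))"
proof (cases "{g \<in> Sph k. h \<in> Sh g} = {}")
  case False
  then obtain g0 where g0: "g0 \<in> Sph k" "h \<in> Sh g0" by auto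
  have g0c: "g0 \<in> carrier G" using g0 by (simp add: in_Sph)
  have "{g \<in> Sph k. h \<in> Sh g} \<subseteq> (\<otimes>) g0 ` B (nat \<lceil>2 * D + 2 * \<delta>\<rceil>)"
  proof
    fix g assume g: "g \<in> {g \<in> Sph k. h \<in> Sh g}"
    then have gc: "g \<in> carrier G" by (simp add: in_Sph)
    have "min (gp g0 h) (gp h g) - \<delta> \<le> gp g0 g" by (rule hyp) fact+
    moreover have "real k - D \<le> gp g0 h" "real k - D \<le> gp h g"
      using g0 g gp_commute[OF assms gc] by (auto simp: Sh_def in_Sph)
    ultimately have "real k - D - \<delta> \<le> gp g0 g" by simp
    then have "real (len (inv g0 \<otimes> g)) \<le> 2 * D + 2 * \<delta>"
      using len_inv_mult_gp[of g0 g] g g0 by (simp add: in_Sph)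
    then have "len (inv g0 \<otimes> g) \<le> nat \<lceil>2 * D + 2 * \<delta>\<rceil>" by linarith
    then have "inv g0 \<otimes> g \<in> B (nat \<lceil>2 * D + 2 * \<delta>\<rceil>)" using gc g0c by (simp add: in_B)
    moreover have "g = g0 \<otimes> (inv g0 \<otimes> g)" using gc g0c by (simp add: m_assoc[symmetric])
    ultimately show "g \<in> (\<otimes>) g0 ` B (nat \<lceil>2 * D + 2 * \<delta>\<rceil>)" by blast
  qed
  then have "card {g \<in> Sph k. h \<in> Sh g} \<le> card ((\<otimes>) g0 ` B (nat \<lceil>2 * D + 2 * \<delta>\<rceil>))"
    by (intro card_mono) auto
  then show ?thesis using card_left_translate_B[OF g0c] by simp
next
  case True
  then show ?thesis by (metis card.empty le0)
qed

text \<open>Provides the truncation hypothesis of \<open>shadow_lower\<close> for the scalar series.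
  If it failed for all \<open>n\<close>, the partial sums would gain a factor 4/3 every
  \<open>k\<close> steps, whereas at the critical exponent they grow subexponentially.\<close>

lemma weighted_ball_growth:
  "\<exists>n\<ge>k. sum p (B n) - sum p (B (n - k)) \<le> sum p (B n) / 4"
proof (rule ccontr)
  assume "\<not> ?thesis"
  then have step: "sum p (B (n - k)) < 3 / 4 * sum p (B n)" if "n \<ge> k" for n using that by force
  have k: "k > 0"
  proof (rule ccontr)
    assume "\<not> k > 0"
    then have "sum p (B 0) < 3 / 4 * sum p (B 0)" using step[of 0] by simp
    moreover have "sum p (B 0) \<ge> 0" by (intro sum_nonneg) auto
    ultimately show False by linarith
  qed
  have low: "(4 / 3) ^ m \<le> sum p (B (m * k))" for m
  proof (induction m)
    case 0
    have "p \<one> \<le> sum p (B 0)" by (intro member_le_sum) auto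
    then show ?case by (simp add: p_def)
  next
    case (Suc m)
    then show ?case using step[of "Suc m * k"] by simp
  qed
  \<comment> \<open>\<open>r\<close> is the square root of 4/3, and \<epsilon> is tuned to
    \<open>exp (\<epsilon> * real (m * k)) = r ^ m\<close>; a factor \<open>r ^ m\<close> thus
    survives against a linear bound.\<close>
  define r :: real where "r = exp (ln (4 / 3) / 2)"
  define \<epsilon> where "\<epsilon> = ln (4 / 3) / 2 / real k"
  have "(0::real) < ln (4 / 3)" by simp
  then have "\<epsilon> > 0" "r > 1" using k by (simp_all add: \<epsilon>_def r_def)
  obtain K where K: "K > 0" "\<And>n. real (card (B n)) \<le> K * exp ((\<omega> + \<epsilon>) * real n)"
    using card_B_le_exp[OF \<open>\<epsilon> > 0\<close>] by auto
  have up: "sum p (B n) \<le> (real n + 1) * (K * exp (\<epsilon> * n))" for n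
  proof -
    have "sum p (B n) = (\<Sum>j\<le>n. sum p (Sph j))" by (rule sum_B_Sph)
    also have "\<dots> \<le> (\<Sum>j\<le>n. K * exp (\<epsilon> * n))"
    proof (rule sum_mono)
      fix j assume j: "j \<in> {..n}"
      have "sum p (Sph j) = (\<Sum>h\<in>Sph j. exp (- (\<omega> * real j)))" by (rule sum.cong) (auto simp: in_Sph p_def)
      then have "sum p (Sph j) = real (card (Sph j)) * exp (- (\<omega> * real j))" by simp
      also have "\<dots> \<le> real (card (B j)) * exp (- (\<omega> * real j))"
        by (intro mult_right_mono) (auto intro!: card_mono Sph_subset_B)
      also have "\<dots> \<le> K * exp ((\<omega> + \<epsilon>) * real j) * exp (- (\<omega> * real j))" using K by (intro mult_right_mono) auto
      also have "\<dots> = K * exp (\<epsilon> * real j)" by (simp add: algebra_simps flip: exp_add)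
      also have "\<dots> \<le> K * exp (\<epsilon> * n)" using K \<open>\<epsilon> > 0\<close> j by auto
      finally show "sum p (Sph j) \<le> K * exp (\<epsilon> * n)" .
    qed
    also have "\<dots> = (real n + 1) * (K * exp (\<epsilon> * n))" by (simp add: algebra_simps)
    finally show ?thesis .
  qed
  have "r ^ m \<le> (K * real k) * real m + K" for m
  proof -
    have e1: "exp (\<epsilon> * real (m * k)) = r ^ m" using k by (simp add: \<epsilon>_def r_def exp_of_nat_mult[symmetric])
    have "r * r = 4 / 3" unfolding r_def by (simp flip: exp_add)
    then have "(4 / 3) ^ m = r ^ m * r ^ m" by (metis power_mult_distrib)
    then have "r ^ m * r ^ m \<le> ((real (m * k) + 1) * K) * r ^ m"
      using low[of m] up[of "m * k"] e1 by simp
    moreover have "r ^ m > 0" using \<open>r > 1\<close> by simp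
    ultimately have "r ^ m \<le> (real (m * k) + 1) * K" by (metis mult_right_le_imp_le)
    then show ?thesis by (simp add: algebra_simps)
  qed
  moreover obtain n0 where "\<forall>n\<ge>n0. (K * real k) * real n + K < r ^ n" using linear_less_power[OF \<open>r > 1\<close>] by blast
  ultimately show False by (meson le_refl not_le)
qed

text \<open>Coornaert's upper bound, from the shadow lemma for the trivial representation on the
  reals with \<open>f = 1\<close>: shadows of points of \<open>Sph k\<close> each carry a fraction
  at least \<open>exp (- (\<omega> * k)) / 2\<close> of the mass and overlap boundedly.\<close>

lemma card_Sph_le:
  "\<exists>C1\<ge>1. \<forall>k. real (card (Sph k)) \<le> C1 * exp (\<omega> * k)"
proof -
  interpret sc: rep_metric G S \<delta> D "\<lambda>g v. v" "{0::real..}" "1::real"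
    by unfold_locales (auto simp: linear_id[unfolded id_def])
  define M where "M = card (B (nat \<lceil>2 * D + 2 * \<delta>\<rceil>))"
  have sca: "sc.a A = sum p A" for A by (simp add: sc.a_def)
  have "real (card (Sph k)) \<le> (2 * M) * exp (\<omega> * k)" for k
  proof -
    obtain n where n: "n \<ge> k" "sum p (B n) - sum p (B (n - k)) \<le> sum p (B n) / 4"
      using weighted_ball_growth by blast
    define P where "P = sum p (B n)"
    have "p \<one> \<le> P" unfolding P_def by (intro member_le_sum) auto
    then have "P > 0" by (simp add: p_def)
    have "sum p (B (n - k)) \<le> P" unfolding P_def by (intro sum_mono2 B_mono) auto
    then have diff: "norm (sc.u n - sc.u (n - k)) \<le> norm (sc.u n) / 4"
      using n(2) \<open>P > 0\<close> by (simp add: sc.u_def sca P_def)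
    have "real (card (Sph k)) * (exp (- (\<omega> * k)) / 2 * P) = (\<Sum>g\<in>Sph k. exp (- (\<omega> * k)) / 2 * P)" by simp
    also have "\<dots> \<le> (\<Sum>g\<in>Sph k. sum p (Sh g \<inter> B n))"
    proof (rule sum_mono)
      fix g assume g: "g \<in> Sph k"
      then have "exp (- (\<omega> * len g)) / 2 * norm (sc.u n) \<le> norm (sc.a (Sh g \<inter> B n))"
        using n diff by (intro sc.shadow_lower) (auto simp: in_Sph)
      moreover have "sum p (Sh g \<inter> B n) \<ge> 0" by (intro sum_nonneg) auto
      ultimately show "exp (- (\<omega> * k)) / 2 * P \<le> sum p (Sh g \<inter> B n)"
        using g \<open>P > 0\<close> by (simp add: sc.u_def sca P_def in_Sph)
    qed
    also have "\<dots> = (\<Sum>g\<in>Sph k. \<Sum>h\<in>B n. if h \<in> Sh g then p h else 0)"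
      by (rule sum.cong[OF refl], subst Int_commute, rule sum.inter_restrict, simp)
    also have "\<dots> = (\<Sum>h\<in>B n. \<Sum>g\<in>Sph k. if h \<in> Sh g then p h else 0)" by (rule sum.swap)
    also have "\<dots> \<le> (\<Sum>h\<in>B n. M * p h)"
    proof (rule sum_mono)
      fix h assume h: "h \<in> B n"
      have "(\<Sum>g\<in>Sph k. if h \<in> Sh g then p h else 0) = real (card {g \<in> Sph k. h \<in> Sh g}) * p h"
        by (simp add: sum.inter_filter[symmetric])
      also have "\<dots> \<le> M * p h"
        using Sph_Sh_multiplicity[of h k] h unfolding M_def by (intro mult_right_mono) (auto simp: in_B)
      finally show "(\<Sum>g\<in>Sph k. if h \<in> Sh g then p h else 0) \<le> M * p h" .
    qed
    also have "\<dots> = M * P" by (simp add: P_def sum_distrib_left)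
    finally have "(real (card (Sph k)) * exp (- (\<omega> * k)) / 2) * P \<le> M * P" by simp
    then have "real (card (Sph k)) * exp (- (\<omega> * k)) / 2 \<le> M" using \<open>P > 0\<close> mult_right_le_imp_le by blast
    then have "real (card (Sph k)) \<le> 2 * M / exp (- (\<omega> * k))" by (simp add: field_simps)
    also have "\<dots> = 2 * M * exp (\<omega> * k)" by (simp add: exp_minus field_simps)
    finally show ?thesis .
  qed
  moreover have "1 \<le> real (2 * M)"
  proof -
    have "M > 0" unfolding M_def by (rule card_B_pos)
    then show ?thesis by simp
  qed
  ultimately show ?thesis by (intro exI[of _ "real (2 * M)"]) auto
qed

end

context rep_metric begin

lemma norm_sum_Sph_le:
  assumes C1: "\<And>k. real (card (Sph k)) \<le> C1 * exp (\<omega> * k)" and v: "v \<in> C"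
  shows "norm (\<Sum>h\<in>Sph j. \<pi> h v) \<le> C1 * exp (\<omega> * j) * norm v"
proof -
  have "norm (\<Sum>h\<in>Sph j. \<pi> h v) \<le> (\<Sum>h\<in>Sph j. norm v)"
    by (rule sum_norm_le) (use v in \<open>auto simp: in_Sph \<pi>_norm\<close>)
  also have "\<dots> \<le> C1 * exp (\<omega> * j) * norm v" using C1[of j] by (simp add: mult_right_mono)
  finally show ?thesis .
qed

lemma a_Sph: "a (Sph j) = exp (- (\<omega> * real j)) *\<^sub>R (\<Sum>h\<in>Sph j. \<pi> h f)"
  unfolding a_def scaleR_sum_right by (rule sum.cong) (auto simp: in_Sph p_def)

lemma norm_a_Sph_le:
  assumes C1: "\<And>k. real (card (Sph k)) \<le> C1 * exp (\<omega> * k)"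
  shows "norm (a (Sph j)) \<le> C1 * norm f"
proof -
  have "norm (a (Sph j)) \<le> exp (- (\<omega> * real j)) * (C1 * exp (\<omega> * j) * norm f)"
    unfolding a_Sph using norm_sum_Sph_le[OF C1 f_C, of j] by (simp add: mult_left_mono)
  also have "\<dots> = C1 * norm f * (exp (- (\<omega> * real j)) * exp (\<omega> * j))" by simp
  also have "\<dots> = C1 * norm f" by (simp flip: exp_add)
  finally show ?thesis .
qed

lemma u_sum_Sph: "u n = (\<Sum>j\<le>n. a (Sph j))"
  unfolding u_def a_def by (rule sum_B_Sph)

text \<open>The weight cancels the cardinality of a sphere, so each sphere adds a bounded vector.
  Moving the cutoff by a fixed amount is therefore negligible once \<open>norm (u n)\<close> is
  large.\<close>

lemma norm_u_diff_le:
  assumes C1: "\<And>k. real (card (Sph k)) \<le> C1 * exp (\<omega> * k)" and "m \<le> n"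
  shows "norm (u n - u m) \<le> real (n - m) * (C1 * norm f)"
proof -
  have "u n - u m = (\<Sum>j\<in>{m<..n}. a (Sph j))"
  proof -
    have "{..n} - {..m} = {m<..n}" by auto
    then show ?thesis using sum_diff[of "{..n}" "{..m}" "\<lambda>j. a (Sph j)"] assms(2) by (simp add: u_sum_Sph)
  qed
  also have "norm \<dots> \<le> (\<Sum>j\<in>{m<..n}. C1 * norm f)"
    by (rule sum_norm_le) (rule norm_a_Sph_le[OF C1])
  finally show ?thesis by simp
qed

lemma norm_u_le:
  assumes C1: "\<And>k. real (card (Sph k)) \<le> C1 * exp (\<omega> * k)"
  shows "norm (u n) \<le> (real n + 1) * (C1 * norm f)"
proof -
  have "norm (u n) \<le> (\<Sum>j\<le>n. C1 * norm f)"
    unfolding u_sum_Sph by (rule sum_norm_le) (rule norm_a_Sph_le[OF C1])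
  then show ?thesis by (simp add: algebra_simps)
qed

end

section \<open>Almost invariant vectors from maximal growth\<close>

text \<open>When the triangle inequality is almost an equality, no partial sum can deviate much from
  the direction of the total: the remaining terms are too short to compensate.\<close>

lemma aligned_part:
  fixes f :: "'i \<Rightarrow> 'v::real_inner"
  assumes "finite I" "J \<subseteq> I" and le: "(\<Sum>i\<in>I. norm (f i)) \<le> (1 + \<epsilon>) * norm (sum f I)"
  shows "(norm (sum f J) - \<epsilon> * norm (sum f I)) * norm (sum f I) \<le> inner (sum f J) (sum f I)"
proof -
  define V where "V = sum f I"
  have split: "V = sum f (I - J) + sum f J" "(\<Sum>i\<in>I. norm (f i)) = (\<Sum>i\<in>I - J. norm (f i)) + (\<Sum>i\<in>J. norm (f i))"
    unfolding V_def using assms by (auto intro: sum.subset_diff)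
  have "norm (sum f (I - J)) \<le> (1 + \<epsilon>) * norm V - norm (sum f J)"
    using norm_sum[of f "I - J"] norm_sum[of f J] split(2) le by (simp add: V_def)
  then have "norm (sum f (I - J)) * norm V \<le> ((1 + \<epsilon>) * norm V - norm (sum f J)) * norm V"
    by (rule mult_right_mono) simp
  moreover have "inner (sum f (I - J)) V \<le> norm (sum f (I - J)) * norm V" by (rule norm_cauchy_schwarz)
  moreover have "inner V V = inner (sum f (I - J)) V + inner (sum f J) V"
    using split(1) by (metis inner_add_left)
  moreover have "inner V V = norm V * norm V" by (simp add: dot_square_norm power2_eq_square)
  ultimately show ?thesis unfolding V_def[symmetric] by (simp add: algebra_simps)
qed

text \<open>Unit vectors whose inner product with a common unit vector is at least 7/8 are within
  1/2 of it, hence within 1 of each other.\<close>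

lemma aligned_pair:
  fixes A B V :: "'v::real_inner"
  assumes V: "V \<noteq> 0" and A: "7 / 8 * norm A * norm V \<le> inner A V" and B: "7 / 8 * norm B * norm V \<le> inner B V"
  shows "norm A * norm B / 2 \<le> inner A B"
proof (cases "A = 0 \<or> B = 0")
  case False
  define x y v where "x = A /\<^sub>R norm A" "y = B /\<^sub>R norm B" "v = V /\<^sub>R norm V"
  note d = x_y_v_def
  have n: "norm x = 1" "norm y = 1" "norm v = 1" using False V by (auto simp: d)
  have i: "inner x v \<ge> 7 / 8" "inner y v \<ge> 7 / 8"
    using False V A B by (auto simp: d field_simps)
  have sq: "(norm (s - t))\<^sup>2 = 2 - 2 * inner s t" if "norm s = 1" "norm t = 1" for s t :: 'v
    using that dot_norm_neg[of s t] by simp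
  have "(norm (x - v))\<^sup>2 \<le> 1 / 4" "(norm (y - v))\<^sup>2 \<le> 1 / 4" using sq n i by auto
  then have "(norm (x - v))\<^sup>2 \<le> (1 / 2)\<^sup>2" "(norm (y - v))\<^sup>2 \<le> (1 / 2)\<^sup>2" by (simp_all add: power2_eq_square)
  then have "norm (x - v) \<le> 1 / 2" "norm (y - v) \<le> 1 / 2" by (auto intro: power2_le_imp_le)
  then have "norm (x - y) \<le> 1" using norm_triangle_ineq4[of "x - v" "y - v"] by simp
  then have "(norm (x - y))\<^sup>2 \<le> 1" by (simp add: power_le_one)
  then have "1 / 2 \<le> inner x y" using sq[OF n(1,2)] by simp
  then show ?thesis using False by (simp add: d field_simps)
qed auto

context growing_hyperbolic begin

lemma Sph_nonempty: "Sph r \<noteq> {}"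
proof -
  have "\<exists>g\<in>carrier G. r \<le> len g"
  proof (rule ccontr)
    assume "\<not> ?thesis"
    then have "len g \<le> r" if "g \<in> carrier G" for g using that by (meson nat_le_linear)
    then have sub: "B n \<subseteq> B r" for n by (auto simp: in_B)
    have "1 + \<omega> * real n \<le> card (B r)" for n
    proof -
      have "1 + \<omega> * real n \<le> exp (\<omega> * real n)" by (rule exp_ge_add_one_self)
      also have "\<dots> \<le> card (B n)" by (rule exp_le_card_B)
      also have "\<dots> \<le> card (B r)" using sub by (simp add: card_mono)
      finally show ?thesis .
    qed
    from this[of "nat \<lceil>card (B r) / \<omega>\<rceil>"] have "1 + \<omega> * (card (B r) / \<omega>) \<le> card (B r)"
      using \<omega>_pos mult_left_mono[of "card (B r) / \<omega>" "real (nat \<lceil>card (B r) / \<omega>\<rceil>)" \<omega>] by (simp add: real_nat_ceiling_ge)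
    then show False using \<omega>_pos by simp
  qed
  then obtain g where "g \<in> carrier G" "r \<le> len g" by auto
  then obtain y where "y \<in> carrier G" "len y = r" using geodesic_point by metis
  then show ?thesis by (auto simp: Sph_def)
qed

section \<open>Nets on spheres and nested cubes\<close>

definition is_net where "is_net r Y \<longleftrightarrow> Y \<subseteq> Sph r \<and>
   (\<forall>y\<in>Y. \<forall>y'\<in>Y. y \<noteq> y' \<longrightarrow> gp y y' < real r - D - 4 * \<delta>) \<and>
   (\<forall>g\<in>Sph r. \<exists>y\<in>Y. real r - D - 4 * \<delta> \<le> gp y g)"

definition net where "net r = (SOME Y. is_net r Y)"

text \<open>A separated set of maximal cardinality is a net, since a point far from all its members
  could be added.\<close>

lemma is_net_net: "is_net r (net r)"
proof -
  define Q where "Q Y \<longleftrightarrow> Y \<subseteq> Sph r \<and> (\<forall>y\<in>Y. \<forall>y'\<in>Y. y \<noteq> y' \<longrightarrow> gp y y' < real r - D - 4 * \<delta>)" for Y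
  have "\<exists>Y. Q Y \<and> (\<forall>Y'. Q Y' \<longrightarrow> card Y' \<le> card Y)"
  proof (rule ex_has_greatest_nat[of Q "{}"])
    show "\<forall>Y. Q Y \<longrightarrow> card Y < Suc (card (Sph r))" by (auto simp: Q_def card_mono less_Suc_eq_le)
  qed (simp add: Q_def)
  then obtain Y where Y: "Q Y" "\<And>Y'. Q Y' \<Longrightarrow> card Y' \<le> card Y" by auto
  have fin: "finite Y" using Y(1) finite_subset[OF _ finite_Sph] by (auto simp: Q_def)
  have "\<exists>y\<in>Y. real r - D - 4 * \<delta> \<le> gp y g" if g: "g \<in> Sph r" for g
  proof (rule ccontr)
    assume "\<not> ?thesis"
    then have far: "gp y g < real r - D - 4 * \<delta>" if "y \<in> Y" for y using that by force
    have "g \<notin> Y"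
    proof
      assume "g \<in> Y"
      then show False using far[of g] g gp_self[of g] \<delta>_nonneg by (simp add: in_Sph)
    qed
    moreover have "Q (insert g Y)"
      unfolding Q_def
    proof (intro conjI ballI impI)
      show "insert g Y \<subseteq> Sph r" using Y(1) g by (simp add: Q_def)
      fix y y' assume yy: "y \<in> insert g Y" "y' \<in> insert g Y" "y \<noteq> y'"
      have c: "g \<in> carrier G" "\<And>y. y \<in> Y \<Longrightarrow> y \<in> carrier G" using g Y(1) by (auto simp: Q_def in_Sph)
      show "gp y y' < real r - D - 4 * \<delta>"
        using yy far gp_commute[OF c(1) c(2)] Y(1) unfolding Q_def by auto
    qed
    ultimately show False using Y(2)[of "insert g Y"] fin by simp
  qed
  then have "is_net r Y" using Y(1) by (simp add: is_net_def Q_def)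
  then show ?thesis unfolding net_def by (rule someI)
qed

lemma net_Sph: "net r \<subseteq> Sph r" using is_net_net by (simp add: is_net_def)
lemma finite_net [simp]: "finite (net r)" using finite_subset[OF net_Sph] by simp
lemma net_nonempty: "net r \<noteq> {}" using is_net_net[of r] Sph_nonempty[of r] by (auto simp: is_net_def)
lemma net_carrier: "y \<in> net r \<Longrightarrow> y \<in> carrier G" using net_Sph[of r] by (auto simp: in_Sph)
lemma net_len: "y \<in> net r \<Longrightarrow> len y = r" using net_Sph[of r] by (auto simp: in_Sph)

text \<open>The parent of \<open>h\<close>: the net point that agrees longest with \<open>h\<close>,
  with ties broken by choice.\<close>

definition par where "par r h = (SOME y. y \<in> net r \<and> (\<forall>y'\<in>net r. gp y' h \<le> gp y h))"

lemma par: "par r h \<in> net r" "y' \<in> net r \<Longrightarrow> gp y' h \<le> gp (par r h) h"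
proof -
  define m where "m = Max ((\<lambda>y. gp y h) ` net r)"
  have "m \<in> (\<lambda>y. gp y h) ` net r" unfolding m_def using net_nonempty by (intro Max_in) auto
  then obtain y where "y \<in> net r" "m = gp y h" by auto
  moreover have "gp y' h \<le> m" if "y' \<in> net r" for y' unfolding m_def using that by (intro Max_ge) auto
  ultimately have "\<exists>y. y \<in> net r \<and> (\<forall>y'\<in>net r. gp y' h \<le> gp y h)" by auto
  from someI_ex[OF this] show "par r h \<in> net r" "y' \<in> net r \<Longrightarrow> gp y' h \<le> gp (par r h) h"
    by (auto simp: par_def)
qed

lemma par_close:
  assumes h: "h \<in> carrier G" "r \<le> len h" shows "real r - D - 5 * \<delta> \<le> gp (par r h) h"
proof -
  obtain g where g: "g \<in> carrier G" "len g = r" "len (inv g \<otimes> h) = len h - r" using geodesic_point[OF h] .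
  have gh: "gp g h = r" using gp_geodesic[OF h(1) g(3,2) h(2)] .
  have "g \<in> Sph r" using g by (simp add: in_Sph)
  then obtain y where y: "y \<in> net r" "real r - D - 4 * \<delta> \<le> gp y g" using is_net_net[of r] by (auto simp: is_net_def)
  have "min (gp y g) (gp g h) - \<delta> \<le> gp y h" by (intro hyp net_carrier[OF y(1)] g h)
  then have "real r - D - 5 * \<delta> \<le> gp y h" using y gh \<delta>_nonneg by simp
  then show ?thesis using par(2)[OF y(1), of h] by simp
qed

text \<open>The \<open>4 * \<delta>\<close> in \<open>is_net\<close> is made for this: a second net
  point agreeing with \<open>h\<close> as long as \<open>y\<close> does would violate separation
  after one use of hyperbolicity.\<close>

lemma par_unique:
  assumes h: "h \<in> carrier G" and y: "y \<in> net r" "real r - D - 3 * \<delta> \<le> gp y h" shows "par r h = y"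
proof (rule ccontr)
  assume ne: "par r h \<noteq> y"
  have "real r - D - 3 * \<delta> \<le> gp (par r h) h" using par(2)[OF y(1), of h] y(2) by simp
  moreover have "min (gp (par r h) h) (gp h y) - \<delta> \<le> gp (par r h) y"
    by (intro hyp net_carrier[OF y(1)] net_carrier[OF par(1)] h)
  ultimately have "real r - D - 4 * \<delta> \<le> gp (par r h) y"
    using y(2) gp_commute[OF h net_carrier[OF y(1)]] by simp
  then show False using is_net_net[of r] ne y(1) par(1)[of r h] unfolding is_net_def by fastforce
qed

text \<open>These are nested partitions in the manner of Christ's dyadic cubes. Errors do not accumulate over the
  levels: by hyperbolicity a point far out forgets the error made there. The recursion runs from the finest
  level \<open>K\<close> to the coarsest level \<open>0\<close>.\<close>

primrec cube_up where
  "cube_up L K 0 h = par (K * L) h"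
| "cube_up L K (Suc j) h = par ((K - Suc j) * L) (cube_up L K j h)"

definition cube where "cube L K k h = cube_up L K (K - k) h"

lemma cube_top: "cube L K K h = par (K * L) h"
  by (simp add: cube_def)

lemma cube_step: "k < K \<Longrightarrow> cube L K k h = par (k * L) (cube L K (Suc k) h)"
  by (simp add: cube_def Suc_diff_Suc[symmetric])

lemma cube_net: "k \<le> K \<Longrightarrow> cube L K k h \<in> net (k * L)"
  using cube_top cube_step par(1) by (metis le_neq_implies_less)

text \<open>The parent at level \<open>k\<close> is taken of a net point that, by the size of
  \<open>L\<close>, agrees with \<open>h\<close> beyond depth \<open>k * L\<close>. Passing from
  that net point to \<open>h\<close> costs a single \<delta>, whatever happened at finer
  levels.\<close>

lemma cube_close:
  assumes h: "h \<in> carrier G" "K * L \<le> len h" and L: "D + 6 * \<delta> \<le> L" and "k \<le> K"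
  shows "real (k * L) - D - 6 * \<delta> \<le> gp (cube L K k h) h"
  using \<open>k \<le> K\<close>
proof (induction rule: inc_induct)
  case base
  then show ?case using par_close[OF h] \<delta>_nonneg by (simp add: cube_top)
next
  case (step k)
  define y where "y = cube L K (Suc k) h"
  have y: "y \<in> net (Suc k * L)" unfolding y_def using step by (intro cube_net) auto
  have "real (k * L) - D - 5 * \<delta> \<le> gp (par (k * L) y) y"
    using net_len[OF y] by (intro par_close net_carrier[OF y]) simp
  moreover have "real (k * L) \<le> gp y h" using step L unfolding y_def by (simp add: algebra_simps)
  moreover have "min (gp (par (k * L) y) y) (gp y h) - \<delta> \<le> gp (par (k * L) y) h"
    by (intro hyp net_carrier[OF y] net_carrier[OF par(1)] h)
  ultimately have "real (k * L) - D - 6 * \<delta> \<le> gp (par (k * L) y) h" using \<delta>_nonneg by simp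
  then show ?case using cube_step[OF step(2)] by (simp add: y_def)
qed

text \<open>Ensures that a cube contains the shadow of its net point: one \<delta> replaces
  \<open>h\<close> by its net point of level \<open>Suc k\<close>, to which
  \<open>par_unique\<close> applies.\<close>

lemma cube_unique:
  assumes h: "h \<in> carrier G" "K * L \<le> len h" and L: "D + 6 * \<delta> \<le> L" and "k \<le> K"
    and y: "y \<in> net (k * L)" "real (k * L) - D - 2 * \<delta> \<le> gp y h"
  shows "cube L K k h = y"
proof (cases "k = K")
  case True
  then show ?thesis using par_unique[OF h(1), of y "K * L"] y \<delta>_nonneg by (simp add: cube_top)
next
  case False
  then have k: "k < K" using \<open>k \<le> K\<close> by simp
  define z where "z = cube L K (Suc k) h"
  have z: "z \<in> net (Suc k * L)" unfolding z_def using k by (intro cube_net) auto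
  have "real (Suc k * L) - D - 6 * \<delta> \<le> gp z h" unfolding z_def using k by (intro cube_close h L) auto
  then have "real (k * L) \<le> gp h z" using L gp_commute[OF h(1) net_carrier[OF z]] by (simp add: algebra_simps)
  moreover have "min (gp y h) (gp h z) - \<delta> \<le> gp y z" by (intro hyp net_carrier[OF y(1)] net_carrier[OF z] h)
  ultimately have "real (k * L) - D - 3 * \<delta> \<le> gp y z" using y(2) \<delta>_nonneg by simp
  then show ?thesis using par_unique[OF net_carrier[OF z] y(1)] cube_step[OF k] by (simp add: z_def)
qed

end

context rep_metric begin

lemma a_partition:
  assumes "finite A" "finite Y" "\<And>h. h \<in> A \<Longrightarrow> \<phi> h \<in> Y"
  shows "a A = (\<Sum>y\<in>Y. a {h \<in> A. \<phi> h = y})"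
  unfolding a_def using assms sum.group[of A Y \<phi> "\<lambda>h. p h *\<^sub>R \<pi> h f"] by (auto simp: image_subset_iff)

text \<open>The sums over all cubes of a level of the norms of the corresponding parts of \<open>u\<close> increase with the
  level but remain bounded. On a level where they hardly increase there is a cube all of whose parts of the
  next level are almost parallel. Deep inside this cube one finds a point \<open>y\<close> such that the parts in the
  shadows of \<open>y\<close> and \<open>y x\<close> are almost parallel, whereas these parts are dominated by the
  translates of \<open>u\<close> by \<open>y\<close> and \<open>y x\<close>.\<close>

lemma almost_invariant:
  fixes R J L K n :: nat and \<epsilon> C1 :: real
  assumes C1: "\<And>k. real (card (Sph k)) \<le> C1 * exp (\<omega> * k)" and f1: "norm f \<le> 1"
    and J: "R + (2 * D + 2 * \<delta>) \<le> J"
    and L: "2 * (D + 6 * \<delta>) \<le> L" "J + R + D + 7 * \<delta> \<le> L"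
    and \<epsilon>: "\<epsilon> = exp (- (\<omega> * (J + R)) - 2 * \<omega> * (D + 6 * \<delta>)) / 32"
    and K: "0 < K" "4 * C1 * exp (2 * \<omega> * (D + 6 * \<delta>)) < (1 + \<epsilon>) ^ K"
    and n: "4 * (K * L + 1) * C1 * exp (\<omega> * (K * L)) \<le> norm (u n)"
    and x: "x \<in> B R"
  shows "exp (- (4 * \<omega> * (D + \<delta>))) / 32 * (norm (u n))\<^sup>2 \<le> inner (u n) (\<pi> x (u n))"
proof -
  define U where "U = norm (u n)"
  \<comment> \<open>Cubes are controlled only beyond depth \<open>K * L\<close>; the discarded inner
    ball is negligible by the size of \<open>norm (u n)\<close>.\<close>
  define \<Omega> where "\<Omega> = {h \<in> B n. K * L \<le> len h}"
  define D1 where "D1 = D + 6 * \<delta>"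
  define Q where "Q k y = {h \<in> \<Omega>. cube L K k h = y}" for k y
  define X where "X k = (\<Sum>y\<in>net (k * L). norm (a (Q k y)))" for k
  have \<epsilon>_pos: "\<epsilon> > 0" unfolding \<epsilon> by simp
  have "1 \<le> C1" using C1[of 0] Sph_nonempty[of 0] by (simp add: Suc_le_eq card_gt_0_iff order_trans[rotated])
  have f1': "C1 * norm f \<le> C1" using f1 \<open>1 \<le> C1\<close> by (simp add: mult_left_le)
  have "4 * (K * L + 1) * C1 * 1 \<le> 4 * (K * L + 1) * C1 * exp (\<omega> * (K * L))"
    using \<open>1 \<le> C1\<close> \<omega>_pos by (intro mult_left_mono) auto
  then have U1: "4 * (K * L + 1) * C1 \<le> U" using n by (simp add: U_def)
  have "1 \<le> 4 * (K * L + 1) * C1" using mult_mono[of 1 "4 * real (K * L + 1)" 1 C1] \<open>1 \<le> C1\<close> by simp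
  then have U_pos: "U > 0" using U1 by linarith
  \<comment> \<open>\<open>norm (u n)\<close> is at most linear in \<open>n\<close>, so its size
    alone forces \<open>n\<close> to be large.\<close>
  have KLn: "K * L \<le> n"
  proof -
    have "U \<le> (real n + 1) * C1"
    proof -
      have "(real n + 1) * (C1 * norm f) \<le> (real n + 1) * C1" using f1' by (intro mult_left_mono) auto
      then show ?thesis using norm_u_le[OF C1, of n] unfolding U_def by linarith
    qed
    then have "(4 * (K * L + 1)) * C1 \<le> (real n + 1) * C1" using U1 by simp
    then have "4 * (real (K * L) + 1) \<le> real n + 1" using \<open>1 \<le> C1\<close> by simp
    then have "real (4 * (K * L + 1)) \<le> real (n + 1)" by simp
    then have "4 * (K * L + 1) \<le> n + 1" by (simp only: of_nat_le_iff)
    then show ?thesis by simp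
  qed
  have \<Omega>_B: "\<Omega> \<subseteq> B n" by (auto simp: \<Omega>_def)
  have \<Omega>_fin: "finite \<Omega>" using finite_subset[OF \<Omega>_B] by simp
  have \<Omega>_c: "\<Omega> \<subseteq> carrier G" using \<Omega>_B B_carrier by auto
  have \<Omega>_len: "K * L \<le> len h" if "h \<in> \<Omega>" for h using that by (simp add: \<Omega>_def)
  have LD: "D + 6 * \<delta> \<le> L" using \<delta>_nonneg by (intro order_trans[OF _ L(1)]) simp
  have Q_sub: "Q k y \<subseteq> \<Omega>" for k y by (auto simp: Q_def)
  have Q_B: "Q k y \<subseteq> B n" for k y using Q_sub \<Omega>_B by (rule order_trans)
  have Q_c: "Q k y \<subseteq> carrier G" for k y using Q_sub \<Omega>_c by (rule order_trans)
  \<comment> \<open>\<open>shadow_lower\<close> gives the factor 1/2, and the elements inside depth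
    \<open>K * L\<close> take away at most 1/4.\<close>
  have lower: "exp (- (\<omega> * len g)) / 4 * U \<le> norm (a (Sh g \<inter> \<Omega>))" if g: "g \<in> carrier G" "len g \<le> K * L" for g
  proof -
    have "norm (u n - u (n - len g)) \<le> len g * (C1 * norm f)"
      using norm_u_diff_le[OF C1, of "n - len g" n] g KLn by simp
    also have "\<dots> \<le> real (K * L + 1) * C1"
    proof (intro mult_mono f1')
      show "real (len g) \<le> real (K * L + 1)" using g by (simp only: of_nat_le_iff)
    qed (use \<open>1 \<le> C1\<close> in auto)
    also have "\<dots> \<le> U / 4" using U1 by (simp add: algebra_simps)
    finally have 1: "exp (- (\<omega> * len g)) / 2 * U \<le> norm (a (Sh g \<inter> B n))"
      unfolding U_def using g KLn by (intro shadow_lower) auto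
    define I where "I = {h \<in> Sh g. len h < K * L}"
    have I: "I \<subseteq> B (K * L)" by (auto simp: I_def in_B Sh_def)
    have "Sh g \<inter> B n = (Sh g \<inter> \<Omega>) \<union> I" "(Sh g \<inter> \<Omega>) \<inter> I = {}"
      using KLn by (auto simp: \<Omega>_def I_def in_B Sh_def)
    then have "a (Sh g \<inter> B n) = a (Sh g \<inter> \<Omega>) + a I"
      using a_union[of "Sh g \<inter> \<Omega>" I] \<Omega>_fin finite_subset[OF I] by simp
    then have 2: "norm (a (Sh g \<inter> B n)) \<le> norm (a (Sh g \<inter> \<Omega>)) + norm (a I)"
      by (simp add: norm_triangle_ineq)
    have "norm (a I) \<le> norm (u (K * L))"
      unfolding u_def using I B_carrier[of "K * L"] by (intro norm_le_C a_C a_mono) auto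
    also have "\<dots> \<le> (real (K * L) + 1) * (C1 * norm f)" by (rule norm_u_le[OF C1])
    also have "\<dots> \<le> (real (K * L) + 1) * C1" using f1' by (intro mult_left_mono) auto
    also have "\<dots> = exp (- (\<omega> * (K * L))) / 4 * (4 * (K * L + 1) * C1 * exp (\<omega> * (K * L)))"
      by (simp add: exp_minus field_simps)
    also have "\<dots> \<le> exp (- (\<omega> * (K * L))) / 4 * U" unfolding U_def by (intro mult_left_mono n) auto
    also have "\<dots> \<le> exp (- (\<omega> * len g)) / 4 * U"
    proof -
      have "real (len g) \<le> real (K * L)" using g by (simp only: of_nat_le_iff)
      then show ?thesis using \<omega>_pos U_pos by (intro mult_right_mono divide_right_mono) auto
    qed
    finally show ?thesis using 1 2 by linarith
  qed
  have X0: "U / 4 \<le> X 0"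
  proof -
    have "\<Omega> \<subseteq> Sh \<one>" using \<Omega>_c by (auto simp: Sh_def gp_def)
    then have "Sh \<one> \<inter> \<Omega> = \<Omega>" by auto
    then have "U / 4 \<le> norm (a \<Omega>)" using lower[of \<one>] by simp
    also have "a \<Omega> = (\<Sum>y\<in>net (0 * L). a (Q 0 y))"
      unfolding Q_def using \<Omega>_fin cube_net[of 0 K L] by (intro a_partition) auto
    also have "norm \<dots> \<le> X 0" unfolding X_def by (rule norm_sum)
    finally show ?thesis .
  qed
  have Q_close: "real (k * L) - D1 \<le> gp y h" if "h \<in> Q k y" "k \<le> K" for h k y
    using cube_close[of h K L k] that \<Omega>_c \<Omega>_len LD by (auto simp: Q_def D1_def)
  \<comment> \<open>Level 0 is treated separately because \<open>shadow_upper_norm\<close> requires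
    \<open>2 * D1 \<le> len y\<close>.\<close>
  have Q_upper: "norm (a (Q k y)) \<le> exp (2 * \<omega> * D1) * exp (- (\<omega> * (k * L))) * U"
    if k: "k \<le> K" and y: "y \<in> net (k * L)" for k y
  proof (cases "k = 0")
    case True
    have "norm (a (Q k y)) \<le> U"
      unfolding U_def u_def by (intro norm_le_C a_C a_mono Q_B Q_c B_carrier finite_B)
    also have "\<dots> \<le> exp (2 * \<omega> * D1) * U" using U_pos \<omega>_pos \<delta>_nonneg by (simp add: D1_def)
    finally show ?thesis using True by simp
  next
    case False
    then have "L \<le> k * L" by simp
    then have "real L \<le> real (k * L)" by (simp only: of_nat_le_iff)
    then have "norm (a (Q k y)) \<le> exp (\<omega> * (2 * D1 - len y)) * norm (u n)"
      using Q_close[OF _ k] net_len[OF y] L(1)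
      by (intro shadow_upper_norm Q_B net_carrier[OF y]) (simp_all add: D1_def)
    also have "exp (\<omega> * (2 * D1 - len y)) = exp (2 * \<omega> * D1) * exp (- (\<omega> * (k * L)))"
      using net_len[OF y] by (simp add: algebra_simps flip: exp_add)
    finally show ?thesis by (simp add: U_def)
  qed
  have XK: "X K \<le> C1 * exp (2 * \<omega> * D1) * U"
  proof -
    have "X K \<le> (\<Sum>y\<in>net (K * L). exp (2 * \<omega> * D1) * exp (- (\<omega> * (K * L))) * U)"
      unfolding X_def by (intro sum_mono Q_upper) auto
    also have "\<dots> = real (card (net (K * L))) * (exp (2 * \<omega> * D1) * exp (- (\<omega> * (K * L))) * U)" by simp
    also have "\<dots> \<le> (C1 * exp (\<omega> * (K * L))) * (exp (2 * \<omega> * D1) * exp (- (\<omega> * (K * L))) * U)"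
    proof (rule mult_right_mono)
      have "real (card (net (K * L))) \<le> card (Sph (K * L))" using net_Sph by (simp add: card_mono)
      then show "real (card (net (K * L))) \<le> C1 * exp (\<omega> * (K * L))" using C1[of "K * L"] by simp
    qed (use U_pos in auto)
    also have "\<dots> = C1 * exp (2 * \<omega> * D1) * U" by (simp add: exp_minus field_simps)
    finally show ?thesis .
  qed
  \<comment> \<open>In \<open>K\<close> steps \<open>X\<close> passes from at least
    \<open>U / 4\<close> to at most \<open>C1 * exp (2 * \<omega> * D1) * U\<close>. By the choice
    of \<open>K\<close>, not every step can gain a factor \<open>1 + \<epsilon>\<close>.\<close>
  have "\<exists>k<K. X (Suc k) \<le> (1 + \<epsilon>) * X k"
  proof (rule ccontr)
    assume "\<not> ?thesis"
    then have grow: "(1 + \<epsilon>) * X k \<le> X (Suc k)" if "k < K" for k using that by force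
    have "(1 + \<epsilon>) ^ k * (U / 4) \<le> X k" if "k \<le> K" for k
      using that
    proof (induction k)
      case (Suc k)
      then have "(1 + \<epsilon>) * ((1 + \<epsilon>) ^ k * (U / 4)) \<le> (1 + \<epsilon>) * X k" using \<epsilon>_pos by (intro mult_left_mono) auto
      then show ?case using grow[of k] Suc.prems by simp
    qed (use X0 in simp)
    from this[of K] XK have "(1 + \<epsilon>) ^ K * (U / 4) \<le> C1 * exp (2 * \<omega> * D1) * U" by simp
    then have "(1 + \<epsilon>) ^ K \<le> 4 * C1 * exp (2 * \<omega> * D1)" using U_pos by (simp add: field_simps)
    then show False using K(2) by (simp add: D1_def)
  qed
  then obtain k where k: "k < K" "X (Suc k) \<le> (1 + \<epsilon>) * X k" by auto
  define I where "I y = {y' \<in> net (Suc k * L). par (k * L) y' = y}" for y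
  have XS: "X (Suc k) = (\<Sum>y\<in>net (k * L). \<Sum>y'\<in>I y. norm (a (Q (Suc k) y')))"
    unfolding X_def I_def by (rule sum.group[symmetric]) (auto simp: par)
  \<comment> \<open>Averaging: the inequality between the sums over all cubes must hold in at least
    one cube.\<close>
  have "\<exists>y\<in>net (k * L). (\<Sum>y'\<in>I y. norm (a (Q (Suc k) y'))) \<le> (1 + \<epsilon>) * norm (a (Q k y))"
  proof (rule ccontr)
    assume "\<not> ?thesis"
    then have "(\<Sum>y\<in>net (k * L). (1 + \<epsilon>) * norm (a (Q k y))) < (\<Sum>y\<in>net (k * L). \<Sum>y'\<in>I y. norm (a (Q (Suc k) y')))"
      using net_nonempty by (intro sum_strict_mono) auto
    then have "(1 + \<epsilon>) * X k < X (Suc k)"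
      unfolding XS unfolding X_def by (simp add: sum_distrib_left)
    then show False using k by simp
  qed
  then obtain y where y: "y \<in> net (k * L)"
    and y_par: "(\<Sum>y'\<in>I y. norm (a (Q (Suc k) y'))) \<le> (1 + \<epsilon>) * norm (a (Q k y))" by auto
  have yc: "y \<in> carrier G" and yl: "len y = k * L" using net_carrier[OF y] net_len[OF y] by auto
  have kL: "k * L + L \<le> K * L"
  proof -
    have "Suc k * L \<le> K * L" using k by (intro mult_le_mono) auto
    then show ?thesis by simp
  qed
  have JRL: "J + R \<le> L" using L(2) \<delta>_nonneg by linarith
  have yKL: "len y \<le> K * L" using yl kL by linarith
  define V where "V = a (Q k y)"
  have V_eq: "V = (\<Sum>y'\<in>I y. a (Q (Suc k) y'))"
  proof -
    have "V = (\<Sum>y'\<in>I y. a {h \<in> Q k y. cube L K (Suc k) h = y'})"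
      unfolding V_def
    proof (rule a_partition)
      show "finite (Q k y)" using finite_subset[OF Q_sub \<Omega>_fin] .
      show "finite (I y)" by (simp add: I_def)
      show "cube L K (Suc k) h \<in> I y" if "h \<in> Q k y" for h
        using that k cube_net[of "Suc k" K L h] cube_step[of k K L h] by (simp add: Q_def I_def)
    qed
    also have "\<dots> = (\<Sum>y'\<in>I y. a (Q (Suc k) y'))"
    proof (rule sum.cong[OF refl])
      fix y' assume "y' \<in> I y"
      then have "{h \<in> Q k y. cube L K (Suc k) h = y'} = Q (Suc k) y'"
        using k cube_step[of k K L] by (auto simp: Q_def I_def)
      then show "a {h \<in> Q k y. cube L K (Suc k) h = y'} = a (Q (Suc k) y')" by simp
    qed
    finally show ?thesis .
  qed
  have inQ: "h \<in> Q k y" if "h \<in> \<Omega>" "real (k * L) - D - 2 * \<delta> \<le> gp y h" for h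
    using cube_unique[of h K L k y] that \<Omega>_c \<Omega>_len k LD y by (auto simp: Q_def)
  have V_pos: "norm V > 0"
  proof -
    have "Sh y \<inter> \<Omega> \<subseteq> Q k y"
      using inQ yl \<delta>_nonneg by (auto simp: Sh_def)
    then have "norm (a (Sh y \<inter> \<Omega>)) \<le> norm V"
      unfolding V_def using \<Omega>_c by (intro norm_le_C a_C a_mono Q_c finite_subset[OF Q_sub \<Omega>_fin]) auto
    moreover have "0 < exp (- (\<omega> * len y)) / 4 * U" using U_pos by simp
    ultimately show ?thesis using lower[OF yc yKL] by linarith
  qed
  obtain h0 where h0: "h0 \<in> Sh y" "h0 \<in> \<Omega>"
  proof -
    have "Sh y \<inter> \<Omega> \<noteq> {}"
    proof
      assume "Sh y \<inter> \<Omega> = {}"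
      then have "norm (a (Sh y \<inter> \<Omega>)) = 0" by (simp add: a_def)
      moreover have "0 < exp (- (\<omega> * len y)) / 4 * U" using U_pos by simp
      ultimately show False using lower[OF yc yKL] by linarith
    qed
    then show ?thesis using that by auto
  qed
  have h0c: "h0 \<in> carrier G" using h0 \<Omega>_c by auto
  have h0l: "k * L + J \<le> len h0" using \<Omega>_len[OF h0(2)] kL JRL by linarith
  \<comment> \<open>A point at depth \<open>J\<close> below \<open>y\<close>, in the direction of
    \<open>h0\<close>. Since \<open>J\<close> exceeds \<open>R\<close> by
    \<open>2 * D + 2 * \<delta>\<close>, the shadow of any point within \<open>R\<close> of
    \<open>y2\<close> stays inside the cube of \<open>y\<close>.\<close>
  obtain y2 where y2: "y2 \<in> carrier G" "len y2 = k * L + J" "len (inv y2 \<otimes> h0) = len h0 - (k * L + J)"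
    using geodesic_point[OF h0c h0l] .
  have y2h0: "gp y2 h0 = real (k * L + J)" by (rule gp_geodesic[OF h0c y2(3,2) h0l])
  have yy2: "real (k * L) - D - \<delta> \<le> gp y y2"
  proof -
    have "min (gp y h0) (gp h0 y2) - \<delta> \<le> gp y y2" by (rule hyp) fact+
    moreover have "real (k * L) - D \<le> gp y h0" using h0(1) yl by (simp add: Sh_def)
    moreover have "real (k * L) - D \<le> gp h0 y2" using y2h0 gp_commute[OF h0c y2(1)] by simp
    ultimately show ?thesis by linarith
  qed
  \<comment> \<open>\<open>A\<close> is carried by the cubes of level \<open>Suc k\<close> that meet
    the shadow of \<open>z\<close>. They cover this shadow, so \<open>A\<close> is large; by the
    size of \<open>L\<close> they are thin at the depth of \<open>z\<close>, so they stay in the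
    shadow of thickness \<open>D + \<delta>\<close> and \<open>A\<close> is dominated by a multiple
    of \<open>\<pi> z (u n)\<close>; being a sum over whole cubes, \<open>A\<close> is almost
    parallel to \<open>V\<close>.\<close>
  have part: "\<exists>A. A \<in> C \<and> 7 / 8 * norm A * norm V \<le> inner A V \<and> exp (- (\<omega> * len z)) / 4 * U \<le> norm A \<and>
      exp (\<omega> * (2 * (D + \<delta>) - len z)) *\<^sub>R \<pi> z (u n) - A \<in> C"
    if x: "x \<in> B R" and z: "z = y2 \<otimes> x" for x z
  proof -
    have xc: "x \<in> carrier G" "len x \<le> R" using x by (auto simp: in_B)
    have zc: "z \<in> carrier G" using z xc y2 by simp
    have zinv: "inv y2 \<otimes> z = x" using z xc y2 by (simp add: m_assoc[symmetric])
    have zl: "k * L + J \<le> len z + R" "len z \<le> k * L + J + R"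
      using len_diff[OF y2(1) zc] xc(2) y2(2) by (simp_all add: zinv)
    have "real (k * L + J) \<le> real (len z + R)" using zl(1) by (simp only: of_nat_le_iff)
    then have zlr: "real (k * L) + real J \<le> real (len z) + real R" by simp
    have zKL: "len z \<le> K * L" using zl kL JRL by linarith
    have y2z: "real (k * L + J) - R \<le> gp y2 z"
    proof -
      have "2 * gp y2 z = real (len y2) + len z - len x" by (simp add: gp_def zinv)
      then show ?thesis using y2(2) xc(2) zlr by simp
    qed
    have deep: "h \<in> Q k y" if h: "h \<in> Sh z" "h \<in> \<Omega>" for h
    proof -
      have hc: "h \<in> carrier G" using h \<Omega>_c by auto
      have "min (gp y2 z) (gp z h) - \<delta> \<le> gp y2 h" by (rule hyp) fact+
      moreover have "real (k * L + J) - R - D \<le> gp z h" using h(1) zlr by (simp add: Sh_def)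
      ultimately have "real (k * L) - D - \<delta> \<le> gp y2 h" using y2z J \<delta>_nonneg by simp
      moreover have "min (gp y y2) (gp y2 h) - \<delta> \<le> gp y h" by (rule hyp) fact+
      ultimately show ?thesis using yy2 by (intro inQ h) simp
    qed
    define P where "P = {y' \<in> I y. \<exists>h\<in>Sh z \<inter> \<Omega>. cube L K (Suc k) h = y'}"
    define T where "T = {h \<in> \<Omega>. cube L K (Suc k) h \<in> P}"
    have T_sub: "T \<subseteq> \<Omega>" by (auto simp: T_def)
    have T_fin: "finite T" using finite_subset[OF T_sub \<Omega>_fin] .
    have aT: "a T = (\<Sum>y'\<in>P. a (Q (Suc k) y'))"
    proof -
      have "a T = (\<Sum>y'\<in>P. a {h \<in> T. cube L K (Suc k) h = y'})"
        using T_fin by (intro a_partition) (auto simp: T_def P_def I_def)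
      also have "\<dots> = (\<Sum>y'\<in>P. a (Q (Suc k) y'))"
      proof (rule sum.cong[OF refl])
        fix y' assume "y' \<in> P"
        then have "{h \<in> T. cube L K (Suc k) h = y'} = Q (Suc k) y'" by (auto simp: T_def Q_def)
        then show "a {h \<in> T. cube L K (Suc k) h = y'} = a (Q (Suc k) y')" by simp
      qed
      finally show ?thesis .
    qed
    have "Sh z \<inter> \<Omega> \<subseteq> T"
    proof
      fix h assume h: "h \<in> Sh z \<inter> \<Omega>"
      then have "h \<in> Q k y" using deep by auto
      then have "cube L K (Suc k) h \<in> I y"
        using k cube_net[of "Suc k" K L h] cube_step[of k K L h] by (simp add: Q_def I_def)
      then show "h \<in> T" using h by (auto simp: T_def P_def)
    qed
    then have "norm (a (Sh z \<inter> \<Omega>)) \<le> norm (a T)"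
      using T_sub \<Omega>_c T_fin by (intro norm_le_C a_C a_mono) auto
    then have aT_lower: "exp (- (\<omega> * len z)) / 4 * U \<le> norm (a T)" using lower[OF zc zKL] by linarith
    have T_Sh: "real (len z) - (D + \<delta>) \<le> gp z h" if h: "h \<in> T" for h
    proof -
      obtain h' where h': "h' \<in> Sh z" "h' \<in> \<Omega>" "cube L K (Suc k) h' = cube L K (Suc k) h"
        using h by (auto simp: T_def P_def)
      define q where "q = cube L K (Suc k) h"
      have q: "q \<in> net (Suc k * L)" unfolding q_def using k by (intro cube_net) auto
      have c: "h \<in> carrier G" "h' \<in> carrier G" "q \<in> carrier G"
        using h T_sub \<Omega>_c h' net_carrier[OF q] by auto
      have "h \<in> Q (Suc k) q" "h' \<in> Q (Suc k) q" using h h' T_sub by (auto simp: Q_def q_def)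
      moreover have "Suc k \<le> K" using k by simp
      ultimately have "real (Suc k * L) - D1 \<le> gp q h" "real (Suc k * L) - D1 \<le> gp h' q"
        unfolding gp_commute[OF c(2,3)] by (blast intro: Q_close)+
      moreover have "min (gp h' q) (gp q h) - \<delta> \<le> gp h' h" by (rule hyp) fact+
      moreover have "real (len z) \<le> real (k * L) + J + R"
        using zl(2) by (simp only: of_nat_le_iff flip: of_nat_add)
      ultimately have "real (len z) - D \<le> gp h' h" using L(2) by (simp add: D1_def algebra_simps)
      moreover have "min (gp z h') (gp h' h) - \<delta> \<le> gp z h" by (rule hyp) fact+
      moreover have "real (len z) - D \<le> gp z h'" using h'(1) by (simp add: Sh_def)
      ultimately show ?thesis by linarith
    qed
    have "2 * (D + \<delta>) \<le> len z"
    proof -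
      have "J \<le> len z + R" using zl(1) by linarith
      then have "real J \<le> real (len z) + real R" by linarith
      moreover have "real R + 2 * real D + 2 * \<delta> \<le> real J" using J by simp
      ultimately show ?thesis by simp
    qed
    then have upper: "exp (\<omega> * (2 * (D + \<delta>) - len z)) *\<^sub>R \<pi> z (u n) - a T \<in> C"
      using T_sub \<Omega>_B T_Sh zc by (intro shadow_upper) auto
    have "(norm (a T) - \<epsilon> * norm V) * norm V \<le> inner (a T) V"
      unfolding aT V_eq
    proof (rule aligned_part)
      show "finite (I y)" by (simp add: I_def)
      show "P \<subseteq> I y" by (auto simp: P_def)
      show "(\<Sum>y'\<in>I y. norm (a (Q (Suc k) y'))) \<le> (1 + \<epsilon>) * norm (\<Sum>y'\<in>I y. a (Q (Suc k) y'))"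
        using y_par unfolding V_eq[symmetric] V_def .
    qed
    \<comment> \<open>The origin of \<epsilon>: \<epsilon> times the upper bound for a cube of level
      \<open>k\<close> is 1/8 of the lower bound for a shadow at depth
      \<open>k * L + J + R\<close>.\<close>
    moreover have "\<epsilon> * norm V \<le> norm (a T) / 8"
    proof -
      have "\<epsilon> * norm V \<le> \<epsilon> * (exp (2 * \<omega> * D1) * exp (- (\<omega> * (k * L))) * U)"
        using Q_upper[of k y] k y \<epsilon>_pos by (intro mult_left_mono) (auto simp: V_def)
      also have "\<dots> = exp (- (\<omega> * (k * L + J + R))) / 32 * U"
        unfolding \<epsilon> D1_def by (simp add: algebra_simps flip: exp_add)
      also have "\<dots> \<le> exp (- (\<omega> * len z)) / 32 * U"
      proof -
        have "real (len z) \<le> real (k * L + J + R)" using zl(2) by (simp only: of_nat_le_iff)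
        then show ?thesis using \<omega>_pos U_pos by (intro mult_right_mono divide_right_mono) auto
      qed
      also have "\<dots> = exp (- (\<omega> * len z)) / 4 * U / 8" by simp
      also have "\<dots> \<le> norm (a T) / 8" by (rule divide_right_mono[OF aT_lower]) simp
      finally show ?thesis .
    qed
    then have "7 / 8 * norm (a T) * norm V \<le> (norm (a T) - \<epsilon> * norm V) * norm V"
      using V_pos by (intro mult_right_mono) auto
    ultimately have "7 / 8 * norm (a T) * norm V \<le> inner (a T) V" by linarith
    moreover have "a T \<in> C" using T_sub \<Omega>_c by (intro a_C) auto
    ultimately show ?thesis using aT_lower upper by blast
  qed
  obtain A1 where A1: "A1 \<in> C" "7 / 8 * norm A1 * norm V \<le> inner A1 V" "exp (- (\<omega> * len y2)) / 4 * U \<le> norm A1"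
    "exp (\<omega> * (2 * (D + \<delta>) - len y2)) *\<^sub>R \<pi> y2 (u n) - A1 \<in> C"
    using part[of \<one> y2] y2 by auto
  define z where "z = y2 \<otimes> x"
  obtain A2 where A2: "A2 \<in> C" "7 / 8 * norm A2 * norm V \<le> inner A2 V" "exp (- (\<omega> * len z)) / 4 * U \<le> norm A2"
    "exp (\<omega> * (2 * (D + \<delta>) - len z)) *\<^sub>R \<pi> z (u n) - A2 \<in> C"
    using part[OF x, of z] z_def by blast
  have xc: "x \<in> carrier G" using x by (simp add: in_B)
  have zc: "z \<in> carrier G" using xc y2 by (simp add: z_def)
  define s t where "s = \<omega> * (2 * (D + \<delta>) - len y2)" "t = \<omega> * (2 * (D + \<delta>) - len z)"
  note st = s_t_def
  have "V \<noteq> 0" using V_pos by auto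
  \<comment> \<open>Two factors 1/4 from \<open>lower\<close> and 1/2 from
    \<open>aligned_pair\<close> make 1/32. The terms with \<open>len y2\<close> and
    \<open>len z\<close> cancel, so neither the depth nor \<open>R\<close> enters the
    constant.\<close>
  have "exp (- (\<omega> * len y2)) / 4 * U * (exp (- (\<omega> * len z)) / 4 * U) / 2 \<le> norm A1 * norm A2 / 2"
    using A1(3) A2(3) U_pos by (intro divide_right_mono mult_mono) auto
  also have "\<dots> \<le> inner A1 A2" by (rule aligned_pair[OF \<open>V \<noteq> 0\<close> A1(2) A2(2)])
  also have "\<dots> \<le> inner (exp s *\<^sub>R \<pi> y2 (u n)) A2" using A1(4) A2(1) unfolding st by (rule inner_le)
  also have "\<dots> = inner A2 (exp s *\<^sub>R \<pi> y2 (u n))" by (rule inner_commute)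
  also have "\<dots> \<le> inner (exp t *\<^sub>R \<pi> z (u n)) (exp s *\<^sub>R \<pi> y2 (u n))"
    using A2(4) unfolding st by (rule inner_le) (use y2 u_C in \<open>auto intro!: C_scale C_\<pi>\<close>)
  also have "\<dots> = exp (s + t) * inner (\<pi> z (u n)) (\<pi> y2 (u n))" by (simp add: exp_add)
  also have "inner (\<pi> z (u n)) (\<pi> y2 (u n)) = inner (u n) (\<pi> x (u n))"
    using y2 xc u_C[of n] by (simp add: z_def \<pi>_mult \<pi>_inner C_\<pi> inner_commute)
  finally have main: "exp (- (\<omega> * len y2)) / 4 * U * (exp (- (\<omega> * len z)) / 4 * U) / 2
    \<le> exp (s + t) * inner (u n) (\<pi> x (u n))" .
  have e: "exp (- (\<omega> * len y2)) / 4 * U * (exp (- (\<omega> * len z)) / 4 * U) / 2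
    = exp (s + t) * (exp (- (4 * \<omega> * (D + \<delta>))) / 32 * U\<^sup>2)"
  proof -
    have st4: "exp (s + t) * exp (- (4 * \<omega> * (D + \<delta>))) = exp (- (\<omega> * len y2)) * exp (- (\<omega> * len z))"
      unfolding st by (simp add: algebra_simps flip: exp_add)
    have "exp (s + t) * (exp (- (4 * \<omega> * (D + \<delta>))) / 32 * U\<^sup>2) = (exp (s + t) * exp (- (4 * \<omega> * (D + \<delta>)))) * U\<^sup>2 / 32"
      by simp
    also have "\<dots> = exp (- (\<omega> * len y2)) / 4 * U * (exp (- (\<omega> * len z)) / 4 * U) / 2"
      unfolding st4 by (simp add: power2_eq_square)
    finally show ?thesis by (rule sym)
  qed
  show ?thesis using main unfolding e U_def[symmetric] by simp
qed

end

context growing_hyperbolic begin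

text \<open>The order of quantifiers is the point: \<open>c\<close> comes before \<open>R\<close>,
  and \<open>M\<close> depends on \<open>R\<close> but on no representation, vector or
  cutoff.\<close>

lemma ex_almost_invariant:
  "\<exists>c>0. \<forall>R. \<exists>M. \<forall>(\<pi> :: 'a \<Rightarrow> 'v::real_inner \<Rightarrow> 'v) C f n. positive_rep G \<pi> C \<longrightarrow> f \<in> C \<longrightarrow> norm f \<le> 1 \<longrightarrow>
     M \<le> norm (\<Sum>h\<in>B n. p h *\<^sub>R \<pi> h f) \<longrightarrow>
     (\<forall>x\<in>B R. c * (norm (\<Sum>h\<in>B n. p h *\<^sub>R \<pi> h f))\<^sup>2
        \<le> inner (\<Sum>h\<in>B n. p h *\<^sub>R \<pi> h f) (\<pi> x (\<Sum>h\<in>B n. p h *\<^sub>R \<pi> h f)))"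
proof -
  obtain C1 where C1: "\<And>k. real (card (Sph k)) \<le> C1 * exp (\<omega> * k)" using card_Sph_le by auto
  show ?thesis
  proof (rule exI[of _ "exp (- (4 * \<omega> * (D + \<delta>))) / 32"], rule conjI, goal_cases)
    case 1
    show "exp (- (4 * \<omega> * (D + \<delta>))) / 32 > 0" by simp
  next
    case 2
    show ?case
    proof
    fix R :: nat
    define J where "J = R + nat \<lceil>2 * D + 2 * \<delta>\<rceil>"
    define L where "L = nat \<lceil>2 * (D + 6 * \<delta>) + (J + R + D + 7 * \<delta>)\<rceil>"
    define \<epsilon> where "\<epsilon> = exp (- (\<omega> * (J + R)) - 2 * \<omega> * (D + 6 * \<delta>)) / 32"
    have J: "R + (2 * D + 2 * \<delta>) \<le> J" unfolding J_def by linarith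
    have L: "2 * (D + 6 * \<delta>) \<le> L" "J + R + D + 7 * \<delta> \<le> L"
      using real_nat_ceiling_ge[of "2 * (D + 6 * \<delta>) + (J + R + D + 7 * \<delta>)"] \<delta>_nonneg of_nat_0_le_iff[of D, where ?'a = real]
      unfolding L_def[symmetric] by simp_all
    have "1 < 1 + \<epsilon>" by (simp add: \<epsilon>_def)
    from linear_less_power[OF this, of 0 "4 * C1 * exp (2 * \<omega> * (D + 6 * \<delta>))"]
    obtain n0 where n0: "\<And>n. n \<ge> n0 \<Longrightarrow> 4 * C1 * exp (2 * \<omega> * (D + 6 * \<delta>)) < (1 + \<epsilon>) ^ n" by auto
    define K where "K = Suc n0"
    have K: "0 < K" "4 * C1 * exp (2 * \<omega> * (D + 6 * \<delta>)) < (1 + \<epsilon>) ^ K" using n0[of K] by (auto simp: K_def)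
    show "\<exists>M. \<forall>(\<pi> :: 'a \<Rightarrow> 'v \<Rightarrow> 'v) C f n. positive_rep G \<pi> C \<longrightarrow> f \<in> C \<longrightarrow> norm f \<le> 1 \<longrightarrow>
     M \<le> norm (\<Sum>h\<in>B n. p h *\<^sub>R \<pi> h f) \<longrightarrow>
     (\<forall>x\<in>B R. exp (- (4 * \<omega> * (D + \<delta>))) / 32 * (norm (\<Sum>h\<in>B n. p h *\<^sub>R \<pi> h f))\<^sup>2
        \<le> inner (\<Sum>h\<in>B n. p h *\<^sub>R \<pi> h f) (\<pi> x (\<Sum>h\<in>B n. p h *\<^sub>R \<pi> h f)))"
    proof (intro exI[of _ "4 * (K * L + 1) * C1 * exp (\<omega> * (K * L))"] allI impI ballI)
      fix \<pi> :: "'a \<Rightarrow> 'v \<Rightarrow> 'v" and C f n x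
      assume *: "positive_rep G \<pi> C" "f \<in> C" "norm f \<le> 1"
        "4 * (K * L + 1) * C1 * exp (\<omega> * (K * L)) \<le> norm (\<Sum>h\<in>B n. p h *\<^sub>R \<pi> h f)" "x \<in> B R"
      interpret positive_rep G \<pi> C by fact
      interpret rep_metric G S \<delta> D \<pi> C f by unfold_locales fact
      show "exp (- (4 * \<omega> * (D + \<delta>))) / 32 * (norm (\<Sum>h\<in>B n. p h *\<^sub>R \<pi> h f))\<^sup>2
        \<le> inner (\<Sum>h\<in>B n. p h *\<^sub>R \<pi> h f) (\<pi> x (\<Sum>h\<in>B n. p h *\<^sub>R \<pi> h f))"
        using almost_invariant[OF C1 *(3) J L \<epsilon>_def K _ *(5), of n] *(4) unfolding u_def a_def by simp
    qed
    qed
  qed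
qed

end

section \<open>Spectral gap from a growth gap\<close>

context growing_hyperbolic begin

text \<open>Such \<open>s\<close> pass near the point \<open>x\<close> at depth \<open>k\<close> on
  a geodesic to \<open>g\<close>. Translation by \<open>inv x\<close> moves them into spheres of
  radius between \<open>j - k\<close> and \<open>j - k + m\<close>.\<close>

lemma card_deep_Sph_le:
  "\<exists>C3>0. \<forall>g\<in>carrier G. \<forall>j k. k \<le> j \<longrightarrow> real (card {s \<in> Sph j. real k \<le> gp s g}) \<le> C3 * exp (\<omega> * (real j - k))"
proof -
  obtain C1 where C1: "C1 \<ge> 1" "\<And>k. real (card (Sph k)) \<le> C1 * exp (\<omega> * k)" using card_Sph_le by auto
  define m where "m = nat \<lceil>2 * \<delta>\<rceil>"
  define C3 where "C3 = (real m + 1) * (C1 * exp (\<omega> * m))"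
  have "real (card {s \<in> Sph j. real k \<le> gp s g}) \<le> C3 * exp (\<omega> * (real j - k))"
    if g: "g \<in> carrier G" and k: "k \<le> j" for g j k
  proof (cases "k \<le> len g")
    case False
    have "{s \<in> Sph j. real k \<le> gp s g} = {}"
      using gp_le_right[OF _ g] False by (fastforce simp: in_Sph)
    then have "real (card {s \<in> Sph j. real k \<le> gp s g}) = 0" by (metis card.empty of_nat_0)
    moreover have "0 \<le> C3 * exp (\<omega> * (real j - k))" using C1(1) by (simp add: C3_def)
    ultimately show ?thesis by linarith
  next
    case True
    obtain x where x: "x \<in> carrier G" "len x = k" "len (inv x \<otimes> g) = len g - k"
      using geodesic_point[OF g True] .
    have gx: "gp x g = k" by (rule gp_geodesic[OF g x(3,2) True])
    have sub: "{s \<in> Sph j. real k \<le> gp s g} \<subseteq> (\<otimes>) x ` (\<Union>i\<le>m. Sph (j - k + i))"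
    proof
      fix s assume "s \<in> {s \<in> Sph j. real k \<le> gp s g}"
      then have s: "s \<in> carrier G" "len s = j" "real k \<le> gp s g" by (auto simp: in_Sph)
      have "min (gp x g) (gp g s) - \<delta> \<le> gp x s" by (rule hyp) fact+
      then have "real k - \<delta> \<le> gp x s" using gx s gp_commute[OF s(1) g] by simp
      then have "real (len (inv x \<otimes> s)) \<le> real j - k + 2 * \<delta>" using len_inv_mult_gp[of x s] s x by simp
      then have up: "real (len (inv x \<otimes> s)) \<le> real (j - k) + 2 * \<delta>" using k by simp
      have "len (inv x \<otimes> s) \<le> j - k + m" unfolding m_def using up by linarith
      moreover have "j - k \<le> len (inv x \<otimes> s)" using len_diff[OF x(1) s(1)] s x by simp
      ultimately obtain i where "i \<le> m" "len (inv x \<otimes> s) = j - k + i" by (metis add_le_cancel_left le_iff_add)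
      then have "inv x \<otimes> s \<in> (\<Union>i\<le>m. Sph (j - k + i))" using s x by (auto simp: in_Sph)
      moreover have "s = x \<otimes> (inv x \<otimes> s)" using s x by (simp add: m_assoc[symmetric])
      ultimately show "s \<in> (\<otimes>) x ` (\<Union>i\<le>m. Sph (j - k + i))" by blast
    qed
    have "card {s \<in> Sph j. real k \<le> gp s g} \<le> card ((\<otimes>) x ` (\<Union>i\<le>m. Sph (j - k + i)))"
      by (rule card_mono[OF _ sub]) auto
    also have "\<dots> \<le> card (\<Union>i\<le>m. Sph (j - k + i))" by (rule card_image_le) auto
    also have "\<dots> \<le> (\<Sum>i\<le>m. card (Sph (j - k + i)))" by (rule card_UN_le) auto
    finally have "real (card {s \<in> Sph j. real k \<le> gp s g}) \<le> (\<Sum>i\<le>m. real (card (Sph (j - k + i))))"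
      by (simp only: of_nat_le_iff flip: of_nat_sum)
    also have "\<dots> \<le> (\<Sum>i\<le>m. C1 * exp (\<omega> * m) * exp (\<omega> * (real j - k)))"
    proof (rule sum_mono)
      fix i assume i: "i \<in> {..m}"
      have "real (card (Sph (j - k + i))) \<le> C1 * exp (\<omega> * real (j - k + i))" by (rule C1(2))
      also have "\<dots> \<le> C1 * exp (\<omega> * (m + (real j - k)))"
        using C1(1) i k \<omega>_pos by (intro mult_left_mono) (auto simp: of_nat_diff)
      finally show "real (card (Sph (j - k + i))) \<le> C1 * exp (\<omega> * m) * exp (\<omega> * (real j - k))"
        by (simp add: exp_add distrib_left)
    qed
    also have "\<dots> = C3 * exp (\<omega> * (real j - k))" by (simp add: C3_def algebra_simps)
    finally show ?thesis .
  qed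
  moreover have "C3 > 0" using C1(1) by (simp add: C3_def add_nonneg_pos)
  ultimately show ?thesis by (intro exI[of _ C3]) auto
qed

text \<open>The estimate behind the rapid decay property: the weight \<open>e\<^sup>-\<^sup>\<omega>\<^sup>|\<^sup>g\<^sup>|\<^sup>/\<^sup>2\<close> is an approximate eigenfunction of
  convolution with balls, with eigenvalue the square root of the volume up to a polynomial factor.\<close>

lemma ball_sum_le:
  "\<exists>A>0. \<forall>N. \<forall>g\<in>carrier G. (\<Sum>s\<in>B N. exp (- (\<omega> / 2 * len (inv s \<otimes> g))))
     \<le> A * (real N + 1)\<^sup>2 * exp (\<omega> / 2 * N) * exp (- (\<omega> / 2 * len g))"
proof -
  obtain C3 where C3: "C3 > 0" "\<And>g j k. g \<in> carrier G \<Longrightarrow> k \<le> j \<Longrightarrow>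
     real (card {s \<in> Sph j. real k \<le> gp s g}) \<le> C3 * exp (\<omega> * (real j - k))" using card_deep_Sph_le by blast
  define A where "A = C3 * exp \<omega>"
  have sph: "(\<Sum>s\<in>Sph j. exp (- (\<omega> / 2 * len (inv s \<otimes> g)))) \<le> (real j + 1) * A * exp (\<omega> / 2 * j) * exp (- (\<omega> / 2 * len g))"
    if g: "g \<in> carrier G" for g j
  proof -
    \<comment> \<open>The sphere is sorted by the integer part of \<open>gp s g\<close>: level
      \<open>i\<close> has at most about \<open>exp (\<omega> * (real j - i))\<close> points of
      weight about \<open>exp (\<omega> * i)\<close>, so all \<open>j + 1\<close> levels obey the
      same bound.\<close>
    define k where "k s = nat \<lfloor>gp s g\<rfloor>" for s
    have k: "real (k s) \<le> gp s g" "gp s g < real (k s) + 1" "k s \<le> j" if "s \<in> Sph j" for s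
    proof -
      have s: "s \<in> carrier G" "len s = j" using that by (auto simp: in_Sph)
      show "real (k s) \<le> gp s g" "gp s g < real (k s) + 1" using gp_nonneg[OF s(1) g] unfolding k_def by linarith+
      then show "k s \<le> j" using gp_le_left[OF s(1) g] s(2) by simp
    qed
    have "(\<Sum>s\<in>Sph j. exp (\<omega> * gp s g)) = (\<Sum>i\<le>j. \<Sum>s\<in>{s \<in> Sph j. k s = i}. exp (\<omega> * gp s g))"
      by (rule sum.group[symmetric]) (use k in auto)
    also have "\<dots> \<le> (\<Sum>i\<le>j. A * exp (\<omega> * j))"
    proof (rule sum_mono)
      fix i assume i: "i \<in> {..j}"
      have "(\<Sum>s\<in>{s \<in> Sph j. k s = i}. exp (\<omega> * gp s g)) \<le> (\<Sum>s\<in>{s \<in> Sph j. k s = i}. exp (\<omega> * (real i + 1)))"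
        using k(2) \<omega>_pos by (intro sum_mono) (auto intro!: less_imp_le)
      also have "\<dots> = real (card {s \<in> Sph j. k s = i}) * exp (\<omega> * (real i + 1))" by simp
      also have "\<dots> \<le> real (card {s \<in> Sph j. real i \<le> gp s g}) * exp (\<omega> * (real i + 1))"
        using k(1) by (intro mult_right_mono) (auto intro!: card_mono)
      also have "\<dots> \<le> C3 * exp (\<omega> * (real j - i)) * exp (\<omega> * (real i + 1))"
        using C3(2)[OF g, of i j] i by (intro mult_right_mono) auto
      also have "\<dots> = A * exp (\<omega> * j)" by (simp add: A_def algebra_simps flip: exp_add)
      finally show "(\<Sum>s\<in>{s \<in> Sph j. k s = i}. exp (\<omega> * gp s g)) \<le> A * exp (\<omega> * j)" .
    qed
    also have "\<dots> = (real j + 1) * A * exp (\<omega> * j)" by (simp add: algebra_simps)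
    finally have le: "(\<Sum>s\<in>Sph j. exp (\<omega> * gp s g)) \<le> (real j + 1) * A * exp (\<omega> * j)" .
    have "(\<Sum>s\<in>Sph j. exp (- (\<omega> / 2 * len (inv s \<otimes> g)))) = (\<Sum>s\<in>Sph j. exp (- (\<omega> / 2 * (real j + len g))) * exp (\<omega> * gp s g))"
    proof (rule sum.cong[OF refl])
      fix s assume "s \<in> Sph j"
      then have e: "real (len (inv s \<otimes> g)) = real j + len g - 2 * gp s g" using len_inv_mult_gp[of s g] by (simp add: in_Sph)
      have "- (\<omega> / 2 * len (inv s \<otimes> g)) = - (\<omega> / 2 * (real j + len g)) + \<omega> * gp s g"
        unfolding e by (simp add: field_simps)
      then show "exp (- (\<omega> / 2 * len (inv s \<otimes> g))) = exp (- (\<omega> / 2 * (real j + len g))) * exp (\<omega> * gp s g)"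
        by (simp only: exp_add)
    qed
    also have "\<dots> = exp (- (\<omega> / 2 * (real j + len g))) * (\<Sum>s\<in>Sph j. exp (\<omega> * gp s g))" by (simp add: sum_distrib_left)
    also have "\<dots> \<le> exp (- (\<omega> / 2 * (real j + len g))) * ((real j + 1) * A * exp (\<omega> * j))"
      by (rule mult_left_mono[OF le]) simp
    also have "\<dots> = (real j + 1) * A * (exp (- (\<omega> / 2 * (real j + len g))) * exp (\<omega> * j))" by simp
    also have "exp (- (\<omega> / 2 * (real j + len g))) * exp (\<omega> * j) = exp (\<omega> / 2 * j) * exp (- (\<omega> / 2 * len g))"
      by (simp add: field_simps flip: exp_add)
    finally show ?thesis by (simp add: algebra_simps)
  qed
  have A: "A > 0" using C3(1) by (simp add: A_def)
  have "(\<Sum>s\<in>B N. exp (- (\<omega> / 2 * len (inv s \<otimes> g)))) \<le> A * (real N + 1)\<^sup>2 * exp (\<omega> / 2 * N) * exp (- (\<omega> / 2 * len g))"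
    if g: "g \<in> carrier G" for g N
  proof -
    have "(\<Sum>s\<in>B N. exp (- (\<omega> / 2 * len (inv s \<otimes> g)))) \<le> (\<Sum>j\<le>N. (real N + 1) * A * exp (\<omega> / 2 * N) * exp (- (\<omega> / 2 * len g)))"
      unfolding sum_B_Sph
    proof (rule sum_mono)
      fix j assume "j \<in> {..N}"
      then have "(real j + 1) * A * exp (\<omega> / 2 * j) * exp (- (\<omega> / 2 * len g))
         \<le> (real N + 1) * A * exp (\<omega> / 2 * N) * exp (- (\<omega> / 2 * len g))"
        using A \<omega>_pos by (intro mult_mono) auto
      then show "(\<Sum>s\<in>Sph j. exp (- (\<omega> / 2 * len (inv s \<otimes> g)))) \<le> (real N + 1) * A * exp (\<omega> / 2 * N) * exp (- (\<omega> / 2 * len g))"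
        using sph[OF g, of j] by linarith
    qed
    also have "\<dots> = A * (real N + 1)\<^sup>2 * exp (\<omega> / 2 * N) * exp (- (\<omega> / 2 * len g))"
      by (simp add: power2_eq_square algebra_simps)
    finally show ?thesis .
  qed
  then show ?thesis using A by (intro exI[of _ A]) auto
qed

end

section \<open>Convolution powers of balls in a representation\<close>

locale metric_rep = word_metric G S + positive_rep G \<pi> C
  for G :: "('a, 'b) monoid_scheme" (structure) and S and \<pi> :: "'a \<Rightarrow> 'v::real_inner \<Rightarrow> 'v" and C
begin

definition P where "P N v = (\<Sum>s\<in>B N. \<pi> s v)"

text \<open>\<open>W N k g\<close> is the number of ways to write \<open>g\<close> as a product of \<open>k\<close> elements of the ball of radius \<open>N\<close>.\<close>

primrec W :: "nat \<Rightarrow> nat \<Rightarrow> 'a \<Rightarrow> real" where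
  "W N 0 g = (if g = \<one> then 1 else 0)"
| "W N (Suc k) g = (\<Sum>s\<in>B N. W N k (inv s \<otimes> g))"

lemma W_eq_0: "g \<in> carrier G \<Longrightarrow> k * N < len g \<Longrightarrow> W N k g = 0"
proof (induction k arbitrary: g)
  case (Suc k)
  have "W N k (inv s \<otimes> g) = 0" if s: "s \<in> B N" for s
  proof (rule Suc.IH)
    have "s \<in> carrier G" "len s \<le> N" using s by (auto simp: in_B)
    then show "inv s \<otimes> g \<in> carrier G" "k * N < len (inv s \<otimes> g)"
      using Suc.prems len_diff[of s g] by auto
  qed
  then show ?case by simp
qed auto

lemma P_C: "v \<in> C \<Longrightarrow> P N v \<in> C"
  unfolding P_def by (intro C_sum C_\<pi>) (auto simp: in_B)

lemma P_pow_C: "v \<in> C \<Longrightarrow> (P N ^^ k) v \<in> C"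
  by (induction k) (auto intro: P_C)

lemma P_pow:
  assumes v: "v \<in> C"
  shows "(P N ^^ k) v = (\<Sum>g\<in>B (k * N). W N k g *\<^sub>R \<pi> g v)"
proof (induction k)
  case 0
  have "B 0 = {\<one>}" using len_eq_0 by (auto simp: in_B)
  then show ?case using v by (simp add: \<pi>_one)
next
  case (Suc k)
  have "(P N ^^ Suc k) v = (\<Sum>s\<in>B N. \<pi> s (\<Sum>g\<in>B (k * N). W N k g *\<^sub>R \<pi> g v))"
    by (simp add: Suc P_def)
  also have "\<dots> = (\<Sum>s\<in>B N. \<Sum>g\<in>B (Suc k * N). W N k (inv s \<otimes> g) *\<^sub>R \<pi> g v)"
  proof (rule sum.cong[OF refl])
    fix s assume "s \<in> B N"
    then have s: "s \<in> carrier G" "len s \<le> N" by (auto simp: in_B)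
    have "\<pi> s (\<Sum>g\<in>B (k * N). W N k g *\<^sub>R \<pi> g v) = (\<Sum>g\<in>B (k * N). W N k g *\<^sub>R \<pi> (s \<otimes> g) v)"
      using s v by (auto simp: \<pi>_sum \<pi>_scale \<pi>_mult in_B intro!: sum.cong)
    also have "\<dots> = (\<Sum>g\<in>{g \<in> B (Suc k * N). inv s \<otimes> g \<in> B (k * N)}. W N k (inv s \<otimes> g) *\<^sub>R \<pi> g v)"
    proof (rule sum.reindex_bij_witness[where i = "\<lambda>g. inv s \<otimes> g" and j = "\<lambda>g. s \<otimes> g"])
      fix g assume g: "g \<in> B (k * N)"
      then have gc: "g \<in> carrier G" by (simp add: in_B)
      show e: "inv s \<otimes> (s \<otimes> g) = g" using gc s by (simp add: m_assoc[symmetric])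
      then show "W N k (inv s \<otimes> (s \<otimes> g)) *\<^sub>R \<pi> (s \<otimes> g) v = W N k g *\<^sub>R \<pi> (s \<otimes> g) v" by simp
      have "len (s \<otimes> g) \<le> Suc k * N" using len_mult[OF s(1) gc] s g by (simp add: in_B)
      then show "s \<otimes> g \<in> {g \<in> B (Suc k * N). inv s \<otimes> g \<in> B (k * N)}"
        using gc s g e by (simp add: in_B)
    next
      fix g assume "g \<in> {g \<in> B (Suc k * N). inv s \<otimes> g \<in> B (k * N)}"
      then show "s \<otimes> (inv s \<otimes> g) = g" "inv s \<otimes> g \<in> B (k * N)" using s by (auto simp: in_B m_assoc[symmetric])
    qed
    also have "\<dots> = (\<Sum>g\<in>B (Suc k * N). W N k (inv s \<otimes> g) *\<^sub>R \<pi> g v)"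
    proof (rule sum.mono_neutral_left)
      show "\<forall>g\<in>B (Suc k * N) - {g \<in> B (Suc k * N). inv s \<otimes> g \<in> B (k * N)}. W N k (inv s \<otimes> g) *\<^sub>R \<pi> g v = 0"
        using s by (auto simp: in_B not_le intro!: W_eq_0)
    qed auto
    finally show "\<pi> s (\<Sum>g\<in>B (k * N). W N k g *\<^sub>R \<pi> g v) = (\<Sum>g\<in>B (Suc k * N). W N k (inv s \<otimes> g) *\<^sub>R \<pi> g v)" .
  qed
  also have "\<dots> = (\<Sum>g\<in>B (Suc k * N). \<Sum>s\<in>B N. W N k (inv s \<otimes> g) *\<^sub>R \<pi> g v)" by (rule sum.swap)
  also have "\<dots> = (\<Sum>g\<in>B (Suc k * N). W N (Suc k) g *\<^sub>R \<pi> g v)" by (simp add: scaleR_sum_left)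
  finally show ?case .
qed

lemma P_adjoint:
  assumes v: "v \<in> C" and w: "w \<in> C" shows "inner (P N v) w = inner v (P N w)"
proof -
  have "inner (P N v) w = (\<Sum>s\<in>B N. inner (\<pi> s v) w)" by (simp add: P_def inner_sum_left)
  also have "\<dots> = (\<Sum>s\<in>B N. inner v (\<pi> (inv s) w))"
  proof (rule sum.cong[OF refl])
    fix s assume "s \<in> B N"
    then have s: "s \<in> carrier G" by (simp add: in_B)
    have "\<pi> s (\<pi> (inv s) w) = w" using s w by (simp add: \<pi>_mult[symmetric] \<pi>_one)
    then show "inner (\<pi> s v) w = inner v (\<pi> (inv s) w)"
      using \<pi>_inner[OF s v, of "\<pi> (inv s) w"] s w by (simp add: C_\<pi>)
  qed
  also have "\<dots> = (\<Sum>s\<in>B N. inner v (\<pi> s w))"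
    by (rule sum.reindex_bij_witness[where i = "\<lambda>s. inv s" and j = "\<lambda>s. inv s"]) (auto simp: in_B)
  also have "\<dots> = inner v (P N w)" by (simp add: P_def inner_sum_right)
  finally show ?thesis .
qed

lemma P_pow_adjoint:
  "v \<in> C \<Longrightarrow> w \<in> C \<Longrightarrow> inner ((P N ^^ k) v) w = inner v ((P N ^^ k) w)"
proof (induction k arbitrary: w)
  case (Suc k)
  then have "inner ((P N ^^ Suc k) v) w = inner ((P N ^^ k) v) (P N w)"
    by (simp add: P_adjoint P_pow_C)
  also have "\<dots> = inner v ((P N ^^ k) (P N w))" using Suc by (simp add: P_C)
  finally show ?case by (simp add: funpow_swap1)
qed simp

text \<open>For the symmetric operator \<open>P\<close> the sequence \<open>\<langle>P\<^sup>k v, v\<rangle>\<close> is log-convex along powers of two,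
  so its first term is controlled by its growth rate.\<close>

lemma P_le_growth:
  assumes v: "v \<in> C" and r: "r > 0" and le: "\<And>k. inner ((P N ^^ k) v) v \<le> K * (real k + 1) * r ^ k"
  shows "inner (P N v) v \<le> r * (norm v)\<^sup>2"
proof (rule ccontr)
  assume contr: "\<not> ?thesis"
  define m where "m k = inner ((P N ^^ k) v) v" for k
  have m0: "m 0 = (norm v)\<^sup>2" by (simp add: m_def power2_norm_eq_inner)
  have m1: "m 1 = inner (P N v) v" by (simp add: m_def)
  have "v \<noteq> 0" using contr by auto
  then have m0_pos: "m 0 > 0" by (simp add: m0)
  have lt: "r * m 0 < m 1" using contr unfolding m0 m1 by simp
  define q where "q = m 1 / m 0"
  have "q > r" using lt m0_pos by (simp add: q_def pos_less_divide_eq)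
  then have q: "q > r" "q > 0" using r by simp_all
  \<comment> \<open>Cauchy-Schwarz for \<open>(P N ^^ k) v\<close> and \<open>v\<close>; symmetry
    moves half of the power \<open>2 * k\<close> to the other side.\<close>
  have dbl: "(m k)\<^sup>2 \<le> m 0 * m (2 * k)" for k
  proof -
    have "m (2 * k) = inner ((P N ^^ k) v) ((P N ^^ k) v)"
      using P_pow_adjoint[of "(P N ^^ k) v" v k N, OF P_pow_C[OF v] v] by (simp add: m_def mult_2 funpow_add inner_commute)
    moreover have "m k ^ 2 \<le> inner ((P N ^^ k) v) ((P N ^^ k) v) * inner v v"
      unfolding m_def by (rule Cauchy_Schwarz_ineq)
    ultimately show ?thesis by (simp add: m_def mult.commute)
  qed
  have low: "m 0 * q ^ (2 ^ i) \<le> m (2 ^ i)" for i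
  proof (induction i)
    case 0
    then show ?case using m0_pos by (simp add: q_def)
  next
    case (Suc i)
    have "(m 0 * q ^ (2 ^ i))\<^sup>2 \<le> (m (2 ^ i))\<^sup>2" using Suc m0_pos q by (intro power_mono) auto
    also have "\<dots> \<le> m 0 * m (2 ^ Suc i)" using dbl[of "2 ^ i"] by simp
    finally have "m 0 * (m 0 * q ^ (2 ^ Suc i)) \<le> m 0 * m (2 ^ Suc i)"
      by (simp add: power2_eq_square power_mult_distrib mult_2 power_add algebra_simps)
    then show ?case using m0_pos by simp
  qed
  have "q / r > 1" using q r by simp
  from linear_less_power[OF this, of "K / m 0" "K / m 0"]
  obtain n0 where n0: "\<And>n. n \<ge> n0 \<Longrightarrow> K / m 0 * real n + K / m 0 < (q / r) ^ n" by auto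
  define k :: nat where "k = 2 ^ n0"
  have "n0 \<le> k" unfolding k_def by (simp add: less_imp_le)
  from n0[OF this] have "K / m 0 * (real k + 1) < (q / r) ^ k" by (simp only: distrib_left mult_1_right)
  then have "K / m 0 * (real k + 1) * r ^ k < (q / r) ^ k * r ^ k" using r by (intro mult_strict_right_mono) auto
  also have "\<dots> = q ^ k" using r by (simp add: power_divide)
  finally have "m 0 * (K / m 0 * (real k + 1) * r ^ k) < m 0 * q ^ k" using m0_pos by (intro mult_strict_left_mono)
  then have "K * (real k + 1) * r ^ k < m 0 * q ^ k" using m0_pos by simp
  then show False using low[of n0] le[of k] by (simp add: k_def m_def)
qed

end

context word_metric begin

text \<open>The sphere of radius \<open>j\<close> contributes at most
  \<open>K * exp ((\<omega> / 2 - \<gamma>) * j)\<close>; since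
  \<open>\<gamma> \<le> \<omega> / 2\<close>, this is largest at \<open>j = m\<close>.\<close>

lemma weighted_subgroup_sum_le:
  assumes H: "\<And>n. real (card (H \<inter> B n)) \<le> K * exp ((\<omega> - \<gamma>) * n)" and "K \<ge> 0" and \<gamma>: "\<gamma> \<le> \<omega> / 2"
  shows "(\<Sum>h\<in>H \<inter> B m. exp (- (\<omega> / 2 * len h))) \<le> K * (real m + 1) * exp ((\<omega> / 2 - \<gamma>) * m)"
proof -
  have "H \<inter> B m = (\<Union>j\<le>m. H \<inter> Sph j)" by (auto simp: B_UN_Sph)
  then have "(\<Sum>h\<in>H \<inter> B m. exp (- (\<omega> / 2 * len h))) = (\<Sum>j\<le>m. \<Sum>h\<in>H \<inter> Sph j. exp (- (\<omega> / 2 * len h)))"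
    by (simp only:) (rule sum.UNION_disjoint, auto simp: in_Sph)
  also have "\<dots> \<le> (\<Sum>j\<le>m. K * exp ((\<omega> / 2 - \<gamma>) * m))"
  proof (rule sum_mono)
    fix j assume j: "j \<in> {..m}"
    have "(\<Sum>h\<in>H \<inter> Sph j. exp (- (\<omega> / 2 * len h))) = (\<Sum>h\<in>H \<inter> Sph j. exp (- (\<omega> / 2 * real j)))"
      by (rule sum.cong) (auto simp: in_Sph)
    also have "\<dots> = real (card (H \<inter> Sph j)) * exp (- (\<omega> / 2 * real j))" by simp
    also have "\<dots> \<le> real (card (H \<inter> B j)) * exp (- (\<omega> / 2 * real j))"
      using Sph_subset_B by (intro mult_right_mono) (auto intro!: card_mono)
    also have "\<dots> \<le> K * exp ((\<omega> - \<gamma>) * j) * exp (- (\<omega> / 2 * real j))" using H by (intro mult_right_mono) auto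
    also have "\<dots> = K * exp ((\<omega> / 2 - \<gamma>) * j)" by (simp add: field_simps flip: exp_add)
    also have "\<dots> \<le> K * exp ((\<omega> / 2 - \<gamma>) * m)"
      using \<gamma> j \<open>K \<ge> 0\<close> by (intro mult_left_mono) (auto intro!: mult_left_mono)
    finally show "(\<Sum>h\<in>H \<inter> Sph j. exp (- (\<omega> / 2 * len h))) \<le> K * exp ((\<omega> / 2 - \<gamma>) * m)" .
  qed
  also have "\<dots> = K * (real m + 1) * exp ((\<omega> / 2 - \<gamma>) * m)" by (simp add: algebra_simps)
  finally show ?thesis .
qed

end

text \<open>Pointwise Schur test: the weight dominates the point mass at \<open>\<one>\<close>, and
  one convolution with the ball multiplies it by at most \<open>A\<close>.\<close>

lemma (in metric_rep) W_le:
  assumes A: "A \<ge> 0" "\<And>g. g \<in> carrier G \<Longrightarrow> (\<Sum>s\<in>B N. exp (- (\<omega> / 2 * len (inv s \<otimes> g)))) \<le> A * exp (- (\<omega> / 2 * len g))"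
    and g: "g \<in> carrier G"
  shows "W N k g \<le> A ^ k * exp (- (\<omega> / 2 * len g))"
  using g
proof (induction k arbitrary: g)
  case (Suc k)
  have "W N (Suc k) g \<le> (\<Sum>s\<in>B N. A ^ k * exp (- (\<omega> / 2 * len (inv s \<otimes> g))))"
    unfolding W.simps using Suc.prems by (intro sum_mono Suc.IH) (auto simp: in_B)
  also have "\<dots> = A ^ k * (\<Sum>s\<in>B N. exp (- (\<omega> / 2 * len (inv s \<otimes> g))))" by (simp add: sum_distrib_left)
  also have "\<dots> \<le> A ^ k * (A * exp (- (\<omega> / 2 * len g)))" using A Suc.prems by (intro mult_left_mono) auto
  finally show ?case by (simp add: mult.commute mult.left_commute)
qed auto

text \<open>The model is the permutation representation on the left cosets of \<open>H\<close>, with \<open>e\<close> the indicator of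
  the coset \<open>H\<close>.\<close>

locale coset_rep = metric_rep G S \<pi> C
  for G :: "('a, 'b) monoid_scheme" (structure) and S and \<pi> :: "'a \<Rightarrow> 'v::real_inner \<Rightarrow> 'v" and C +
  fixes H e
  assumes H: "subgroup H G" and e_C: "e \<in> C"
    and e_inner: "g \<in> carrier G \<Longrightarrow> inner (\<pi> g e) e = (if g \<in> H then 1 else 0)"
    and e_span: "v \<in> C \<Longrightarrow> \<exists>I c. finite I \<and> I \<subseteq> carrier G \<and> (\<forall>x\<in>I. 0 \<le> c x) \<and> v = (\<Sum>x\<in>I. c x *\<^sub>R \<pi> x e)"
begin

text \<open>A matrix coefficient between \<open>\<pi> x e\<close> and \<open>\<pi> y e\<close>
  detects the \<open>g\<close> with \<open>inv y \<otimes> (g \<otimes> x)\<close> in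
  \<open>H\<close>, so the bound of \<open>W_le\<close> is summed over \<open>H\<close>. The vector
  \<open>v\<close> and the constant \<open>K\<close> of \<open>H\<close> affect only
  \<open>K'\<close>, not the rate.\<close>

lemma P_pow_growth:
  assumes K: "K \<ge> 0" "\<And>n. real (card (H \<inter> B n)) \<le> K * exp ((\<omega> - \<gamma>) * n)" and \<gamma>: "\<gamma> \<le> \<omega> / 2" and "\<omega> \<ge> 0"
    and A: "A \<ge> 0" "\<And>g. g \<in> carrier G \<Longrightarrow> (\<Sum>s\<in>B N. exp (- (\<omega> / 2 * len (inv s \<otimes> g)))) \<le> A * exp (- (\<omega> / 2 * len g))"
    and v: "v \<in> C"
  shows "\<exists>K'. \<forall>k. inner ((P N ^^ k) v) v \<le> K' * (real k + 1) * (A * exp ((\<omega> / 2 - \<gamma>) * N)) ^ k"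
proof -
  define r where "r = A * exp ((\<omega> / 2 - \<gamma>) * N)"
  obtain I c where I: "finite I" "I \<subseteq> carrier G" "\<And>x. x \<in> I \<Longrightarrow> 0 \<le> c x" "v = (\<Sum>x\<in>I. c x *\<^sub>R \<pi> x e)"
    using e_span[OF v] by auto
  define M where "M b = exp (\<omega> / 2 * b) * (K * (real N + b + 1) * exp ((\<omega> / 2 - \<gamma>) * b))" for b :: real
  have M: "(\<Sum>g\<in>B (k * N). W N k g * inner (\<pi> g (\<pi> x e)) (\<pi> y e)) \<le> M (real (len x + len y)) * (real k + 1) * r ^ k"
    if x: "x \<in> carrier G" and y: "y \<in> carrier G" for x y k
  proof -
    define b where "b = len x + len y"
    define Z where "Z = {g \<in> B (k * N). inv y \<otimes> (g \<otimes> x) \<in> H}"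
    have "(\<Sum>g\<in>B (k * N). W N k g * inner (\<pi> g (\<pi> x e)) (\<pi> y e)) = (\<Sum>g\<in>B (k * N). if g \<in> Z then W N k g else 0)"
    proof (rule sum.cong[OF refl])
      fix g assume gB: "g \<in> B (k * N)"
      then have g: "g \<in> carrier G" by (simp add: in_B)
      have eq: "g \<otimes> x = y \<otimes> (inv y \<otimes> (g \<otimes> x))" using g x y by (simp add: m_assoc[symmetric])
      have "\<pi> g (\<pi> x e) = \<pi> (g \<otimes> x) e" using g x by (simp add: \<pi>_mult e_C)
      also have "\<dots> = \<pi> y (\<pi> (inv y \<otimes> (g \<otimes> x)) e)" using g x y by (subst eq) (simp add: \<pi>_mult e_C del: inv_closed)
      finally have "inner (\<pi> g (\<pi> x e)) (\<pi> y e) = inner (\<pi> (inv y \<otimes> (g \<otimes> x)) e) e"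
        using g x y by (simp add: \<pi>_inner C_\<pi> e_C)
      also have "\<dots> = (if g \<in> Z then 1 else 0)" using e_inner[of "inv y \<otimes> (g \<otimes> x)"] g x y gB by (simp add: Z_def)
      finally show "W N k g * inner (\<pi> g (\<pi> x e)) (\<pi> y e) = (if g \<in> Z then W N k g else 0)" by simp
    qed
    also have "\<dots> = sum (W N k) Z"
      by (rule sum.mono_neutral_cong_right) (auto simp: Z_def)
    also have "\<dots> \<le> (\<Sum>g\<in>Z. A ^ k * exp (\<omega> / 2 * b) * exp (- (\<omega> / 2 * len (inv y \<otimes> (g \<otimes> x)))))"
    proof (rule sum_mono)
      fix g assume "g \<in> Z"
      then have g: "g \<in> carrier G" by (simp add: Z_def in_B)
      have "len (inv y \<otimes> (g \<otimes> x)) \<le> len y + (len g + len x)"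
        using len_mult[of "inv y" "g \<otimes> x"] len_mult[OF g x] g x y by simp
      then have "real (len (inv y \<otimes> (g \<otimes> x))) \<le> real b + len g" by (simp add: b_def)
      then have "\<omega> / 2 * real (len (inv y \<otimes> (g \<otimes> x))) \<le> \<omega> / 2 * (real b + len g)" using \<open>\<omega> \<ge> 0\<close> by (intro mult_left_mono) auto
      then have "exp (- (\<omega> / 2 * len g)) \<le> exp (\<omega> / 2 * b) * exp (- (\<omega> / 2 * len (inv y \<otimes> (g \<otimes> x))))"
        by (simp add: distrib_left flip: exp_add)
      then have "A ^ k * exp (- (\<omega> / 2 * len g)) \<le> A ^ k * (exp (\<omega> / 2 * b) * exp (- (\<omega> / 2 * len (inv y \<otimes> (g \<otimes> x)))))"
        using A(1) by (intro mult_left_mono) auto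
      then show "W N k g \<le> A ^ k * exp (\<omega> / 2 * b) * exp (- (\<omega> / 2 * len (inv y \<otimes> (g \<otimes> x))))"
        using W_le[OF A g, of k] by simp
    qed
    also have "\<dots> = A ^ k * exp (\<omega> / 2 * b) * (\<Sum>g\<in>Z. exp (- (\<omega> / 2 * len (inv y \<otimes> (g \<otimes> x)))))"
      by (simp add: sum_distrib_left)
    also have "\<dots> \<le> A ^ k * exp (\<omega> / 2 * b) * (K * ((real N + b + 1) * (real k + 1)) * (exp ((\<omega> / 2 - \<gamma>) * N) ^ k * exp ((\<omega> / 2 - \<gamma>) * b)))"
    proof (rule mult_left_mono)
    have "(\<Sum>g\<in>Z. exp (- (\<omega> / 2 * len (inv y \<otimes> (g \<otimes> x)))))
        = (\<Sum>h\<in>(\<lambda>g. inv y \<otimes> (g \<otimes> x)) ` Z. exp (- (\<omega> / 2 * len h)))"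
      using x y by (subst sum.reindex) (auto simp: inj_on_def Z_def in_B)
    also have "\<dots> \<le> (\<Sum>h\<in>H \<inter> B (k * N + b). exp (- (\<omega> / 2 * len h)))"
    proof (rule sum_mono2)
      show "(\<lambda>g. inv y \<otimes> (g \<otimes> x)) ` Z \<subseteq> H \<inter> B (k * N + b)"
      proof
        fix h assume "h \<in> (\<lambda>g. inv y \<otimes> (g \<otimes> x)) ` Z"
        then obtain g where g: "g \<in> B (k * N)" "h \<in> H" "h = inv y \<otimes> (g \<otimes> x)" by (auto simp: Z_def)
        then have gc: "g \<in> carrier G" "len g \<le> k * N" by (auto simp: in_B)
        have "len h \<le> len y + (len g + len x)"
          using len_mult[of "inv y" "g \<otimes> x"] len_mult[OF gc(1) x] gc x y g(3) by simp
        then show "h \<in> H \<inter> B (k * N + b)" using g gc x y by (simp add: in_B b_def)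
      qed
    qed auto
    also have "\<dots> \<le> K * (real (k * N + b) + 1) * exp ((\<omega> / 2 - \<gamma>) * real (k * N + b))"
      by (rule weighted_subgroup_sum_le[OF K(2,1) \<gamma>])
    also have "\<dots> \<le> K * ((real N + b + 1) * (real k + 1)) * exp ((\<omega> / 2 - \<gamma>) * real (k * N + b))"
      using K(1) by (intro mult_right_mono mult_left_mono) (auto simp: algebra_simps)
    also have "exp ((\<omega> / 2 - \<gamma>) * real (k * N + b)) = exp ((\<omega> / 2 - \<gamma>) * N) ^ k * exp ((\<omega> / 2 - \<gamma>) * b)"
      by (simp add: algebra_simps flip: exp_add exp_of_nat_mult)
    finally show "(\<Sum>g\<in>Z. exp (- (\<omega> / 2 * len (inv y \<otimes> (g \<otimes> x)))))
        \<le> K * ((real N + b + 1) * (real k + 1)) * (exp ((\<omega> / 2 - \<gamma>) * N) ^ k * exp ((\<omega> / 2 - \<gamma>) * b))" .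
    qed (use A in auto)
    also have "\<dots> = M (real (len x + len y)) * (real k + 1) * r ^ k"
      by (simp add: M_def r_def b_def power_mult_distrib mult_ac)
    finally show ?thesis .
  qed
  define K' where "K' = (\<Sum>x\<in>I. \<Sum>y\<in>I. c x * c y * M (real (len x + len y)))"
  have "inner ((P N ^^ k) v) v \<le> K' * (real k + 1) * r ^ k" for k
  proof -
    have "inner (\<pi> g v) v = (\<Sum>x\<in>I. \<Sum>y\<in>I. c x * c y * inner (\<pi> g (\<pi> x e)) (\<pi> y e))" if "g \<in> carrier G" for g
    proof -
      have "\<pi> g v = (\<Sum>x\<in>I. c x *\<^sub>R \<pi> g (\<pi> x e))" using that by (simp add: I(4) \<pi>_sum \<pi>_scale)
      then have "inner (\<pi> g v) v = (\<Sum>x\<in>I. c x * inner (\<pi> g (\<pi> x e)) v)" by (simp add: inner_sum_left)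
      also have "\<dots> = (\<Sum>x\<in>I. \<Sum>y\<in>I. c x * c y * inner (\<pi> g (\<pi> x e)) (\<pi> y e))"
        by (simp add: I(4) inner_sum_right sum_distrib_left mult_ac)
      finally show ?thesis .
    qed
    then have "inner ((P N ^^ k) v) v = (\<Sum>g\<in>B (k * N). \<Sum>x\<in>I. \<Sum>y\<in>I. c x * c y * (W N k g * inner (\<pi> g (\<pi> x e)) (\<pi> y e)))"
      unfolding P_pow[OF v] by (simp add: inner_sum_left sum_distrib_left mult_ac in_B)
    also have "\<dots> = (\<Sum>x\<in>I. \<Sum>y\<in>I. c x * c y * (\<Sum>g\<in>B (k * N). W N k g * inner (\<pi> g (\<pi> x e)) (\<pi> y e)))"
      by (subst sum.swap, rule sum.cong[OF refl], subst sum.swap) (simp add: sum_distrib_left)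
    also have "\<dots> \<le> (\<Sum>x\<in>I. \<Sum>y\<in>I. c x * c y * (M (real (len x + len y)) * (real k + 1) * r ^ k))"
      using I by (intro sum_mono mult_left_mono M) auto
    also have "\<dots> = K' * (real k + 1) * r ^ k"
      by (simp add: K'_def sum_distrib_left sum_distrib_right mult_ac)
    finally show ?thesis .
  qed
  then show ?thesis unfolding r_def by blast
qed

text \<open>Passing to the growth rate removes \<open>K\<close> and \<open>K'\<close>, which makes
  the bound uniform over the subgroups with the same \<gamma>.\<close>

lemma P_le:
  assumes K: "K \<ge> 0" "\<And>n. real (card (H \<inter> B n)) \<le> K * exp ((\<omega> - \<gamma>) * n)" and \<gamma>: "\<gamma> \<le> \<omega> / 2" and "\<omega> \<ge> 0"
    and A: "A > 0" "\<And>g. g \<in> carrier G \<Longrightarrow> (\<Sum>s\<in>B N. exp (- (\<omega> / 2 * len (inv s \<otimes> g)))) \<le> A * exp (- (\<omega> / 2 * len g))"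
    and v: "v \<in> C"
  shows "inner (P N v) v \<le> A * exp ((\<omega> / 2 - \<gamma>) * N) * (norm v)\<^sup>2"
proof -
  obtain K' where "\<And>k. inner ((P N ^^ k) v) v \<le> K' * (real k + 1) * (A * exp ((\<omega> / 2 - \<gamma>) * N)) ^ k"
    using P_pow_growth[OF K \<gamma> \<open>\<omega> \<ge> 0\<close> less_imp_le[OF A(1)] A(2) v] by auto
  then show ?thesis using A(1) by (intro P_le_growth[OF v]) auto
qed

section \<open>Sphere operators and subgroups of almost maximal growth\<close>

definition U where "U j v = (\<Sum>h\<in>Sph j. \<pi> h v)"

lemma U_C: "v \<in> C \<Longrightarrow> U j v \<in> C"
  unfolding U_def by (intro C_sum C_\<pi>) (auto simp: in_Sph)

text \<open>Every element of \<open>Sph (i + j)\<close> factors along a geodesic and so occurs among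
  the products on the left; the order of the cone absorbs the other products.\<close>

lemma U_add:
  assumes v: "v \<in> C" shows "U i (U j v) - U (i + j) v \<in> C"
proof -
  have "U i (U j v) = (\<Sum>(x, y)\<in>Sph i \<times> Sph j. \<pi> (x \<otimes> y) v)"
    unfolding U_def using v by (simp add: \<pi>_sum \<pi>_mult in_Sph flip: sum.cartesian_product)
  moreover have "(\<Sum>(x, y)\<in>Sph i \<times> Sph j. \<pi> (x \<otimes> y) v) - (\<Sum>h\<in>Sph (i + j). \<pi> h v) \<in> C"
  proof -
    have "\<exists>x y. x \<in> Sph i \<and> y \<in> Sph j \<and> h = x \<otimes> y" if "h \<in> Sph (i + j)" for h
    proof -
      have h: "h \<in> carrier G" "len h = i + j" using that by (auto simp: in_Sph)
      obtain x where "x \<in> carrier G" "len x = i" "len (inv x \<otimes> h) = len h - i" using geodesic_point[OF h(1), of i] h(2) by auto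
      then show ?thesis using h by (intro exI[of _ x] exI[of _ "inv x \<otimes> h"]) (auto simp: in_Sph m_assoc[symmetric])
    qed
    then obtain x y where xy: "\<And>h. h \<in> Sph (i + j) \<Longrightarrow> x h \<in> Sph i \<and> y h \<in> Sph j \<and> h = x h \<otimes> y h" by metis
    show ?thesis
    proof (rule C_sum_diff[where t = "\<lambda>h. (x h, y h)"])
      show "inj_on (\<lambda>h. (x h, y h)) (Sph (i + j))"
      proof (rule inj_onI)
        fix h h' assume "h \<in> Sph (i + j)" "h' \<in> Sph (i + j)" "(x h, y h) = (x h', y h')"
        then show "h = h'" using xy[of h] xy[of h'] by simp
      qed
      show "(\<lambda>h. (x h, y h)) ` Sph (i + j) \<subseteq> Sph i \<times> Sph j" using xy by auto
      show "(case xa of (x, y) \<Rightarrow> \<pi> (x \<otimes> y) v) \<in> C" if "xa \<in> Sph i \<times> Sph j" for xa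
        using that v by (auto intro!: C_\<pi> simp: in_Sph)
      show "(case (x h, y h) of (x, y) \<Rightarrow> \<pi> (x \<otimes> y) v) - \<pi> h v \<in> C" if "h \<in> Sph (i + j)" for h
        using xy[OF that] C_zero by simp
    qed auto
  qed
  ultimately show ?thesis by (simp add: U_def)
qed

lemma norm_U_le: "v \<in> C \<Longrightarrow> norm (U j v) \<le> card (Sph j) * norm v"
  unfolding U_def by (rule order_trans[OF sum_norm_le[where g = "\<lambda>_. norm v"]]) (auto simp: in_Sph \<pi>_norm)

lemma card_H_Sph: "real (card (H \<inter> Sph j)) = inner (U j e) e"
proof -
  have "inner (U j e) e = (\<Sum>h\<in>Sph j. if h \<in> H then 1 else 0)"
    unfolding U_def inner_sum_left by (rule sum.cong) (auto simp: in_Sph e_inner)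
  then show ?thesis by (simp add: sum.If_cases Int_commute)
qed

lemma norm_e: "norm e = 1"
  using e_inner[of \<one>] H by (simp add: \<pi>_one e_C norm_eq_sqrt_inner subgroup.one_closed)

text \<open>Otherwise \<open>U_add\<close> would bound \<open>U (m * n + i) e\<close> by powers of
  \<open>exp (\<omega> * n - 1)\<close>. As \<open>inner (U j e) e\<close> counts \<open>H\<close>
  in a sphere, \<open>H\<close> would grow at rate at most \<open>\<omega> - 1 / n\<close>.\<close>

lemma ex_large_U:
  assumes n: "n \<ge> 1" "1 \<le> \<omega> * real n" and growth: "growth_exponent G S H > ereal (\<omega> - 1 / n)"
  shows "\<exists>f\<in>C. norm f = 1 \<and> exp (\<omega> * n - 1) \<le> norm (U n f)"
proof (rule ccontr)
  assume contr: "\<not> ?thesis"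
  define r where "r = exp (\<omega> * n - 1)"
  have r: "r \<ge> 1" using n by (simp add: r_def)
  have U_le: "norm (U n v) \<le> r * norm v" if v: "v \<in> C" for v
  proof (cases "v = 0")
    case True
    then show ?thesis by (simp add: U_def linear_0[OF linear_\<pi>] in_Sph)
  next
    case False
    define w where "w = v /\<^sub>R norm v"
    have "w \<in> C" "norm w = 1" using False v by (auto simp: w_def intro!: C_scale)
    then have "norm (U n w) < r" using contr by (force simp: r_def)
    moreover have "U n w = U n v /\<^sub>R norm v" unfolding U_def w_def by (simp add: \<pi>_scale in_Sph scaleR_sum_right)
    ultimately show ?thesis using False by (simp add: field_simps)
  qed
  have pow: "norm (U (m * n + i) e) \<le> r ^ m * card (Sph i)" for m i
  proof (induction m)
    case 0
    then show ?case using norm_U_le[OF e_C, of i] norm_e by simp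
  next
    case (Suc m)
    have "norm (U (n + (m * n + i)) e) \<le> norm (U n (U (m * n + i) e))"
      by (intro norm_le_C U_add U_C e_C)
    also have "\<dots> \<le> r * norm (U (m * n + i) e)" by (intro U_le U_C e_C)
    also have "\<dots> \<le> r * (r ^ m * card (Sph i))" using Suc r by (intro mult_left_mono) auto
    finally show ?case by (simp add: add.assoc)
  qed
  have "\<omega> - 1 / n \<ge> 0" using n by (simp add: field_simps)
  have sph: "real (card (H \<inter> Sph j)) \<le> card (B n) * exp ((\<omega> - 1 / n) * j)" for j
  proof -
    have "real (card (H \<inter> Sph j)) \<le> norm (U j e) * norm e" unfolding card_H_Sph by (rule norm_cauchy_schwarz)
    also have "\<dots> \<le> r ^ (j div n) * card (Sph (j mod n))" using pow[of "j div n" "j mod n"] norm_e by simp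
    also have "\<dots> \<le> exp ((\<omega> - 1 / n) * j) * card (B n)"
    proof (rule mult_mono)
      have "r ^ (j div n) = exp ((\<omega> * n - 1) * real (j div n))" by (simp add: r_def exp_of_nat_mult[symmetric] mult.commute)
      also have "\<dots> \<le> exp ((\<omega> * n - 1) * (real j / real n))"
      proof -
        have "(\<omega> * n - 1) * real (j div n) \<le> (\<omega> * n - 1) * (real j / real n)"
          using n by (intro mult_left_mono of_nat_div_le_of_nat) auto
        then show ?thesis by (simp only: exp_le_cancel_iff)
      qed
      also have "(\<omega> * n - 1) * (real j / real n) = (\<omega> - 1 / n) * j" using n by (simp add: field_simps)
      finally show "r ^ (j div n) \<le> exp ((\<omega> - 1 / n) * j)" .
      have "Sph (j mod n) \<subseteq> B n" using n by (auto simp: in_Sph in_B less_imp_le)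
      then show "real (card (Sph (j mod n))) \<le> card (B n)" by (simp add: card_mono)
    qed auto
    finally show ?thesis by (simp add: mult.commute)
  qed
  have "growth_exponent G S H \<le> ereal (\<omega> - 1 / n)"
  proof (rule growth_exponent_le)
    show "0 < real (card (B n))" using card_B_pos by simp
    fix N
    have "H \<inter> B N = (\<Union>j\<le>N. H \<inter> Sph j)" by (auto simp: B_UN_Sph)
    then have "card (H \<inter> B N) \<le> (\<Sum>j\<le>N. card (H \<inter> Sph j))" by (simp only:) (rule card_UN_le, simp)
    then have "real (card (H \<inter> B N)) \<le> (\<Sum>j\<le>N. real (card (H \<inter> Sph j)))" by (simp only: of_nat_le_iff flip: of_nat_sum)
    also have "\<dots> \<le> (\<Sum>j\<le>N. card (B n) * exp ((\<omega> - 1 / n) * N))"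
    proof (rule sum_mono)
      fix j assume "j \<in> {..N}"
      then have "real (card (B n)) * exp ((\<omega> - 1 / n) * j) \<le> card (B n) * exp ((\<omega> - 1 / n) * N)"
        using \<open>\<omega> - 1 / n \<ge> 0\<close> by (intro mult_left_mono) (auto intro!: mult_left_mono)
      then show "real (card (H \<inter> Sph j)) \<le> card (B n) * exp ((\<omega> - 1 / n) * N)" using sph[of j] by linarith
    qed
    also have "\<dots> = real (card (B n)) * (real N + 1) * exp ((\<omega> - 1 / n) * real N)" by (simp add: algebra_simps)
    finally show "real (card (H \<inter> B N)) \<le> real (card (B n)) * (real N + 1) * exp ((\<omega> - 1 / n) * real N)" .
  qed
  then show False using growth by simp
qed

text \<open>A large outer sphere forces all inner ones to be large: \<open>U n f\<close> is
  dominated by \<open>U (n - j) (U j f)\<close>, and \<open>U (n - j)\<close> has norm at most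
  \<open>C1 * exp (\<omega> * real (n - j))\<close>. The \<open>n + 1\<close> spheres then add up by
  \<open>norm_sum_ge\<close>.\<close>

lemma norm_weighted_sum_ge:
  assumes C1: "C1 \<ge> 1" "\<And>k. real (card (Sph k)) \<le> C1 * exp (\<omega> * k)" and f: "f \<in> C" "exp (\<omega> * n - 1) \<le> norm (U n f)"
  shows "real (n + 1) / (exp 1 * C1)\<^sup>2 \<le> (norm (\<Sum>h\<in>B n. exp (- (\<omega> * len h)) *\<^sub>R \<pi> h f))\<^sup>2"
proof -
  have U_ge: "1 / (exp 1 * C1) \<le> norm (exp (- (\<omega> * real j)) *\<^sub>R U j f)" if j: "j \<le> n" for j
  proof -
    have "exp (\<omega> * n - 1) \<le> norm (U (n - j + j) f)" using f j by simp
    also have "\<dots> \<le> norm (U (n - j) (U j f))" by (intro norm_le_C U_add U_C f)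
    also have "\<dots> \<le> card (Sph (n - j)) * norm (U j f)" by (intro norm_U_le U_C f)
    also have "\<dots> \<le> C1 * exp (\<omega> * real (n - j)) * norm (U j f)" using C1(2) by (intro mult_right_mono) auto
    also have "\<dots> = C1 * exp (\<omega> * n) * (exp (- (\<omega> * real j)) * norm (U j f))"
      using j by (simp add: of_nat_diff right_diff_distrib exp_diff exp_minus field_simps)
    finally have "exp (\<omega> * n) * (1 / exp 1) \<le> exp (\<omega> * n) * (C1 * (exp (- (\<omega> * real j)) * norm (U j f)))"
      by (simp add: exp_diff mult_ac)
    then have "1 / exp 1 \<le> C1 * (exp (- (\<omega> * real j)) * norm (U j f))" by (subst (asm) mult_le_cancel_left_pos) auto
    then show ?thesis using C1(1) by (simp add: field_simps)
  qed
  have "(\<Sum>h\<in>B n. exp (- (\<omega> * len h)) *\<^sub>R \<pi> h f) = (\<Sum>j\<le>n. exp (- (\<omega> * real j)) *\<^sub>R U j f)"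
    unfolding sum_B_Sph U_def scaleR_sum_right by (intro sum.cong refl) (simp add: in_Sph)
  moreover have "(\<Sum>j\<le>n. (1 / (exp 1 * C1))\<^sup>2) \<le> (\<Sum>j\<le>n. (norm (exp (- (\<omega> * real j)) *\<^sub>R U j f))\<^sup>2)"
    using U_ge C1(1) by (intro sum_mono power_mono) auto
  moreover have "(\<Sum>j\<le>n. (norm (exp (- (\<omega> * real j)) *\<^sub>R U j f))\<^sup>2) \<le> (norm (\<Sum>j\<le>n. exp (- (\<omega> * real j)) *\<^sub>R U j f))\<^sup>2"
    by (rule norm_sum_ge) (auto intro!: C_scale U_C f)
  ultimately show ?thesis by (simp add: power_divide)
qed

end

section \<open>The permutation representation on cosets\<close>

text \<open>With \<open>'i\<close> the type of all subsets of the group, one vector space serves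
  every coset space. The constants of \<open>ex_almost_invariant\<close> can thus be fixed at a
  single type before \<open>H\<close> is known.\<close>

typedef 'i finsupp = "{f :: 'i \<Rightarrow> real. finite {i. f i \<noteq> 0}}" morphisms val Abs_finsupp
  by (rule exI[of _ "\<lambda>_. 0"]) simp

lemma finite_val [simp]: "finite {i. val f i \<noteq> 0}"
  using val[of f] by simp

lemma val_Abs: "finite {i. f i \<noteq> 0} \<Longrightarrow> val (Abs_finsupp f) = f"
  by (simp add: Abs_finsupp_inverse)

lemma finsupp_eqI: "(\<And>i. val f i = val g i) \<Longrightarrow> f = g"
  by (metis ext val_inject)

instantiation finsupp :: (type) real_inner
begin

definition zero_finsupp :: "'a finsupp" where
  "zero_finsupp = Abs_finsupp (\<lambda>_. 0)"
definition plus_finsupp :: "'a finsupp \<Rightarrow> 'a finsupp \<Rightarrow> 'a finsupp" where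
  "plus_finsupp f g = Abs_finsupp (\<lambda>i. val f i + val g i)"
definition uminus_finsupp :: "'a finsupp \<Rightarrow> 'a finsupp" where
  "uminus_finsupp f = Abs_finsupp (\<lambda>i. - val f i)"
definition minus_finsupp :: "'a finsupp \<Rightarrow> 'a finsupp \<Rightarrow> 'a finsupp" where
  "minus_finsupp f g = Abs_finsupp (\<lambda>i. val f i - val g i)"
definition scaleR_finsupp :: "real \<Rightarrow> 'a finsupp \<Rightarrow> 'a finsupp" where
  "scaleR_finsupp r f = Abs_finsupp (\<lambda>i. r * val f i)"
definition inner_finsupp :: "'a finsupp \<Rightarrow> 'a finsupp \<Rightarrow> real" where
  "inner_finsupp f g = (\<Sum>i | val f i \<noteq> 0. val f i * val g i)"
definition norm_finsupp :: "'a finsupp \<Rightarrow> real" where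
  "norm_finsupp f = sqrt (inner f f)"
definition dist_finsupp :: "'a finsupp \<Rightarrow> 'a finsupp \<Rightarrow> real" where
  "dist_finsupp f g = norm (f - g)"
definition sgn_finsupp :: "'a finsupp \<Rightarrow> 'a finsupp" where
  "sgn_finsupp f = scaleR (inverse (norm f)) f"
definition uniformity_finsupp :: "('a finsupp \<times> 'a finsupp) filter" where
  "uniformity_finsupp = (INF e\<in>{0<..}. principal {(x, y). dist x y < e})"
definition open_finsupp :: "'a finsupp set \<Rightarrow> bool" where
  "open_finsupp X \<longleftrightarrow> (\<forall>x\<in>X. \<forall>\<^sub>F (x', y) in uniformity. x' = x \<longrightarrow> y \<in> X)"

lemma val_zero [simp]: "val 0 i = 0"
  by (simp add: zero_finsupp_def val_Abs)

lemma val_add [simp]: "val (f + g) i = val f i + val g i"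
  unfolding plus_finsupp_def by (subst val_Abs) (auto intro: finite_subset[of _ "{i. val f i \<noteq> 0} \<union> {i. val g i \<noteq> 0}"])

lemma val_diff [simp]: "val (f - g) i = val f i - val g i"
  unfolding minus_finsupp_def by (subst val_Abs) (auto intro: finite_subset[of _ "{i. val f i \<noteq> 0} \<union> {i. val g i \<noteq> 0}"])

lemma val_minus [simp]: "val (- f) i = - val f i"
  unfolding uminus_finsupp_def by (subst val_Abs) auto

lemma val_scaleR [simp]: "val (scaleR r f) i = r * val f i"
  unfolding scaleR_finsupp_def by (subst val_Abs) (auto intro: finite_subset[of _ "{i. val f i \<noteq> 0}"])

lemma inner_finsupp_superset:
  assumes "finite I" "{i. val f i \<noteq> 0} \<subseteq> I" shows "inner f g = (\<Sum>i\<in>I. val f i * val g i)"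
  unfolding inner_finsupp_def using assms by (intro sum.mono_neutral_left) auto

instance
proof
  fix f g h :: "'a finsupp" and r s :: real
  show "f + g + h = f + (g + h)" "f + g = g + f" "0 + f = f" "- f + f = 0" "f - g = f + - g"
    "scaleR r (f + g) = scaleR r f + scaleR r g" "scaleR (r + s) f = scaleR r f + scaleR s f"
    "scaleR r (scaleR s f) = scaleR (r * s) f" "scaleR 1 f = f"
    by (auto intro!: finsupp_eqI simp: algebra_simps)
  show "sgn f = scaleR (inverse (norm f)) f" by (rule sgn_finsupp_def)
  show "dist f g = norm (f - g)" by (rule dist_finsupp_def)
  show "(uniformity :: ('a finsupp \<times> 'a finsupp) filter) = (INF e\<in>{0<..}. principal {(x, y). dist x y < e})"
    by (rule uniformity_finsupp_def)
  show "open X \<longleftrightarrow> (\<forall>x\<in>X. \<forall>\<^sub>F (x', y) in uniformity. x' = x \<longrightarrow> y \<in> X)" for X :: "'a finsupp set"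
    by (rule open_finsupp_def)
  define I where "I = {i. val f i \<noteq> 0} \<union> {i. val g i \<noteq> 0} \<union> {i. val (f + g) i \<noteq> 0} \<union> {i. val (scaleR r f) i \<noteq> 0}"
  have I: "finite I" unfolding I_def by (intro finite_UnI finite_val)
  have e: "inner f h = (\<Sum>i\<in>I. val f i * val h i)" "inner g h = (\<Sum>i\<in>I. val g i * val h i)"
    "inner (f + g) h = (\<Sum>i\<in>I. val (f + g) i * val h i)" "inner (scaleR r f) h = (\<Sum>i\<in>I. val (scaleR r f) i * val h i)" for h
    by ((rule inner_finsupp_superset[OF I]), (auto simp: I_def)[1])+
  show "inner f g = inner g f" by (simp add: e mult.commute)
  show "inner (f + g) h = inner f h + inner g h" by (simp add: e(1,2,3) distrib_right sum.distrib)
  show "inner (scaleR r f) h = r * inner f h" by (simp add: e(1,4) sum_distrib_left mult.assoc)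
  show "0 \<le> inner f f" by (simp add: e(1) sum_nonneg)
  show "inner f f = 0 \<longleftrightarrow> f = 0"
  proof
    assume "inner f f = 0"
    then have zero: "\<forall>i\<in>I. val f i = 0" using I by (simp add: e(1) sum_nonneg_eq_0_iff)
    have "val f i = 0" for i
    proof (cases "i \<in> I")
      case False
      then show ?thesis by (simp add: I_def)
    qed (use zero in blast)
    then show "f = 0" by (intro finsupp_eqI) simp
  qed (simp add: inner_finsupp_def)
  show "norm f = sqrt (inner f f)" by (rule norm_finsupp_def)
qed

end

lemma val_sum: "val (sum f I) i = (\<Sum>j\<in>I. val (f j) i)"
  by (induction I rule: infinite_finite_induct) auto

context group begin

text \<open>Values off the left cosets of \<open>H\<close> are set to 0. Members of
  \<open>coset_cone H\<close> vanish there, so the laws of a representation hold on the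
  cone.\<close>

definition coset_action :: "'a set \<Rightarrow> 'a \<Rightarrow> 'a set finsupp \<Rightarrow> 'a set finsupp" where
  "coset_action H g v = Abs_finsupp (\<lambda>A. if A \<in> (\<lambda>x. x <# H) ` carrier G then val v (inv g <# A) else 0)"

definition coset_cone :: "'a set \<Rightarrow> 'a set finsupp set" where
  "coset_cone H = {v. \<forall>A. 0 \<le> val v A \<and> (val v A \<noteq> 0 \<longrightarrow> A \<in> (\<lambda>x. x <# H) ` carrier G)}"

definition coset_vector :: "'a set \<Rightarrow> 'a set finsupp" where
  "coset_vector H = Abs_finsupp (\<lambda>A. if A = H then 1 else 0)"

context
  fixes H assumes H: "subgroup H G"
begin

private abbreviation "L \<equiv> (\<lambda>x. x <# H) ` carrier G"

private lemma H_carrier: "H \<subseteq> carrier G"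
  using H by (rule subgroup.subset)

private lemma L_carrier: "A \<in> L \<Longrightarrow> A \<subseteq> carrier G"
  using l_coset_subset_G[OF H_carrier] by auto

private lemma L_translate: "g \<in> carrier G \<Longrightarrow> A \<in> L \<Longrightarrow> g <# A \<in> L"
  using lcos_m_assoc[OF H_carrier] by (auto simp: image_iff)

private lemma L_inv: "g \<in> carrier G \<Longrightarrow> A \<in> L \<Longrightarrow> g <# (inv g <# A) = A" "g \<in> carrier G \<Longrightarrow> A \<in> L \<Longrightarrow> inv g <# (g <# A) = A"
  using L_carrier by (simp_all add: lcos_m_assoc lcos_mult_one)

private lemma val_action:
  assumes g: "g \<in> carrier G"
  shows "val (coset_action H g v) A = (if A \<in> L then val v (inv g <# A) else 0)"
proof -
  have "{A. (if A \<in> L then val v (inv g <# A) else 0) \<noteq> 0} \<subseteq> (\<lambda>A. g <# A) ` {A. val v A \<noteq> 0}"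
  proof
    fix A assume "A \<in> {A. (if A \<in> L then val v (inv g <# A) else 0) \<noteq> 0}"
    then have A: "A \<in> L" "val v (inv g <# A) \<noteq> 0" by (auto split: if_splits)
    then show "A \<in> (\<lambda>A. g <# A) ` {A. val v A \<noteq> 0}" using L_inv(1)[OF g A(1)] by (intro image_eqI[of _ _ "inv g <# A"]) auto
  qed
  then have fin: "finite {A. (if A \<in> L then val v (inv g <# A) else 0) \<noteq> 0}"
    by (rule finite_subset) simp
  show ?thesis unfolding coset_action_def by (subst val_Abs[OF fin]) simp
qed

private lemma val_vector: "val (coset_vector H) A = (if A = H then 1 else 0)"
  unfolding coset_vector_def by (subst val_Abs) auto

private lemma H_L: "H \<in> L"
  using lcos_mult_one[OF H_carrier] by (metis image_eqI one_closed)

private lemma val_action_vector: "x \<in> carrier G \<Longrightarrow> val (coset_action H x (coset_vector H)) A = (if A = x <# H then 1 else 0)"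
  using L_inv[of x A] L_inv[of x H] H_L L_translate[of x H] by (auto simp: val_action val_vector)

lemma positive_rep_coset_action: "positive_rep G (coset_action H) (coset_cone H)"
proof (rule positive_rep.intro[OF group_axioms], rule positive_rep_axioms.intro)
  show "linear (coset_action H g)" if "g \<in> carrier G" for g
    using that by (intro linearI) (auto intro!: finsupp_eqI simp: val_action)
  show "coset_action H g v \<in> coset_cone H" if "g \<in> carrier G" "v \<in> coset_cone H" for g v
    using that by (auto simp: coset_cone_def val_action)
  show "v + w \<in> coset_cone H" if "v \<in> coset_cone H" "w \<in> coset_cone H" for v w
    using that unfolding coset_cone_def by (auto, metis add_0)
  show "0 \<le> inner v w" if "v \<in> coset_cone H" "w \<in> coset_cone H" for v w
    using that unfolding inner_finsupp_def coset_cone_def by (intro sum_nonneg mult_nonneg_nonneg) auto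
  show "coset_action H \<one> v = v" if "v \<in> coset_cone H" for v
    using that L_carrier by (intro finsupp_eqI) (auto simp: val_action coset_cone_def lcos_mult_one)
  show "coset_action H (g \<otimes> h) v = coset_action H g (coset_action H h v)"
    if "g \<in> carrier G" "h \<in> carrier G" "v \<in> coset_cone H" for g h v
    using that L_translate[of "inv g"] L_carrier
    by (intro finsupp_eqI) (simp add: val_action lcos_m_assoc inv_mult_group)
  show "inner (coset_action H g v) (coset_action H g w) = inner v w"
    if g: "g \<in> carrier G" and v: "v \<in> coset_cone H" and w: "w \<in> coset_cone H" for g v w
  proof -
    have supp: "A \<in> L" if "val v A \<noteq> 0" for A using v that by (auto simp: coset_cone_def)
    show ?thesis
      unfolding inner_finsupp_def
    proof (rule sum.reindex_bij_witness[where i = "\<lambda>A. g <# A" and j = "\<lambda>A. inv g <# A"])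
      fix A assume "A \<in> {A. val (coset_action H g v) A \<noteq> 0}"
      then have A: "A \<in> L" "val v (inv g <# A) \<noteq> 0" using g by (auto simp: val_action split: if_splits)
      then show "g <# (inv g <# A) = A" "inv g <# A \<in> {A. val v A \<noteq> 0}"
        "val v (inv g <# A) * val w (inv g <# A) = val (coset_action H g v) A * val (coset_action H g w) A"
        using g L_inv by (auto simp: val_action)
    next
      fix A assume "A \<in> {A. val v A \<noteq> 0}"
      then have A: "A \<in> L" "val v A \<noteq> 0" using supp by auto
      then show "inv g <# (g <# A) = A" "g <# A \<in> {A. val (coset_action H g v) A \<noteq> 0}"
        using g L_inv L_translate by (auto simp: val_action)
    qed
  qed
qed (auto simp: coset_cone_def)

lemma coset_vector_properties:
  shows coset_vector_cone: "coset_vector H \<in> coset_cone H"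
    and coset_vector_inner: "g \<in> carrier G \<Longrightarrow> inner (coset_action H g (coset_vector H)) (coset_vector H) = (if g \<in> H then 1 else 0)"
    and coset_vector_span: "v \<in> coset_cone H \<Longrightarrow> \<exists>I c. finite I \<and> I \<subseteq> carrier G \<and> (\<forall>x\<in>I. 0 \<le> c x) \<and>
       v = (\<Sum>x\<in>I. c x *\<^sub>R coset_action H x (coset_vector H))"
proof -
  show "coset_vector H \<in> coset_cone H" using H_L by (auto simp: coset_cone_def val_vector)
  show "inner (coset_action H g (coset_vector H)) (coset_vector H) = (if g \<in> H then 1 else 0)" if g: "g \<in> carrier G"
  proof -
    have "g \<in> g <# H"
      using g by (auto simp: l_coset_def intro!: bexI[of _ \<one>] subgroup.one_closed[OF H])
    then have "g <# H = H \<longleftrightarrow> g \<in> H" using coset_join3[OF g H] by auto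
    moreover have "inner (coset_action H g (coset_vector H)) (coset_vector H) = (\<Sum>A\<in>{g <# H}. 1 * (if A = H then 1 else 0))"
      unfolding inner_finsupp_def using g by (intro sum.cong) (auto simp: val_action_vector val_vector)
    ultimately show ?thesis by simp
  qed
  show "\<exists>I c. finite I \<and> I \<subseteq> carrier G \<and> (\<forall>x\<in>I. 0 \<le> c x) \<and> v = (\<Sum>x\<in>I. c x *\<^sub>R coset_action H x (coset_vector H))"
    if v: "v \<in> coset_cone H"
  proof -
    define Z where "Z = {A. val v A \<noteq> 0}"
    have "\<forall>A\<in>Z. \<exists>x\<in>carrier G. A = x <# H" using v by (auto simp: coset_cone_def Z_def)
    then obtain x where x: "\<And>A. A \<in> Z \<Longrightarrow> x A \<in> carrier G \<and> A = x A <# H" by metis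
    have inj: "inj_on x Z"
    proof (rule inj_onI)
      fix A A' assume "A \<in> Z" "A' \<in> Z" "x A = x A'"
      then show "A = A'" using x[of A] x[of A'] by simp
    qed
    have "v = (\<Sum>A\<in>Z. val v A *\<^sub>R coset_action H (x A) (coset_vector H))"
    proof (rule finsupp_eqI)
      fix A
      have "val (\<Sum>A\<in>Z. val v A *\<^sub>R coset_action H (x A) (coset_vector H)) A = (\<Sum>A'\<in>Z. if A = A' then val v A' else 0)"
        unfolding val_sum by (rule sum.cong) (use x in \<open>auto simp: val_action_vector\<close>)
      also have "\<dots> = val v A" by (simp add: Z_def)
      finally show "val v A = val (\<Sum>A\<in>Z. val v A *\<^sub>R coset_action H (x A) (coset_vector H)) A" by simp
    qed
    also have "\<dots> = (\<Sum>y\<in>x ` Z. val v (y <# H) *\<^sub>R coset_action H y (coset_vector H))"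
      using x by (subst sum.reindex[OF inj]) (auto intro!: sum.cong)
    finally have "v = (\<Sum>y\<in>x ` Z. val v (y <# H) *\<^sub>R coset_action H y (coset_vector H))" .
    then show ?thesis
      using v x by (intro exI[of _ "x ` Z"] exI[of _ "\<lambda>y. val v (y <# H)"]) (auto simp: Z_def coset_cone_def)
  qed
qed

end

end

lemma (in word_metric) coset_rep_coset_action:
  assumes "subgroup H G"
  shows "coset_rep G S (coset_action H) (coset_cone H) H (coset_vector H)"
proof -
  show ?thesis
  proof (intro coset_rep.intro metric_rep.intro coset_rep_axioms.intro)
    show "word_metric G S" by (rule word_metric_axioms)
    show "positive_rep G (coset_action H) (coset_cone H)" by (rule positive_rep_coset_action[OF assms])
    show "subgroup H G" by (rule assms)
    show "coset_vector H \<in> coset_cone H" by (rule coset_vector_cone[OF assms])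
  qed (fact coset_vector_inner[OF assms] coset_vector_span[OF assms])+
qed

section \<open>Independence of the generating set\<close>

lemma (in group) infinite_rcosets_trivial:
  assumes "\<not> virtually_cyclic G"
  shows "subgroup {\<one>} G" "infinite (rcosets {\<one>})"
proof -
  show s: "subgroup {\<one>} G" by (rule triv_subgroup)
  have "cyclic_group (G\<lparr>carrier := {\<one>}\<rparr>)"
    using subgroup_imp_group[OF s] by (intro trivial_imp_cyclic_group) (simp add: trivial_group_def)
  then show "infinite (rcosets {\<one>})" using assms s unfolding virtually_cyclic_def by auto
qed

text \<open>The trivial subgroup has exponent at least 0, and as \<open>G\<close> is not virtually
  cyclic its index is infinite; the gap then lifts \<omega> above 0.\<close>

lemma (in word_metric) \<omega>_pos_of_gap:
  assumes "\<not> virtually_cyclic G" "has_growth_gap G S"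
  shows "\<omega> > 0"
proof -
  obtain \<gamma> where \<gamma>: "\<gamma> > 0" "\<And>H. subgroup H G \<Longrightarrow> infinite (rcosets H) \<Longrightarrow> growth_exponent G S H \<le> ereal (\<omega> - \<gamma>)"
    using assms(2) unfolding has_growth_gap_iff by blast
  have "0 \<le> growth_exponent G S {\<one>}" by (rule growth_exponent_nonneg) simp
  also have "\<dots> \<le> ereal (\<omega> - \<gamma>)" by (rule \<gamma>(2)[OF infinite_rcosets_trivial[OF assms(1)]])
  finally show ?thesis using \<gamma>(1) by simp
qed

text \<open>A ball for \<open>S\<close> lies in a ball for \<open>T\<close> of proportional radius,
  so exponential growth persists.\<close>

lemma (in word_metric) \<omega>_pos_change_generators:
  assumes "finite_symmetric_generating_set G T" "\<omega> > 0"
  shows "word_metric.\<omega> G T > 0"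
proof (rule ccontr)
  interpret T: word_metric G T by standard (rule assms)
  assume "\<not> T.\<omega> > 0"
  obtain lam where lam: "lam \<ge> 1" "\<And>g. g \<in> carrier G \<Longrightarrow> T.len g \<le> lam * len g" using T.bilipschitz[OF gens] by auto
  define \<epsilon> where "\<epsilon> = \<omega> / (2 * real lam)"
  have "\<epsilon> > 0" using lam assms by (simp add: \<epsilon>_def)
  then obtain K where K: "\<And>n. real (card (T.B n)) \<le> K * exp ((T.\<omega> + \<epsilon>) * real n)" "K > 0" using T.card_B_le_exp by blast
  define r where "r = exp (\<omega> / 2)"
  have "r > 1" using assms by (simp add: r_def)
  have "r ^ n \<le> K" for n
  proof -
    have sub: "B n \<subseteq> T.B (lam * n)"
    proof
      fix g assume "g \<in> B n"
      then have g: "g \<in> carrier G" "len g \<le> n" by (auto simp: in_B)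
      then have "lam * len g \<le> lam * n" by simp
      then show "g \<in> T.B (lam * n)" using lam(2)[OF g(1)] g by (auto simp: T.in_B intro: order_trans)
    qed
    have "exp (\<omega> * n) \<le> card (B n)" by (rule exp_le_card_B)
    also have "\<dots> \<le> card (T.B (lam * n))" using sub by (simp add: card_mono)
    also have "\<dots> \<le> K * exp ((T.\<omega> + \<epsilon>) * real (lam * n))" by (rule K)
    also have "\<dots> \<le> K * exp (\<epsilon> * real (lam * n))"
      using K(2) \<open>\<not> T.\<omega> > 0\<close> by (intro mult_left_mono) (auto intro!: mult_right_mono)
    also have "\<epsilon> * real (lam * n) = \<omega> / 2 * n" using lam by (simp add: \<epsilon>_def)
    finally have "r ^ n * r ^ n \<le> K * r ^ n" by (simp add: r_def mult.commute flip: exp_of_nat_mult exp_add)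
    then show ?thesis using \<open>r > 1\<close> by simp
  qed
  moreover obtain n where "K < r ^ n" using linear_less_power[OF \<open>r > 1\<close>, of 0 K] by auto
  ultimately show False by (meson not_le)
qed

lemma (in hyperbolic_metric) ex_growing_hyperbolic:
  assumes "\<omega> > 0" shows "\<exists>D. growing_hyperbolic G S \<delta> D"
proof
  \<comment> \<open>The summand \<open>ln 4 / \<omega>\<close> produces the factor 1/4 in
    \<open>D_small\<close>.\<close>
  define D where "D = nat \<lceil>2 * \<delta> + ln 4 / \<omega>\<rceil>"
  have "(0::real) \<le> ln 4" by simp
  then have D: "2 * \<delta> + ln 4 / \<omega> \<le> D" "0 \<le> ln 4 / \<omega>" using assms unfolding D_def by (linarith, simp)
  then have "2 * \<delta> \<le> D" by linarith
  have "\<omega> * (2 * \<delta> - D) \<le> \<omega> * (- (ln 4 / \<omega>))" using D assms by (intro mult_left_mono) auto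
  then have "exp (\<omega> * (2 * \<delta> - D)) \<le> exp (- ln 4)" using assms by simp
  also have "\<dots> = 1 / 4" by (simp add: exp_minus)
  finally show "growing_hyperbolic G S \<delta> D" using \<open>2 * \<delta> \<le> D\<close> assms by unfold_locales auto
qed

theorem theorem1p4:
  fixes G :: "('a, 'b) monoid_scheme"
  assumes "hyperbolic_group G"
    and "\<not> virtually_cyclic G"
    and "\<exists>S. finite_symmetric_generating_set G S \<and> has_growth_gap G S"
  shows "\<forall>T. finite_symmetric_generating_set G T \<longrightarrow> has_growth_gap G T"
proof (intro allI impI)
  fix T assume T_gens: "finite_symmetric_generating_set G T"
  obtain S where S_gens: "finite_symmetric_generating_set G S" and S_gap: "has_growth_gap G S" using assms(3) by blast
  interpret group G using assms(1) by (simp add: hyperbolic_group_def)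
  obtain \<delta>S \<delta>T where "hyperbolic_metric G S \<delta>S" "hyperbolic_metric G T \<delta>T"
    using hyperbolic_group_hyperbolic_metric[OF assms(1)] S_gens T_gens by blast
  then interpret S: hyperbolic_metric G S \<delta>S + T: hyperbolic_metric G T \<delta>T by simp_all
  have S_pos: "S.\<omega> > 0" by (rule S.\<omega>_pos_of_gap[OF assms(2) S_gap])
  then have T_pos: "T.\<omega> > 0" by (rule S.\<omega>_pos_change_generators[OF T_gens])
  obtain DS DT where "growing_hyperbolic G S \<delta>S DS" "growing_hyperbolic G T \<delta>T DT"
    using S.ex_growing_hyperbolic[OF S_pos] T.ex_growing_hyperbolic[OF T_pos] by blast
  then interpret S: growing_hyperbolic G S \<delta>S DS + T: growing_hyperbolic G T \<delta>T DT by simp_all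
  obtain \<gamma>0 where \<gamma>0: "\<gamma>0 > 0" "\<And>H. subgroup H G \<Longrightarrow> infinite (rcosets\<^bsub>G\<^esub> H) \<Longrightarrow> growth_exponent G S H \<le> ereal (S.\<omega> - \<gamma>0)"
    using S_gap unfolding S.has_growth_gap_iff by blast
  \<comment> \<open>Halving \<open>\<gamma>0\<close> gives the strict inequality needed by
    \<open>card_le_of_growth_exponent\<close>; the cap \<open>S.\<omega> / 2\<close> is the
    condition of \<open>weighted_subgroup_sum_le\<close>.\<close>
  define \<gamma> where "\<gamma> = min (\<gamma>0 / 2) (S.\<omega> / 2)"
  have \<gamma>: "\<gamma> > 0" "\<gamma> \<le> S.\<omega> / 2" "\<gamma> < \<gamma>0" using \<gamma>0(1) S_pos by (auto simp: \<gamma>_def)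
  obtain A where A: "A > 0" "\<And>N g. g \<in> carrier G \<Longrightarrow> (\<Sum>s\<in>S.B N. exp (- (S.\<omega> / 2 * S.len (inv\<^bsub>G\<^esub> s \<otimes>\<^bsub>G\<^esub> g))))
     \<le> A * (real N + 1)\<^sup>2 * exp (S.\<omega> / 2 * N) * exp (- (S.\<omega> / 2 * S.len g))"
    using S.ball_sum_le by blast
  obtain C1 where C1: "C1 \<ge> 1" "\<And>k. real (card (T.Sph k)) \<le> C1 * exp (T.\<omega> * k)" using T.card_Sph_le by blast
  obtain c where c: "c > 0" "\<And>R. \<exists>M. \<forall>(\<pi> :: 'a \<Rightarrow> 'a set finsupp \<Rightarrow> 'a set finsupp) C f n. positive_rep G \<pi> C \<longrightarrow> f \<in> C \<longrightarrow> norm f \<le> 1 \<longrightarrow>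
     M \<le> norm (\<Sum>h\<in>T.B n. T.p h *\<^sub>R \<pi> h f) \<longrightarrow>
     (\<forall>x\<in>T.B R. c * (norm (\<Sum>h\<in>T.B n. T.p h *\<^sub>R \<pi> h f))\<^sup>2
        \<le> inner (\<Sum>h\<in>T.B n. T.p h *\<^sub>R \<pi> h f) (\<pi> x (\<Sum>h\<in>T.B n. T.p h *\<^sub>R \<pi> h f)))"
    using T.ex_almost_invariant[where ?'v = "'a set finsupp"] by blast
  have "(\<lambda>N. A * (real N + 1)\<^sup>2 * exp (- \<gamma> * N)) \<longlonglongrightarrow> 0" using A(1) \<gamma>(1) by real_asymp
  then have "\<forall>\<^sub>F N in sequentially. A * (real N + 1)\<^sup>2 * exp (- \<gamma> * N) < c" using c(1) by (rule order_tendstoD)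
  then obtain N :: nat where N: "A * (real N + 1)\<^sup>2 * exp (- \<gamma> * N) < c" by (auto simp: eventually_sequentially)
  obtain lam where lam: "\<And>g. g \<in> carrier G \<Longrightarrow> T.len g \<le> lam * S.len g" using T.bilipschitz[OF S_gens] by blast
  have BN: "S.B N \<subseteq> T.B (lam * N)"
  proof
    fix g assume g: "g \<in> S.B N"
    then have "lam * S.len g \<le> lam * N" by (simp add: S.in_B)
    then show "g \<in> T.B (lam * N)" using lam[of g] g by (auto simp: S.in_B T.in_B intro: order_trans)
  qed
  obtain M where M: "\<And>(\<pi> :: 'a \<Rightarrow> 'a set finsupp \<Rightarrow> 'a set finsupp) C f n x. positive_rep G \<pi> C \<Longrightarrow> f \<in> C \<Longrightarrow> norm f \<le> 1 \<Longrightarrow>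
     M \<le> norm (\<Sum>h\<in>T.B n. T.p h *\<^sub>R \<pi> h f) \<Longrightarrow> x \<in> T.B (lam * N) \<Longrightarrow>
     c * (norm (\<Sum>h\<in>T.B n. T.p h *\<^sub>R \<pi> h f))\<^sup>2
        \<le> inner (\<Sum>h\<in>T.B n. T.p h *\<^sub>R \<pi> h f) (\<pi> x (\<Sum>h\<in>T.B n. T.p h *\<^sub>R \<pi> h f))"
  proof (rule exE[OF c(2)[of "lam * N"]], goal_cases)
    case (1 M)
    show ?case by (rule that, rule 1[rule_format]; assumption)
  qed
  show "has_growth_gap G T"
  proof (rule ccontr)
    assume no_gap: "\<not> has_growth_gap G T"
    \<comment> \<open>The three summands yield \<open>n \<ge> 1\<close>, the condition
      \<open>1 \<le> T.\<omega> * n\<close> of \<open>ex_large_U\<close>, and, through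
      \<open>norm_weighted_sum_ge\<close>, \<open>M \<le> norm u\<close>.\<close>
    define n where "n = nat \<lceil>1 + 1 / T.\<omega> + (M * (exp 1 * C1))\<^sup>2\<rceil>"
    have "1 + 1 / T.\<omega> + (M * (exp 1 * C1))\<^sup>2 \<le> n" unfolding n_def by (rule real_nat_ceiling_ge)
    moreover have "0 \<le> 1 / T.\<omega>" "0 \<le> (M * (exp 1 * C1))\<^sup>2" using T_pos by simp_all
    ultimately have n: "1 \<le> real n" "1 / T.\<omega> \<le> n" "(M * (exp 1 * C1))\<^sup>2 \<le> n" by linarith+
    have n1: "1 \<le> n" "1 \<le> T.\<omega> * real n" using n T_pos by (simp_all add: field_simps)
    have "1 / real n > 0" using n by simp
    then obtain H where H: "subgroup H G" "infinite (rcosets\<^bsub>G\<^esub> H)" "\<not> growth_exponent G T H \<le> ereal (T.\<omega> - 1 / n)"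
      using no_gap unfolding T.has_growth_gap_iff by blast
    define \<pi> C e where "\<pi> = coset_action H" "C = coset_cone H" "e = coset_vector H"
    interpret crS: coset_rep G S \<pi> C H e unfolding \<pi>_C_e_def by (rule S.coset_rep_coset_action[OF H(1)])
    interpret crT: coset_rep G T \<pi> C H e unfolding \<pi>_C_e_def by (rule T.coset_rep_coset_action[OF H(1)])
    obtain f where f: "f \<in> C" "norm f = 1" "exp (T.\<omega> * n - 1) \<le> norm (crT.U n f)"
      using crT.ex_large_U[OF n1] H(3) by (auto simp: not_le)
    define u where "u = (\<Sum>h\<in>T.B n. T.p h *\<^sub>R \<pi> h f)"
    have uC: "u \<in> C" unfolding u_def by (intro crS.C_sum crS.C_scale crS.C_\<pi> f) (auto simp: T.in_B)
    have u_ge: "real (n + 1) / (exp 1 * C1)\<^sup>2 \<le> (norm u)\<^sup>2"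
      using crT.norm_weighted_sum_ge[OF C1 f(1,3)] by (simp add: u_def T.p_def)
    have "0 < real (n + 1) / (exp 1 * C1)\<^sup>2" using C1(1) by simp
    then have u_pos: "0 < (norm u)\<^sup>2" using u_ge by linarith
    have "M\<^sup>2 \<le> real (n + 1) / (exp 1 * C1)\<^sup>2" using n(3) C1(1) by (simp add: field_simps power_mult_distrib)
    then have "M\<^sup>2 \<le> (norm u)\<^sup>2" using u_ge by linarith
    then have "M \<le> norm u" by (rule power2_le_imp_le) simp
    then have inv: "c * (norm u)\<^sup>2 \<le> inner u (\<pi> x u)" if "x \<in> S.B N" for x
      using M[OF crS.positive_rep_axioms f(1), of n x] f(2) BN that by (auto simp: u_def)
    obtain K where K: "K > 0" "\<And>n. real (card (H \<inter> S.B n)) \<le> K * exp ((S.\<omega> - \<gamma>) * real n)"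
    proof -
      have "growth_exponent G S H < ereal (S.\<omega> - \<gamma>)" using \<gamma>0(2)[OF H(1,2)] \<gamma>(3) by (rule_tac le_less_trans) auto
      then show ?thesis using S.card_le_of_growth_exponent that by blast
    qed
    \<comment> \<open>Almost invariance summed over the \<open>S\<close>-ball, which has at least
      \<open>exp (S.\<omega> * N)\<close> elements, is confronted with the upper bound
      \<open>P_le\<close> for the same quantity.\<close>
    have "exp (S.\<omega> * N) * (c * (norm u)\<^sup>2) \<le> card (S.B N) * (c * (norm u)\<^sup>2)"
      using c(1) by (intro mult_right_mono S.exp_le_card_B) auto
    also have "\<dots> = (\<Sum>x\<in>S.B N. c * (norm u)\<^sup>2)" by simp
    also have "\<dots> \<le> (\<Sum>x\<in>S.B N. inner u (\<pi> x u))" by (intro sum_mono inv)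
    also have "\<dots> = inner (crS.P N u) u" unfolding crS.P_def inner_sum_left by (rule sum.cong[OF refl inner_commute])
    also have "\<dots> \<le> (A * (real N + 1)\<^sup>2 * exp (S.\<omega> / 2 * N)) * exp ((S.\<omega> / 2 - \<gamma>) * N) * (norm u)\<^sup>2"
      using K \<gamma> S_pos A uC by (intro crS.P_le[where K = K]) auto
    also have "\<dots> = exp (S.\<omega> * N) * ((A * (real N + 1)\<^sup>2 * exp (- \<gamma> * N)) * (norm u)\<^sup>2)"
    proof -
      have "exp (S.\<omega> / 2 * N) * exp ((S.\<omega> / 2 - \<gamma>) * N) = exp (S.\<omega> * N) * exp (- \<gamma> * N)"
        by (simp add: field_simps flip: exp_add)
      then show ?thesis by (simp add: mult_ac)
    qed
    finally have "c * (norm u)\<^sup>2 \<le> (A * (real N + 1)\<^sup>2 * exp (- \<gamma> * N)) * (norm u)\<^sup>2" by (subst (asm) mult_le_cancel_left_pos) auto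
    then have "c \<le> A * (real N + 1)\<^sup>2 * exp (- \<gamma> * N)" using u_pos by (subst (asm) mult_le_cancel_right_pos) auto
    then show False using N by linarith
  qed
qed

end
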